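(* Assume that $\mu$ is strictly contracting and admits a moment of order $2$. Let $W_0$ be a random variable with law $\nu$, independent of $(Y_n)_{n\in\mathbb N}$. Then there exists $s^2\ge 0$ such that $$\frac1n\,\mathbb E\big[(\sigma(A_n,W_0)-n\lambda_\mu)^2\big]\underset{n\to+\infty}\longrightarrow s^2$$ and $\frac1{\sqrt n}\big(\sigma(A_n,W_0)-n\lambda_\mu\big)$ converges in distribution to $\mathcal N(0,s^2)$. If there do not exist $m\in\mathbb N$ and a continuous function $\psi_m$ on $S^+$ such that $$\sigma(g,x)-m\lambda_\mu=\psi_m(x)-\psi_m(g\cdot x)\qquad\text{for }\mu^{*m}\otimes\nu\text{-almost every }(g,x)\in G\times S^+,$$ then $s^2>0$. In particular, if $\mu$ is aperiodic, then $s^2>0$.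
   Context: Let $d\ge 2$ be an integer and $\mathbb N=\{1,2,\dots\}$. $\|\cdot\|$ denotes the $\ell^1$ norm on $\mathbb R^d$ and also the associated operator norm on $d\times d$ matrices. $G$ is the semigroup of $d\times d$ real matrices with nonnegative entries such that every row and every column contains a strictly positive entry, with the topology induced by the norm; $G^+\subset G$ is the set of matrices all of whose entries are strictly positive. $S^+=\{x\in\mathbb R^d:\|x\|=1,\ x_i\ge 0\ \forall i\}$, equipped with the metric $\mathbf d(x,y)=\varphi(m(x,y)m(y,x))$, where $\varphi(s)=\frac{1-s}{1+s}$ and $m(x,y)=\inf\{x_i/y_i: 1\le i\le d,\ y_i>0\}$; continuity and Borel sets on $S^+$ refer to $\mathbf d$. For $g\in G$: $v(g)=\inf_{x\in S^+}\|gx\|$, $N(g)=\max(\|g\|,1/v(g))$, and $\kappa(g)$ is the spectral radius of $g$. For $(g,x)\in G\times S^+$, $g\cdot x=gx/\|gx\|$ and $\sigma(g,x)=\log\|gx\|$. $\mu$ is a Borel probability measure on $G$; $\mu^{*r}$ is its $r$-fold convolution (the law of a product of $r$ independent matrices of law $\mu$). $\mu$ is strictly contracting if $\mu^{*r}(G^+)>0$ for some $r\in\mathbb N$. $\mu$ admits a moment of order $p\ge1$ if $\int_G(\log N(g))^p\,d\mu(g)<\infty$. $\Gamma_\mu$ is the closed semigroup generated by the support of $\mu$. $\mu$ is aperiodic if the additive group generated by $\{\log\kappa(g): g\in\Gamma_\mu\}$ is dense in $\mathbb R$. When $\mu$ is strictly contracting there is a unique $\mu$-invariant Borel probability measure $\nu$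 on $S^+$, i.e. $\int_{G\times S^+}f(g\cdot x)\,d\mu(g)d\nu(x)=\int_{S^+} f\,d\nu$ for all nonnegative Borel $f$. $(Y_n)_{n\in\mathbb N}$ are iid with law $\mu$ and $A_n=Y_n\cdots Y_1$. $\lambda_\mu\in\mathbb R$ is the almost sure (and $L^1$) limit of $\frac1n\log\|A_n\|$, which exists and is constant as soon as $\int_G|\log\|g\||\,d\mu(g)<\infty$. $\mathcal N(0,0)$ is the Dirac mass at $0$. *)

theory Defs
  imports "HOL-Probability.Probability" "HOL-Computational_Algebra.Group_Closure"
begin

text \<open>The library norm on \<^typ>\<open>real^'n\<close> is the Euclidean one, so the \<open>\<ell>\<^sup>1\<close> norm and its operator
  norm get their own names. In \<open>op_norm\<close> the vector \<open>x = 0\<close> contributes \<open>0 / 0 = 0\<close>, as in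
  \<^const>\<open>onorm\<close>. All norms being equivalent, the library topology on matrices is the
  norm topology.\<close>

definition l1_norm :: "real^'n \<Rightarrow> real" where
  "l1_norm x = (\<Sum>i\<in>UNIV. \<bar>x $ i\<bar>)"

definition op_norm :: "real^'n^'n \<Rightarrow> real" where
  "op_norm g = (SUP x. l1_norm (g *v x) / l1_norm x)"

definition nonneg_mats :: "(real^'n^'n) set" where
  "nonneg_mats = {g. (\<forall>i j. 0 \<le> g $ i $ j) \<and> (\<forall>i. \<exists>j. 0 < g $ i $ j) \<and> (\<forall>j. \<exists>i. 0 < g $ i $ j)}"

definition pos_mats :: "(real^'n^'n) set" where
  "pos_mats = {g. \<forall>i j. 0 < g $ i $ j}"

definition mat_borel :: "(real^'n^'n) measure" where
  "mat_borel = restrict_space borel nonneg_mats"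

definition spec_radius :: "real^'n^'n \<Rightarrow> real" where
  "spec_radius g = Sup {cmod z |z. \<exists>x::complex^'n. x \<noteq> 0 \<and> (\<chi> i j. complex_of_real (g $ i $ j)) *v x = z *s x}"

definition prob_simplex :: "(real^'n) set" where
  "prob_simplex = {x. l1_norm x = 1 \<and> (\<forall>i. 0 \<le> x $ i)}"

definition ratio_inf :: "real^'n \<Rightarrow> real^'n \<Rightarrow> real" where
  "ratio_inf x y = (INF i\<in>{i. 0 < y $ i}. x $ i / y $ i)"

definition varphi :: "real \<Rightarrow> real" where
  "varphi s = (1 - s) / (1 + s)"

text \<open>The value \<open>0\<close> outside the simplex is only there because \<^locale>\<open>Metric_space\<close> asks for
  nonnegativity and symmetry on the whole type.\<close>

definition proj_dist :: "real^'n \<Rightarrow> real^'n \<Rightarrow> real" where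
  "proj_dist x y =
     (if x \<in> prob_simplex \<and> y \<in> prob_simplex then varphi (ratio_inf x y * ratio_inf y x) else 0)"

lemma ratio_inf_le:
  assumes "0 < y $ i"
  shows "ratio_inf x y \<le> x $ i / y $ i"
  unfolding ratio_inf_def by (rule cINF_lower) (use assms in auto)

lemma prob_simplexD:
  assumes "x \<in> prob_simplex"
  shows "0 \<le> x $ i" "(\<Sum>i\<in>UNIV. x $ i) = 1" "{i. 0 < x $ i} \<noteq> {}"
proof -
  show nn: "0 \<le> x $ i" for i
    using assms by (simp add: prob_simplex_def)
  show s: "(\<Sum>i\<in>UNIV. x $ i) = 1"
    using assms nn by (simp add: prob_simplex_def l1_norm_def)
  show "{i. 0 < x $ i} \<noteq> {}"
  proof
    assume "{i. 0 < x $ i} = {}"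
    hence "x $ i = 0" for i using nn[of i] by (metis empty_iff mem_Collect_eq less_eq_real_def)
    thus False using s by simp
  qed
qed

lemma ratio_inf_mult_le:
  assumes "x \<in> prob_simplex" "y \<in> prob_simplex"
  shows "ratio_inf x y * y $ i \<le> x $ i"
proof (cases "0 < y $ i")
  case True
  then show ?thesis using ratio_inf_le[OF True, of x] by (simp add: field_simps)
next
  case False
  then show ?thesis using prob_simplexD(1)[OF assms(1), of i] prob_simplexD(1)[OF assms(2), of i] by simp
qed

lemma ratio_inf_greatest:
  assumes "y \<in> prob_simplex" "\<And>i. 0 < y $ i \<Longrightarrow> c \<le> x $ i / y $ i"
  shows "c \<le> ratio_inf x y"
  unfolding ratio_inf_def using prob_simplexD(3)[OF assms(1)] assms(2) by (intro cINF_greatest) auto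

lemma ratio_inf_nonneg:
  assumes "x \<in> prob_simplex" "y \<in> prob_simplex"
  shows "0 \<le> ratio_inf x y"
  using assms by (intro ratio_inf_greatest) (auto intro!: divide_nonneg_pos prob_simplexD(1))

lemma ratio_inf_le_1:
  assumes "x \<in> prob_simplex" "y \<in> prob_simplex"
  shows "ratio_inf x y \<le> 1"
proof -
  have "(\<Sum>i\<in>UNIV. ratio_inf x y * y $ i) \<le> (\<Sum>i\<in>UNIV. x $ i)"
    by (intro sum_mono ratio_inf_mult_le assms)
  thus ?thesis using prob_simplexD(2)[OF assms(1)] prob_simplexD(2)[OF assms(2)]
    by (simp flip: sum_distrib_left)
qed

lemma ratio_inf_trans:
  assumes "x \<in> prob_simplex" "y \<in> prob_simplex" "z \<in> prob_simplex"
  shows "ratio_inf x y * ratio_inf y z \<le> ratio_inf x z"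
proof (rule ratio_inf_greatest[OF assms(3)])
  fix i assume z: "0 < z $ i"
  have "ratio_inf x y * (ratio_inf y z * z $ i) \<le> ratio_inf x y * y $ i"
    by (intro mult_left_mono ratio_inf_mult_le ratio_inf_nonneg assms)
  also have "\<dots> \<le> x $ i" by (intro ratio_inf_mult_le assms)
  finally show "ratio_inf x y * ratio_inf y z \<le> x $ i / z $ i"
    using z by (simp add: field_simps)
qed

lemma varphi_antimono: "0 \<le> s \<Longrightarrow> s \<le> t \<Longrightarrow> varphi t \<le> varphi s"
  unfolding varphi_def by (simp add: divide_simps algebra_simps)

lemma varphi_mult_le:
  assumes "0 \<le> s" "s \<le> 1" "0 \<le> t" "t \<le> 1"
  shows "varphi (s * t) \<le> varphi s + varphi t"
proof -
  have st: "0 \<le> s * t" "s * t \<le> 1" using assms by (auto intro: mult_le_one)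
  have "0 \<le> (1 - s) * (1 - t)" using assms by simp
  hence "(1 + s) * (1 + t) \<le> 2 * (1 + s * t)" by (simp add: algebra_simps)
  moreover have pos: "0 < (1 + s) * (1 + t)" using assms by (intro mult_pos_pos) auto
  ultimately have "2 * (1 - s * t) / (2 * (1 + s * t)) \<le> 2 * (1 - s * t) / ((1 + s) * (1 + t))"
    using st mult_pos_pos[OF pos, of "2 * (1 + s * t)"] by (intro divide_left_mono) (simp_all add: mult.commute)
  hence "varphi (s * t) \<le> 2 * (1 - s * t) / ((1 + s) * (1 + t))"
    unfolding varphi_def by (subst (asm) mult_divide_mult_cancel_left) auto
  also have "\<dots> = varphi s + varphi t"
    unfolding varphi_def using assms by (simp add: divide_simps) (simp add: algebra_simps)
  finally show ?thesis .
qed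

lemma Metric_space_proj_dist: "Metric_space prob_simplex proj_dist"
proof
  show "0 \<le> proj_dist x y" for x y :: "real^'n"
    by (auto simp: proj_dist_def varphi_def ratio_inf_nonneg ratio_inf_le_1
             intro!: divide_nonneg_nonneg mult_le_one)
  show "proj_dist x y = proj_dist y x" for x y :: "real^'n"
    by (simp add: proj_dist_def mult.commute)
  show "proj_dist x y = 0 \<longleftrightarrow> x = y" if xy: "x \<in> prob_simplex" "y \<in> prob_simplex" for x y :: "real^'n"
  proof
    note le1 = ratio_inf_le_1[OF xy] ratio_inf_le_1[OF xy(2,1)]
    note ge0 = ratio_inf_nonneg[OF xy] ratio_inf_nonneg[OF xy(2,1)]
    assume "proj_dist x y = 0"
    hence "ratio_inf x y * ratio_inf y x = 1"
      using xy ge0 by (auto simp: proj_dist_def varphi_def add_nonneg_eq_0_iff)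
    hence "ratio_inf x y = 1" "ratio_inf y x = 1"
      using le1 ge0 by (smt (verit) mult_left_le mult_left_le_one_le)+
    thus "x = y"
      using ratio_inf_mult_le[OF xy] ratio_inf_mult_le[OF xy(2,1)] by (simp add: vec_eq_iff order_antisym)
  next
    assume "x = y"
    have "1 \<le> ratio_inf x x" by (intro ratio_inf_greatest xy) simp
    hence "ratio_inf x x = 1" using ratio_inf_le_1[OF xy(1) xy(1)] by simp
    thus "proj_dist x y = 0" using \<open>x = y\<close> by (simp add: proj_dist_def varphi_def)
  qed
  show "proj_dist x z \<le> proj_dist x y + proj_dist y z"
    if xyz: "x \<in> prob_simplex" "y \<in> prob_simplex" "z \<in> prob_simplex" for x y z :: "real^'n"
  proof -
    note nn = ratio_inf_nonneg[OF xyz(1,2)] ratio_inf_nonneg[OF xyz(2,1)]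
      ratio_inf_nonneg[OF xyz(2,3)] ratio_inf_nonneg[OF xyz(3,2)]
    note le1 = ratio_inf_le_1[OF xyz(1,2)] ratio_inf_le_1[OF xyz(2,1)]
      ratio_inf_le_1[OF xyz(2,3)] ratio_inf_le_1[OF xyz(3,2)]
    have "(ratio_inf x y * ratio_inf y z) * (ratio_inf z y * ratio_inf y x)
            \<le> ratio_inf x z * ratio_inf z x"
      by (intro mult_mono ratio_inf_trans xyz mult_nonneg_nonneg nn ratio_inf_nonneg)
    hence "varphi (ratio_inf x z * ratio_inf z x)
            \<le> varphi ((ratio_inf x y * ratio_inf y x) * (ratio_inf y z * ratio_inf z y))"
      using nn by (intro varphi_antimono) (auto simp: mult_ac)
    also have "\<dots> \<le> varphi (ratio_inf x y * ratio_inf y x) + varphi (ratio_inf y z * ratio_inf z y)"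
      using nn le1 by (intro varphi_mult_le mult_le_one mult_nonneg_nonneg)
    finally show ?thesis using xyz by (simp add: proj_dist_def)
  qed
qed

text \<open>This topology is finer than the Euclidean one: points with different supports are at
  distance \<open>1\<close>.\<close>

definition simplex_top :: "(real^'n) topology" where
  "simplex_top = Metric_space.mtopology prob_simplex proj_dist"

definition simplex_borel :: "(real^'n) measure" where
  "simplex_borel = sigma prob_simplex {U. openin simplex_top U}"

definition vmin :: "real^'n^'n \<Rightarrow> real" where
  "vmin g = (INF x\<in>prob_simplex. l1_norm (g *v x))"

definition Nfun :: "real^'n^'n \<Rightarrow> real" where
  "Nfun g = max (op_norm g) (1 / vmin g)"

definition act :: "real^'n^'n \<Rightarrow> real^'n \<Rightarrow> real^'n" where
  "act g x = (1 / l1_norm (g *v x)) *\<^sub>R (g *v x)"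

definition cocycle :: "real^'n^'n \<Rightarrow> real^'n \<Rightarrow> real" where
  "cocycle g x = ln (l1_norm (g *v x))"

primrec conv_pow :: "(real^'n^'n) measure \<Rightarrow> nat \<Rightarrow> (real^'n^'n) measure" where
  "conv_pow \<mu> 0 = return mat_borel (mat 1)"
| "conv_pow \<mu> (Suc r) = distr (\<mu> \<Otimes>\<^sub>M conv_pow \<mu> r) mat_borel (\<lambda>(g, h). g ** h)"

definition strictly_contracting :: "(real^'n^'n) measure \<Rightarrow> bool" where
  "strictly_contracting \<mu> \<longleftrightarrow> (\<exists>r\<ge>1. emeasure (conv_pow \<mu> r) pos_mats > 0)"

definition has_moment :: "real \<Rightarrow> (real^'n^'n) measure \<Rightarrow> bool" where
  "has_moment p \<mu> \<longleftrightarrow> (\<integral>\<^sup>+ g. ennreal (ln (Nfun g) powr p) \<partial>\<mu>) < \<infinity>"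

definition msupport :: "(real^'n^'n) measure \<Rightarrow> (real^'n^'n) set" where
  "msupport \<mu> = {g \<in> nonneg_mats. \<forall>U. openin (top_of_set nonneg_mats) U \<and> g \<in> U \<longrightarrow> emeasure \<mu> U > 0}"

text \<open>Closedness is relative to \<^const>\<open>nonneg_mats\<close>, which is not closed in the space of all matrices.\<close>

definition closed_semigroup :: "(real^'n^'n) measure \<Rightarrow> (real^'n^'n) set" where
  "closed_semigroup \<mu> = \<Inter> {T. closedin (top_of_set nonneg_mats) T \<and> msupport \<mu> \<subseteq> T \<and>
                               (\<forall>g\<in>T. \<forall>h\<in>T. g ** h \<in> T)}"

definition aperiodic :: "(real^'n^'n) measure \<Rightarrow> bool" where
  "aperiodic \<mu> \<longleftrightarrow>
     closure (group_closure ((\<lambda>g. ln (spec_radius g)) ` closed_semigroup \<mu>)) = UNIV"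

definition invariant_prob :: "(real^'n^'n) measure \<Rightarrow> (real^'n) measure \<Rightarrow> bool" where
  "invariant_prob \<mu> \<nu> \<longleftrightarrow> prob_space \<nu> \<and> sets \<nu> = sets simplex_borel \<and>
     (\<forall>f\<in>borel_measurable simplex_borel.
        (\<integral>\<^sup>+ (g, x). f (act g x) \<partial>(\<mu> \<Otimes>\<^sub>M \<nu>)) = (\<integral>\<^sup>+ x. f x \<partial>\<nu>))"

primrec mat_prod :: "(nat \<Rightarrow> 'w \<Rightarrow> real^'n^'n) \<Rightarrow> nat \<Rightarrow> 'w \<Rightarrow> real^'n^'n" where
  "mat_prod Y 0 \<omega> = mat 1"
| "mat_prod Y (Suc n) \<omega> = Y (Suc n) \<omega> ** mat_prod Y n \<omega>"

definition is_lyapunov :: "'w measure \<Rightarrow> (nat \<Rightarrow> 'w \<Rightarrow> real^'n^'n) \<Rightarrow> real \<Rightarrow> bool" where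
  "is_lyapunov M Y l \<longleftrightarrow> (AE \<omega> in M. (\<lambda>n. 1 / real n * ln (op_norm (mat_prod Y n \<omega>))) \<longlonglongrightarrow> l)"

text \<open>The two sigma algebras generated by \<open>W\<close> and by the whole sequence are independent. (The
  library's \<open>indep_var\<close> only covers variables with values in the same type.)\<close>

definition indep_of_seq ::
    "'w measure \<Rightarrow> ('w \<Rightarrow> real^'n) \<Rightarrow> (nat \<Rightarrow> 'w \<Rightarrow> real^'n^'n) \<Rightarrow> bool" where
  "indep_of_seq M W Y \<longleftrightarrow> prob_space.indep_set M
     (sets (vimage_algebra (space M) W simplex_borel))
     (sets (vimage_algebra (space M) (\<lambda>\<omega>. \<lambda>n\<in>{1..}. Y n \<omega>) (Pi\<^sub>M {1..} (\<lambda>_. mat_borel))))"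

text \<open>\<^const>\<open>normal_density\<close> takes the standard deviation as its parameter, and degenerates for \<open>0\<close>.\<close>

definition normal_law :: "real \<Rightarrow> real measure" where
  "normal_law s2 = (if s2 = 0 then return borel 0
                    else density lborel (\<lambda>x. ennreal (normal_density 0 (sqrt s2) x)))"

end

theory Submission
  imports Defs
begin

text \<open>The proof is a martingale approximation, carried out with the Markov operator
  \<open>P u (x) = \<integral> u(g \<cdot> x) d\<mu>(g)\<close> of the chain \<open>A\<^sub>n \<cdot> x\<close> on the simplex.

  Every matrix of the semigroup is nonexpanding for the distance, and the matrices with entries in
  \<open>[\<delta>, 1 / \<delta>]\<close> contract it by a fixed factor (\<open>gap_act_contract\<close>). By strict contraction a product of
  some fixed length is of the second kind with positive probability for a small \<open>\<delta>\<close>, so the powers of \<open>P\<close>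
  shrink Lipschitz constants exponentially fast (\<open>exponential_contraction\<close>). Consequently
  \<open>U - P U = u - \<integral> u d\<nu>\<close> has a bounded Lipschitz solution \<open>U\<close> for every bounded Lipschitz \<open>u\<close>
  (\<open>poisson_equation\<close>). This equation is used twice.

  The drift \<open>x \<mapsto> \<integral> \<sigma>(g, x) d\<mu>(g)\<close> is bounded and Lipschitz. Let \<open>\<lambda>\<close> be its mean under \<open>\<nu>\<close> and \<open>\<psi>\<close> the
  solution of Poisson's equation for it. The increments \<open>h(g, x) = \<sigma>(g, x) - \<lambda> + \<psi>(g \<cdot> x) - \<psi>(x)\<close> then
  have mean zero under \<open>\<mu>\<close> from every point \<open>x\<close>. They add up to a martingale which stays within
  \<open>2 sup \<bar>\<psi>\<bar>\<close> of \<open>\<sigma>(A\<^sub>n, x) - n \<lambda>\<close>, and whose second moment from the stationary law is exactly \<open>n v\<close>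
  (\<open>nn_integral_msum_sq\<close>), where \<open>v\<close> is the mean under \<open>\<nu>\<close> of the conditional variance
  \<open>V(x) = \<integral> h(g, x)\<^sup>2 d\<mu>(g)\<close>. This \<open>v\<close> is the asymptotic variance.

  By the moment of order two \<open>V\<close> is bounded and Lipschitz as well. Let \<open>U\<close> solve Poisson's equation for
  \<open>V\<close>, and twist \<open>P\<close> by \<open>exp (i s h)\<close>. On the function \<open>1 - s\<^sup>2 U / 2\<close> the twisted operator acts as
  multiplication by \<open>1 - s\<^sup>2 v / 2\<close> up to \<open>o(s\<^sup>2)\<close>, uniformly in \<open>x\<close> (\<open>twisted_step_corr\<close>). With
  \<open>s = t / \<surd>n\<close> and \<open>n\<close> iterations, the characteristic functions converge to \<open>exp (- t\<^sup>2 v / 2)\<close>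
  (\<open>integral_iexp_msum_tendsto\<close>), and Levy's continuity theorem applies.

  The measure \<open>\<nu>\<close> does not charge the boundary of the simplex (\<open>AE_nu_positive\<close>). At an interior point
  \<open>\<sigma>(A\<^sub>n, x)\<close> and \<open>log \<parallel>A\<^sub>n\<parallel>\<close> differ by a bounded amount, so \<open>\<lambda>\<close> is the Lyapunov exponent.

  If \<open>v = 0\<close>, then \<open>h = 0\<close> almost everywhere, which is the coboundary relation with \<open>m = 1\<close> and the
  continuous function \<open>\<psi>\<close>. On the interior of the simplex \<open>h\<close> is continuous in \<open>(g, x)\<close>, so it vanishes
  on the product of the supports of \<open>\<mu>\<close> and \<open>\<nu>\<close>. It follows that for each \<open>g\<close> in the closed semigroup
  \<open>\<sigma>(g, x) + \<psi>(g \<cdot> x) - \<psi>(x)\<close> is an integer multiple of \<open>\<lambda>\<close> that does not depend on the point \<open>x\<close> of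
  the support (\<open>closed_semigroup_subset_lattice_mats\<close>). Iterating \<open>g\<close> shows that this multiple is the
  logarithm of the spectral radius (\<open>ln_spec_radius_lattice_mats\<close>), and so \<open>\<mu>\<close> is not aperiodic.\<close>

section \<open>The action of nonnegative matrices on the simplex\<close>

text \<open>The column sums of a nonnegative matrix are the \<open>\<ell>\<^sup>1\<close> norms of the images of the basis
  vectors, so they control \<open>l1_norm (g *v x)\<close> on the whole simplex.\<close>

definition col_sum :: "real^'n^'n \<Rightarrow> 'n \<Rightarrow> real" where
  "col_sum g j = (\<Sum>i\<in>UNIV. g $ i $ j)"

lemma nonneg_matsD:
  assumes "g \<in> nonneg_mats"
  shows "0 \<le> g $ i $ j" "\<exists>j. 0 < g $ i $ j" "\<exists>i. 0 < g $ i $ j"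
  using assms by (auto simp: nonneg_mats_def)

lemma pos_mats_subset: "pos_mats \<subseteq> nonneg_mats"
  by (auto simp: pos_mats_def nonneg_mats_def less_imp_le)

lemma mat_1_nonneg_mats: "mat 1 \<in> nonneg_mats"
proof -
  have "0 < (mat 1 :: real^'n^'n) $ i $ i" for i by (simp add: mat_def)
  then show ?thesis unfolding nonneg_mats_def by (auto simp: mat_def)
qed

lemma nonneg_mats_mult:
  assumes "g \<in> nonneg_mats" "h \<in> nonneg_mats"
  shows "g ** h \<in> nonneg_mats"
proof -
  have pos: "0 < (g ** h) $ i $ k" if "0 < g $ i $ j" "0 < h $ j $ k" for i j k
    unfolding matrix_matrix_mult_def using that nonneg_matsD(1)[OF assms(1)] nonneg_matsD(1)[OF assms(2)]
    by (auto intro!: sum_pos2[where i = j])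
  have "\<exists>k. 0 < (g ** h) $ i $ k" for i
    using pos nonneg_matsD(2)[OF assms(1)] nonneg_matsD(2)[OF assms(2)] by blast
  moreover have "\<exists>i. 0 < (g ** h) $ i $ k" for k
    using pos nonneg_matsD(3)[OF assms(1)] nonneg_matsD(3)[OF assms(2)] by blast
  moreover have "0 \<le> (g ** h) $ i $ k" for i k
    unfolding matrix_matrix_mult_def using nonneg_matsD(1)[OF assms(1)] nonneg_matsD(1)[OF assms(2)]
    by (auto intro!: sum_nonneg)
  ultimately show ?thesis by (auto simp: nonneg_mats_def)
qed

lemma col_sum_pos: "g \<in> nonneg_mats \<Longrightarrow> 0 < col_sum g j"
  unfolding col_sum_def
  using nonneg_matsD(1)[of g _ j] nonneg_matsD(3)[of g j] by (auto intro: sum_pos2)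

lemma matvec_nonneg:
  assumes "g \<in> nonneg_mats" "\<And>j. 0 \<le> x $ j"
  shows "0 \<le> (g *v x) $ i"
  using assms nonneg_matsD(1)[OF assms(1)] by (auto simp: matrix_vector_mult_def intro!: sum_nonneg)

lemma matvec_mono:
  assumes "g \<in> nonneg_mats" "\<And>j. y $ j \<le> x $ j"
  shows "(g *v y) $ i \<le> (g *v x) $ i"
  using assms nonneg_matsD(1)[OF assms(1)]
  by (auto simp: matrix_vector_mult_def intro!: sum_mono mult_left_mono)

lemma sum_matvec: "(\<Sum>i\<in>UNIV. (g *v x) $ i) = (\<Sum>j\<in>UNIV. col_sum g j * x $ j)"
  for g :: "real^'n^'n"
  unfolding col_sum_def matrix_vector_mult_def
  by (simp add: sum_distrib_right) (rule sum.swap)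

lemma l1_norm_nonneg_vec: "(\<And>i. 0 \<le> x $ i) \<Longrightarrow> l1_norm x = (\<Sum>i\<in>UNIV. x $ i)"
  by (simp add: l1_norm_def)

lemma l1_norm_matvec:
  assumes "g \<in> nonneg_mats" "x \<in> prob_simplex"
  shows "l1_norm (g *v x) = (\<Sum>j\<in>UNIV. col_sum g j * x $ j)"
  using assms by (simp add: l1_norm_nonneg_vec matvec_nonneg prob_simplexD sum_matvec)

lemma l1_norm_matvec_pos:
  assumes "g \<in> nonneg_mats" "x \<in> prob_simplex"
  shows "0 < l1_norm (g *v x)"
proof -
  obtain j where "0 < x $ j" using prob_simplexD(3)[OF assms(2)] by auto
  then show ?thesis
    unfolding l1_norm_matvec[OF assms]
    using col_sum_pos[OF assms(1)] prob_simplexD(1)[OF assms(2)]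
    by (intro sum_pos2[where i = j] mult_nonneg_nonneg) (auto simp: less_imp_le)
qed

lemma l1_norm_matvec_between:
  assumes "g \<in> nonneg_mats" "x \<in> prob_simplex"
    and "\<And>j. a \<le> col_sum g j" "\<And>j. col_sum g j \<le> b"
  shows "a \<le> l1_norm (g *v x)" "l1_norm (g *v x) \<le> b"
proof -
  have "(\<Sum>j\<in>UNIV. a * x $ j) \<le> l1_norm (g *v x)" "l1_norm (g *v x) \<le> (\<Sum>j\<in>UNIV. b * x $ j)"
    unfolding l1_norm_matvec[OF assms(1,2)]
    using assms(3,4) prob_simplexD(1)[OF assms(2)] by (auto intro!: sum_mono mult_right_mono)
  then show "a \<le> l1_norm (g *v x)" "l1_norm (g *v x) \<le> b"
    using prob_simplexD(2)[OF assms(2)] by (simp_all flip: sum_distrib_left)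
qed

lemma l1_norm_scaleR: "l1_norm (c *\<^sub>R x) = \<bar>c\<bar> * l1_norm x"
  by (simp add: l1_norm_def abs_mult sum_distrib_left)

lemma act_in_simplex:
  assumes "g \<in> nonneg_mats" "x \<in> prob_simplex"
  shows "act g x \<in> prob_simplex"
  using l1_norm_matvec_pos[OF assms] matvec_nonneg[OF assms(1) prob_simplexD(1)[OF assms(2)]]
  unfolding prob_simplex_def act_def by (simp add: l1_norm_scaleR)

lemma l1_norm_mult_act:
  assumes "g \<in> nonneg_mats" "h \<in> nonneg_mats" "x \<in> prob_simplex"
  shows "l1_norm ((g ** h) *v x) = l1_norm (g *v act h x) * l1_norm (h *v x)"
  using l1_norm_matvec_pos[OF assms(2,3)] unfolding act_def
  by (simp add: matrix_vector_mul_assoc[symmetric] matrix_vector_mult_scaleR l1_norm_scaleR)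

lemma act_mult:
  assumes "g \<in> nonneg_mats" "h \<in> nonneg_mats" "x \<in> prob_simplex"
  shows "act (g ** h) x = act g (act h x)"
proof -
  have "act (g ** h) x = (1 / (l1_norm (g *v act h x) * l1_norm (h *v x))) *\<^sub>R (g *v (h *v x))"
    unfolding act_def[of "g ** h"] l1_norm_mult_act[OF assms] by (simp add: matrix_vector_mul_assoc)
  also have "\<dots> = (1 / l1_norm (g *v act h x)) *\<^sub>R (g *v act h x)"
    unfolding act_def[of h] by (simp add: matrix_vector_mult_scaleR)
  finally show ?thesis by (simp add: act_def[of g])
qed

lemma cocycle_mult:
  assumes "g \<in> nonneg_mats" "h \<in> nonneg_mats" "x \<in> prob_simplex"
  shows "cocycle (g ** h) x = cocycle g (act h x) + cocycle h x"
  unfolding cocycle_def l1_norm_mult_act[OF assms]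
  using l1_norm_matvec_pos[OF assms(2,3)] l1_norm_matvec_pos[OF assms(1) act_in_simplex[OF assms(2,3)]]
  by (simp add: ln_mult)

lemma act_one: "x \<in> prob_simplex \<Longrightarrow> act (mat 1) x = x"
  by (simp add: act_def prob_simplex_def)

lemma cocycle_one: "x \<in> prob_simplex \<Longrightarrow> cocycle (mat 1) x = 0"
  by (simp add: cocycle_def prob_simplex_def)

text \<open>A bound for the cocycle that is uniform on the simplex, comparable with \<open>ln (Nfun g)\<close> and,
  unlike the latter, visibly measurable.\<close>

definition log_size :: "real^'n^'n \<Rightarrow> real" where
  "log_size g = (\<Sum>j\<in>UNIV. \<bar>ln (col_sum g j)\<bar>)"

lemma log_size_nonneg: "0 \<le> log_size g"
  by (simp add: log_size_def sum_nonneg)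

lemma abs_cocycle_le:
  assumes "g \<in> nonneg_mats" "x \<in> prob_simplex"
  shows "\<bar>cocycle g x\<bar> \<le> log_size g"
proof -
  have le: "\<bar>ln (col_sum g j)\<bar> \<le> log_size g" for j
    unfolding log_size_def by (rule member_le_sum) auto
  have "exp (- log_size g) \<le> col_sum g j" "col_sum g j \<le> exp (log_size g)" for j
    using le[of j] col_sum_pos[OF assms(1), of j]
    by (metis abs_le_iff exp_le_cancel_iff exp_ln neg_le_iff_le minus_minus)+
  then have "exp (- log_size g) \<le> l1_norm (g *v x)" "l1_norm (g *v x) \<le> exp (log_size g)"
    by (intro l1_norm_matvec_between assms; auto)+
  then have "- log_size g \<le> ln (l1_norm (g *v x))" "ln (l1_norm (g *v x)) \<le> log_size g"
    using l1_norm_matvec_pos[OF assms] ln_le_cancel_iff[of "l1_norm (g *v x)" "exp (log_size g)"]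
    by (simp_all add: ln_ge_iff)
  then show ?thesis unfolding cocycle_def by linarith
qed

lemma l1_norm_eq_0: "l1_norm x = 0 \<longleftrightarrow> x = 0"
  by (simp add: l1_norm_def sum_nonneg_eq_0_iff vec_eq_iff)

lemma l1_norm_nonneg: "0 \<le> l1_norm x"
  by (simp add: l1_norm_def sum_nonneg)

lemma l1_norm_matvec_le:
  assumes "g \<in> nonneg_mats" "\<And>j. col_sum g j \<le> b"
  shows "l1_norm (g *v x) \<le> b * l1_norm x"
proof -
  have "l1_norm (g *v x) \<le> (\<Sum>i\<in>UNIV. (g *v (\<chi> j. \<bar>x $ j\<bar>)) $ i)"
    unfolding l1_norm_def matrix_vector_mult_def using nonneg_matsD(1)[OF assms(1)]
    by (auto intro!: sum_mono order.trans[OF sum_abs] simp: abs_mult)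
  also have "\<dots> \<le> (\<Sum>j\<in>UNIV. b * \<bar>x $ j\<bar>)"
    unfolding sum_matvec using assms(2) by (auto intro!: sum_mono mult_right_mono)
  finally show ?thesis by (simp add: l1_norm_def sum_distrib_left)
qed

lemma op_norm_between:
  fixes g :: "real^'n^'n"
  assumes "g \<in> nonneg_mats"
  shows "l1_norm (g *v x) \<le> op_norm g * l1_norm x"
    and "(\<And>j. col_sum g j \<le> b) \<Longrightarrow> op_norm g \<le> b"
proof -
  have bound: "l1_norm (g *v x) / l1_norm x \<le> b"
    if "\<And>j. col_sum g j \<le> b" for x b
  proof -
    obtain j :: 'n where True by simp
    have "0 \<le> b" using that[of j] col_sum_pos[OF assms, of j] by linarith
    show ?thesis
      using l1_norm_matvec_le[OF assms that, of x] l1_norm_nonneg[of x] \<open>0 \<le> b\<close>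
      by (cases "l1_norm x = 0") (auto simp: divide_simps)
  qed
  have "bdd_above (range (\<lambda>x. l1_norm (g *v x) / l1_norm x))"
  proof (rule bdd_aboveI2)
    show "l1_norm (g *v x) / l1_norm x \<le> Max (range (col_sum g))" for x
      by (rule bound) simp
  qed
  then have "l1_norm (g *v x) / l1_norm x \<le> op_norm g"
    unfolding op_norm_def by (rule cSUP_upper2[where x = x]) auto
  then show "l1_norm (g *v x) \<le> op_norm g * l1_norm x"
    using l1_norm_nonneg[of x] l1_norm_eq_0[of x]
    by (cases "x = 0") (auto simp: divide_simps l1_norm_def[of 0])
  show "op_norm g \<le> b" if "\<And>j. col_sum g j \<le> b"
    unfolding op_norm_def by (rule cSUP_least) (auto intro!: bound that)
qed

lemma axis_in_simplex: "axis j 1 \<in> prob_simplex"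
proof -
  have "l1_norm (axis j 1) = 1"
    unfolding l1_norm_def axis_def by (simp add: if_distrib[of abs] cong: if_cong)
  then show ?thesis by (simp add: prob_simplex_def axis_def)
qed

lemma l1_norm_matvec_axis:
  assumes "g \<in> nonneg_mats"
  shows "l1_norm (g *v axis j 1) = col_sum g j"
  unfolding l1_norm_matvec[OF assms axis_in_simplex] by (simp add: axis_def if_distrib cong: if_cong)

lemma log_size_le_ln_Nfun:
  fixes g :: "real^'n^'n"
  assumes "g \<in> nonneg_mats"
  shows "0 \<le> ln (Nfun g)" "log_size g \<le> CARD('n) * ln (Nfun g)"
proof -
  have up: "col_sum g j \<le> op_norm g" for j
    using op_norm_between(1)[OF assms, of "axis j 1"] axis_in_simplex[of j]
    by (simp add: l1_norm_matvec_axis[OF assms] prob_simplex_def)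
  have Min_le: "Min (range (col_sum g)) \<le> l1_norm (g *v x)" if "x \<in> prob_simplex" for x
    using l1_norm_matvec_between(1)[OF assms that, of "Min (range (col_sum g))"
        "Max (range (col_sum g))"] by auto
  have "bdd_below ((\<lambda>x. l1_norm (g *v x)) ` prob_simplex)"
    using Min_le by (intro bdd_belowI2) auto
  then have down: "vmin g \<le> col_sum g j" for j
    unfolding vmin_def using l1_norm_matvec_axis[OF assms, of j] axis_in_simplex[of j]
    by (intro cINF_lower2) auto
  have ne: "(prob_simplex :: (real^'n) set) \<noteq> {}" using axis_in_simplex by auto
  have "Min (range (col_sum g)) \<le> vmin g"
    unfolding vmin_def using Min_le ne by (intro cINF_greatest) auto
  moreover have "0 < Min (range (col_sum g))" using col_sum_pos[OF assms] by (simp)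
  ultimately have vpos: "0 < vmin g" by linarith
  have N1: "op_norm g \<le> Nfun g" "1 / vmin g \<le> Nfun g" by (auto simp: Nfun_def)
  have le: "\<bar>ln (col_sum g j)\<bar> \<le> ln (Nfun g)" for j
  proof -
    have p: "0 < col_sum g j" by (rule col_sum_pos[OF assms])
    have "ln (col_sum g j) \<le> ln (Nfun g)"
      using up[of j] N1 p by (subst ln_le_cancel_iff) auto
    moreover have "ln (1 / col_sum g j) \<le> ln (Nfun g)"
    proof (subst ln_le_cancel_iff)
      have "1 / col_sum g j \<le> 1 / vmin g" using down[of j] vpos by (intro divide_left_mono) auto
      then show "1 / col_sum g j \<le> Nfun g" using N1 by linarith
      show "0 < Nfun g" using N1 vpos by (smt (verit) zero_less_divide_1_iff)
    qed (use p in auto)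
    ultimately show ?thesis using p by (simp add: ln_div)
  qed
  show "0 \<le> ln (Nfun g)" using le[of undefined] by linarith
  have "log_size g \<le> (\<Sum>j\<in>(UNIV::'n set). ln (Nfun g))"
    unfolding log_size_def by (intro sum_mono le)
  then show "log_size g \<le> CARD('n) * ln (Nfun g)" by simp
qed

text \<open>At a positive vector the cocycle determines the operator norm up to a constant factor.\<close>

lemma op_norm_cocycle:
  assumes "g \<in> nonneg_mats" "x \<in> prob_simplex" "\<And>i. \<delta> \<le> x $ i" "0 < \<delta>"
  shows "\<bar>ln (op_norm g) - cocycle g x\<bar> \<le> - ln \<delta>"
proof -
  have x1: "l1_norm x = 1" using assms(2) by (simp add: prob_simplex_def)
  have p: "0 < l1_norm (g *v x)" by (rule l1_norm_matvec_pos[OF assms(1,2)])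
  have a: "l1_norm (g *v x) \<le> op_norm g" using op_norm_between(1)[OF assms(1), of x] x1 by simp
  have "op_norm g \<le> l1_norm (g *v x) / \<delta>"
  proof (rule op_norm_between(2)[OF assms(1)])
    fix j
    have "col_sum g j * \<delta> \<le> col_sum g j * x $ j"
      using assms(3)[of j] col_sum_pos[OF assms(1), of j] by simp
    also have "\<dots> \<le> l1_norm (g *v x)"
      unfolding l1_norm_matvec[OF assms(1,2)] using col_sum_pos[OF assms(1)] prob_simplexD(1)[OF assms(2)]
      by (intro member_le_sum[where f = "\<lambda>j. col_sum g j * x $ j"] mult_nonneg_nonneg)
        (auto simp: less_imp_le)
    finally show "col_sum g j \<le> l1_norm (g *v x) / \<delta>" using assms(4) by (simp add: field_simps)
  qed
  then have "ln (op_norm g) \<le> ln (l1_norm (g *v x) / \<delta>)" using a p assms(4) by (subst ln_le_cancel_iff) auto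
  also have "\<dots> = cocycle g x - ln \<delta>" using p assms(4) by (simp add: cocycle_def ln_div)
  finally have 1: "ln (op_norm g) \<le> cocycle g x - ln \<delta>" .
  have "cocycle g x \<le> ln (op_norm g)" unfolding cocycle_def using a p by (subst ln_le_cancel_iff) auto
  then show ?thesis using 1 by linarith
qed

section \<open>Contraction\<close>

text \<open>The quantity \<open>s = m(x,y) m(y,x)\<close> enters the distance through \<open>(1 - s) / (1 + s)\<close>. The gap
  \<open>1 - s\<close> lies between this distance and its double and is easier to estimate.\<close>

definition gap :: "real^'n \<Rightarrow> real^'n \<Rightarrow> real" where
  "gap x y = 1 - ratio_inf x y * ratio_inf y x"

lemma gap_range:
  assumes "x \<in> prob_simplex" "y \<in> prob_simplex"
  shows "0 \<le> gap x y" "gap x y \<le> 1"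
  using assms ratio_inf_nonneg[of x y] ratio_inf_nonneg[of y x] ratio_inf_le_1[of x y]
    ratio_inf_le_1[of y x]
  by (auto simp: gap_def mult_le_one)

lemma gap_proj_dist:
  assumes "x \<in> prob_simplex" "y \<in> prob_simplex"
  shows "proj_dist x y \<le> gap x y" "gap x y \<le> 2 * proj_dist x y"
proof -
  define s where "s = ratio_inf x y * ratio_inf y x"
  have s: "0 \<le> s" "s \<le> 1"
    using gap_range[OF assms] by (auto simp: gap_def s_def)
  have eq: "proj_dist x y = (1 - s) / (1 + s)" "gap x y = 1 - s"
    using assms by (auto simp: proj_dist_def s_def varphi_def gap_def)
  have "(1 - s) * 1 \<le> (1 - s) * (1 + s)" using s by (intro mult_left_mono) auto
  then show "proj_dist x y \<le> gap x y"
    unfolding eq using s by (auto simp: divide_simps)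
  have "(1 - s) * (1 + s) \<le> (1 - s) * 2" using s by (intro mult_left_mono) auto
  then show "gap x y \<le> 2 * proj_dist x y"
    unfolding eq using s by (auto simp: divide_simps)
qed

lemma ratio_inf_act_mult:
  assumes g: "g \<in> nonneg_mats" and xy: "x \<in> prob_simplex" "y \<in> prob_simplex"
    and a: "0 \<le> a" "\<And>i. a * (g *v y) $ i \<le> (g *v x) $ i"
    and b: "0 \<le> b" "\<And>i. b * (g *v x) $ i \<le> (g *v y) $ i"
  shows "a * b \<le> ratio_inf (act g x) (act g y) * ratio_inf (act g y) (act g x)"
proof -
  have *: "a * l1_norm (g *v y) / l1_norm (g *v x) \<le> ratio_inf (act g x) (act g y)"
    if "x \<in> prob_simplex" "y \<in> prob_simplex" "\<And>i. a * (g *v y) $ i \<le> (g *v x) $ i" for x y a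
  proof (rule ratio_inf_greatest)
    fix i
    assume "0 < act g y $ i"
    then show "a * l1_norm (g *v y) / l1_norm (g *v x) \<le> act g x $ i / act g y $ i"
      using that(3)[of i] l1_norm_matvec_pos[OF g that(1)] l1_norm_matvec_pos[OF g that(2)]
      by (auto simp: act_def divide_simps zero_less_mult_iff mult.commute)
  qed (use act_in_simplex[OF g that(2)] in auto)
  have "a * b = (a * l1_norm (g *v y) / l1_norm (g *v x)) * (b * l1_norm (g *v x) / l1_norm (g *v y))"
    using l1_norm_matvec_pos[OF g xy(1)] l1_norm_matvec_pos[OF g xy(2)] by simp
  also have "\<dots> \<le> ratio_inf (act g x) (act g y) * ratio_inf (act g y) (act g x)"
    using a b xy l1_norm_matvec_pos[OF g xy(1)] l1_norm_matvec_pos[OF g xy(2)]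
    by (intro mult_mono * divide_nonneg_pos mult_nonneg_nonneg ratio_inf_nonneg act_in_simplex g) auto
  finally show ?thesis .
qed

lemma matvec_ratio_inf:
  assumes g: "g \<in> nonneg_mats" and xy: "x \<in> prob_simplex" "y \<in> prob_simplex"
  shows "ratio_inf x y * (g *v y) $ i \<le> (g *v x) $ i"
  using matvec_mono[OF g, of "ratio_inf x y *\<^sub>R y" x i] ratio_inf_mult_le[OF xy]
  by (simp add: matrix_vector_mult_scaleR)

lemma gap_act_le:
  assumes "g \<in> nonneg_mats" "x \<in> prob_simplex" "y \<in> prob_simplex"
  shows "gap (act g x) (act g y) \<le> gap x y"
  unfolding gap_def
  using ratio_inf_act_mult[OF assms ratio_inf_nonneg[OF assms(2,3)] matvec_ratio_inf[OF assms]
      ratio_inf_nonneg[OF assms(3,2)] matvec_ratio_inf[OF assms(1,3,2)]] by simp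

text \<open>The matrices with all entries in \<open>[\<delta>, 1 / \<delta>]\<close>. For \<open>\<delta> = 1 / (k + 1)\<close> they exhaust the positive
  matrices, and each of these sets contracts the gap by a fixed factor.\<close>

definition bounded_mats :: "real \<Rightarrow> (real^'n^'n) set" where
  "bounded_mats \<delta> = {g. \<forall>i j. \<delta> \<le> g $ i $ j \<and> g $ i $ j \<le> 1 / \<delta>}"

lemma pos_mats_eq_UN: "(pos_mats :: (real^'n^'n) set) = (\<Union>k. bounded_mats (1 / real (Suc k)))"
proof (intro set_eqI iffI)
  fix g :: "real^'n^'n"
  assume "g \<in> pos_mats"
  then have pos: "0 < g $ i $ j" for i j by (simp add: pos_mats_def)
  define B where "B = (\<Sum>i\<in>UNIV. \<Sum>j\<in>UNIV. max (g $ i $ j) (1 / g $ i $ j))"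
  obtain k where k: "B \<le> real k" using real_arch_simple by blast
  have B: "max (g $ i $ j) (1 / g $ i $ j) \<le> B" for i j
  proof -
    have "max (g $ i $ j) (1 / g $ i $ j) \<le> (\<Sum>j\<in>UNIV. max (g $ i $ j) (1 / g $ i $ j))"
      by (rule member_le_sum) (auto simp: pos less_imp_le intro!: max.coboundedI1)
    also have "\<dots> \<le> B" unfolding B_def
      by (rule member_le_sum) (auto simp: pos less_imp_le intro!: max.coboundedI1 sum_nonneg)
    finally show ?thesis .
  qed
  have "g \<in> bounded_mats (1 / real (Suc k))"
    unfolding bounded_mats_def
  proof (intro CollectI allI conjI)
    fix i j
    show "1 / real (Suc k) \<le> g $ i $ j" 
    proof -
      have "1 / g $ i $ j \<le> real (Suc k)" using B[of i j] k by simp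
      then show ?thesis using pos[of i j] by (simp add: field_simps)
    qed
    show "g $ i $ j \<le> 1 / (1 / real (Suc k))" using B[of i j] k by simp
  qed
  then show "g \<in> (\<Union>k. bounded_mats (1 / real (Suc k)))" by blast
next
  fix g :: "real^'n^'n"
  assume "g \<in> (\<Union>k. bounded_mats (1 / real (Suc k)))"
  then obtain k where k: "\<And>i j. 1 / real (Suc k) \<le> g $ i $ j" by (auto simp: bounded_mats_def)
  have "0 < 1 / real (Suc k)" by simp
  then show "g \<in> pos_mats" unfolding pos_mats_def by (intro CollectI allI less_le_trans[OF _ k])
qed

text \<open>Write \<open>x = m y + (1 - m) u\<close> with \<open>m = m(x,y)\<close> and \<open>u\<close> in the simplex. A matrix with entries
  in \<open>[\<delta>, 1 / \<delta>]\<close> maps \<open>u\<close> above \<open>\<delta>\<^sup>2\<close> times the image of \<open>y\<close>, which raises \<open>m\<close> to at least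
  \<open>m + \<delta>\<^sup>2 (1 - m)\<close>.\<close>

lemma gap_act_contract:
  assumes \<delta>: "0 < \<delta>" "\<delta> \<le> 1" and gK: "g \<in> bounded_mats \<delta>"
    and xy: "x \<in> prob_simplex" "y \<in> prob_simplex"
  shows "gap (act g x) (act g y) \<le> (1 - \<delta> ^ 4) * gap x y"
proof -
  have g: "g \<in> nonneg_mats"
  proof -
    have "\<delta> \<le> g $ i $ j" for i j using gK by (simp add: bounded_mats_def)
    then have "g \<in> pos_mats" using \<delta>(1) by (auto simp: pos_mats_def intro: less_le_trans)
    then show ?thesis using pos_mats_subset by blast
  qed
  have dl: "\<delta> \<le> g $ i $ j" "g $ i $ j \<le> 1 / \<delta>" for i j using gK by (auto simp: bounded_mats_def)
  define \<eta> where "\<eta> = \<delta>\<^sup>2"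
  have \<eta>: "0 < \<eta>" "\<eta> \<le> 1" using \<delta> by (auto simp: \<eta>_def power_le_one)
  have step: "(ratio_inf x y + \<eta> * (1 - ratio_inf x y)) * (g *v y) $ i \<le> (g *v x) $ i"
    if xy: "x \<in> prob_simplex" "y \<in> prob_simplex" for x y i
  proof -
    let ?m = "ratio_inf x y"
    have "\<delta> * (1 - ?m) = (\<Sum>j\<in>UNIV. \<delta> * (x $ j - ?m * y $ j))"
      using prob_simplexD(2)[OF xy(1)] prob_simplexD(2)[OF xy(2)]
      by (simp add: sum_subtractf flip: sum_distrib_left)
    also have "\<dots> \<le> (\<Sum>j\<in>UNIV. g $ i $ j * (x $ j - ?m * y $ j))"
      using dl ratio_inf_mult_le[OF xy] by (intro sum_mono mult_right_mono) auto
    also have "\<dots> = (g *v x) $ i - ?m * (g *v y) $ i"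
      by (simp add: matrix_vector_mult_def algebra_simps sum_subtractf sum_distrib_left)
    finally have 1: "\<delta> * (1 - ?m) \<le> (g *v x) $ i - ?m * (g *v y) $ i" .
    have "(g *v y) $ i \<le> (\<Sum>j\<in>UNIV. 1 / \<delta> * y $ j)"
      unfolding matrix_vector_mult_def using dl prob_simplexD(1)[OF xy(2)]
      by (simp del: times_divide_eq_left) (intro sum_mono mult_right_mono, auto)
    then have 2: "(g *v y) $ i \<le> 1 / \<delta>"
      using prob_simplexD(2)[OF xy(2)] by (simp flip: sum_distrib_left sum_divide_distrib)
    have "\<eta> * (1 - ?m) * (g *v y) $ i \<le> \<eta> * (1 - ?m) * (1 / \<delta>)"
      using 2 \<eta> ratio_inf_le_1[OF xy] by (intro mult_left_mono) auto
    also have "\<dots> = \<delta> * (1 - ?m)" using \<delta> by (simp add: \<eta>_def power2_eq_square)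
    finally show ?thesis using 1 by (simp add: algebra_simps)
  qed
  define a b where "a = 1 - ratio_inf x y" and "b = 1 - ratio_inf y x"
  have ab: "0 \<le> a" "a \<le> 1" "0 \<le> b" "b \<le> 1"
    using ratio_inf_nonneg[OF xy] ratio_inf_nonneg[OF xy(2,1)] ratio_inf_le_1[OF xy]
      ratio_inf_le_1[OF xy(2,1)] by (auto simp: a_def b_def)
  have "(1 - a + \<eta> * a) * (1 - b + \<eta> * b)
      \<le> ratio_inf (act g x) (act g y) * ratio_inf (act g y) (act g x)"
    using step[OF xy] step[OF xy(2,1)] ab \<eta> by (intro ratio_inf_act_mult g xy) (auto simp: a_def b_def)
  then have "gap (act g x) (act g y) \<le> 1 - (1 - a + \<eta> * a) * (1 - b + \<eta> * b)"
    by (simp add: gap_def)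
  also have "\<dots> = (1 - \<eta>\<^sup>2) * (a + b - a * b) - \<eta> * (1 - \<eta>) * (a * (1 - b) + b * (1 - a))"
    by (simp add: algebra_simps power2_eq_square)
  also have "\<dots> \<le> (1 - \<eta>\<^sup>2) * (a + b - a * b)" using ab \<eta> by auto
  also have "\<dots> = (1 - \<delta> ^ 4) * gap x y"
    by (simp add: \<eta>_def gap_def a_def b_def algebra_simps flip: power_mult)
  finally show ?thesis .
qed

text \<open>For nearby points the difference is at most \<open>- ln (1 - gap x y)\<close> whatever the matrix is. For
  points at a gap above \<open>1 / 2\<close> it is at most twice the uniform bound of the cocycle.\<close>

lemma abs_cocycle_diff_le:
  assumes g: "g \<in> nonneg_mats" and xy: "x \<in> prob_simplex" "y \<in> prob_simplex"
  shows "\<bar>cocycle g x - cocycle g y\<bar> \<le> (2 + 4 * log_size g) * gap x y"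
proof (cases "gap x y \<le> 1 / 2")
  case True
  define s where "s = ratio_inf x y * ratio_inf y x"
  have s: "1 / 2 \<le> s" "s \<le> 1" "gap x y = 1 - s"
    using True gap_range[OF xy] by (auto simp: gap_def s_def)
  have *: "cocycle g y - cocycle g x \<le> - ln s"
    if xy: "x \<in> prob_simplex" "y \<in> prob_simplex" and s: "0 < s" "s \<le> ratio_inf x y" for x y s
  proof -
    have "s * l1_norm (g *v y) \<le> ratio_inf x y * l1_norm (g *v y)"
      using s l1_norm_matvec_pos[OF g xy(2)] by (intro mult_right_mono) auto
    also have "\<dots> = (\<Sum>i\<in>UNIV. ratio_inf x y * (g *v y) $ i)"
      using matvec_nonneg[OF g prob_simplexD(1)[OF xy(2)]] by (simp add: l1_norm_nonneg_vec sum_distrib_left)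
    also have "\<dots> \<le> l1_norm (g *v x)"
      using matvec_nonneg[OF g prob_simplexD(1)[OF xy(1)]]
      by (auto simp add: l1_norm_nonneg_vec intro!: sum_mono matvec_ratio_inf g xy)
    finally have "ln (s * l1_norm (g *v y)) \<le> ln (l1_norm (g *v x))"
      using s(1) l1_norm_matvec_pos[OF g xy(1)] l1_norm_matvec_pos[OF g xy(2)]
      by (subst ln_le_cancel_iff) auto
    then show ?thesis
      using s(1) l1_norm_matvec_pos[OF g xy(2)] by (simp add: ln_mult cocycle_def)
  qed
  have "s \<le> ratio_inf x y" "s \<le> ratio_inf y x"
    unfolding s_def using ratio_inf_nonneg[OF xy] ratio_inf_nonneg[OF xy(2,1)] ratio_inf_le_1[OF xy]
      ratio_inf_le_1[OF xy(2,1)] by (auto intro: mult_left_le mult_left_le_one_le)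
  then have d: "\<bar>cocycle g x - cocycle g y\<bar> \<le> - ln s"
    using *[OF xy, of s] *[OF xy(2,1), of s] s by (auto simp: abs_le_iff)
  have "- ln s = ln (1 / s)" using s by (simp add: ln_div)
  also have "\<dots> \<le> 1 / s - 1" using s by (intro ln_le_minus_one) auto
  also have "\<dots> = (1 - s) / s" using s by (simp add: field_simps)
  also have "\<dots> \<le> (1 - s) / (1 / 2)" using s by (intro divide_left_mono) auto
  finally have "- ln s \<le> 2 * gap x y" using s by simp
  moreover have "0 \<le> 4 * log_size g * gap x y"
    using log_size_nonneg[of g] gap_range[OF xy] by auto
  ultimately show ?thesis using d by (simp add: algebra_simps)
next
  case False
  have "\<bar>cocycle g x - cocycle g y\<bar> \<le> 2 * log_size g"
    using abs_cocycle_le[OF g xy(1)] abs_cocycle_le[OF g xy(2)] by linarith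
  also have "\<dots> = 4 * log_size g * (1 / 2)" by simp
  also have "\<dots> \<le> 4 * log_size g * gap x y"
    using False log_size_nonneg[of g] by (intro mult_left_mono) auto
  also have "\<dots> \<le> (2 + 4 * log_size g) * gap x y" using gap_range[OF xy] by (intro mult_right_mono) auto
  finally show ?thesis .
qed

section \<open>Topology and measurability\<close>

text \<open>Two points of the same face with nearly equal coordinates have a small gap, and the gap
  conversely bounds the differences of the coordinates. So the gap and the Euclidean distance define the same
  topology on each face.\<close>

lemma gap_same_support_le:
  assumes xy: "x \<in> prob_simplex" "y \<in> prob_simplex" and supp: "\<And>i. x $ i = 0 \<Longrightarrow> y $ i = 0"
    and \<epsilon>: "0 < \<epsilon>" "\<epsilon> < 1" and close: "\<And>i. 0 < x $ i \<Longrightarrow> \<bar>y $ i - x $ i\<bar> \<le> \<epsilon> * x $ i"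
  shows "gap x y \<le> 2 * \<epsilon>"
proof -
  have c: "\<bar>y $ i - x $ i\<bar> \<le> \<epsilon> * x $ i" for i
    using supp[of i] close[of i] prob_simplexD(1)[OF xy(1), of i] by (cases "x $ i = 0") auto
  have 1: "1 - \<epsilon> \<le> ratio_inf y x"
  proof (rule ratio_inf_greatest[OF xy(1)])
    fix i assume "0 < x $ i"
    then show "1 - \<epsilon> \<le> y $ i / x $ i" using c[of i] by (simp add: field_simps)
  qed
  have 2: "1 - \<epsilon> \<le> ratio_inf x y"
  proof (rule ratio_inf_greatest[OF xy(2)])
    fix i assume y: "0 < y $ i"
    have x: "0 \<le> x $ i" by (rule prob_simplexD(1)[OF xy(1)])
    have "(1 - \<epsilon>) * y $ i \<le> (1 - \<epsilon>) * ((1 + \<epsilon>) * x $ i)"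
      using c[of i] \<epsilon> by (intro mult_left_mono) (auto simp: algebra_simps)
    also have "\<dots> = (1 - \<epsilon> * \<epsilon>) * x $ i" by (simp add: algebra_simps)
    also have "\<dots> \<le> 1 * x $ i" using x \<epsilon> by (intro mult_right_mono) auto
    finally show "1 - \<epsilon> \<le> x $ i / y $ i" using y by (simp add: field_simps)
  qed
  have "(1 - \<epsilon>) * (1 - \<epsilon>) \<le> ratio_inf x y * ratio_inf y x"
    using 1 2 \<epsilon> by (intro mult_mono) auto
  then have "gap x y \<le> 2 * \<epsilon> - \<epsilon> * \<epsilon>" by (simp add: gap_def algebra_simps)
  then show ?thesis using zero_le_square[of \<epsilon>] by linarith
qed

lemma abs_diff_le_gap:
  assumes "x \<in> prob_simplex" "y \<in> prob_simplex"
  shows "\<bar>x $ i - y $ i\<bar> \<le> gap x y"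
proof -
  have *: "y $ i - x $ i \<le> gap x y" if xy: "x \<in> prob_simplex" "y \<in> prob_simplex" for x y
  proof -
    have "y $ i \<le> (\<Sum>i\<in>UNIV. y $ i)" using prob_simplexD(1)[OF xy(2)] by (intro member_le_sum) auto
    then have y1: "y $ i \<le> 1" using prob_simplexD(2)[OF xy(2)] by simp
    have "1 - gap x y \<le> ratio_inf x y"
      using ratio_inf_nonneg[OF xy] ratio_inf_le_1[OF xy(2,1)] by (simp add: gap_def mult_left_le)
    then have "(1 - gap x y) * y $ i \<le> ratio_inf x y * y $ i"
      using prob_simplexD(1)[OF xy(2)] by (intro mult_right_mono)
    then have "(1 - gap x y) * y $ i \<le> x $ i" using ratio_inf_mult_le[OF xy, of i] by linarith
    moreover have "gap x y * y $ i \<le> gap x y" using y1 gap_range[OF xy] by (simp add: mult_left_le)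
    ultimately show ?thesis by (simp add: algebra_simps)
  qed
  have "gap y x = gap x y" by (simp add: gap_def mult.commute)
  then show ?thesis using *[OF assms] *[OF assms(2,1)] by (simp add: abs_le_iff)
qed

lemma openin_simplex_top:
  "openin simplex_top U \<longleftrightarrow>
     U \<subseteq> prob_simplex \<and> (\<forall>x\<in>U. \<exists>r>0. \<forall>y\<in>prob_simplex. proj_dist x y < r \<longrightarrow> y \<in> U)"
proof -
  interpret Metric_space "prob_simplex :: (real^'n) set" proj_dist by (rule Metric_space_proj_dist)
  have ball: "mball x r \<subseteq> U \<longleftrightarrow> (\<forall>y\<in>prob_simplex. proj_dist x y < r \<longrightarrow> y \<in> U)"
    if "x \<in> prob_simplex" for x r
    using that by (auto simp: in_mball)
  have "(\<forall>x\<in>U. \<exists>r>0. mball x r \<subseteq> U) \<longleftrightarrow>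
      (\<forall>x\<in>U. \<exists>r>0. \<forall>y\<in>prob_simplex. proj_dist x y < r \<longrightarrow> y \<in> U)"
    if "U \<subseteq> prob_simplex"
    using that ball by (intro ball_cong refl) (simp add: subset_iff)
  then show ?thesis unfolding simplex_top_def openin_mtopology by (auto simp only: Ball_def)
qed

lemma topspace_simplex_top: "topspace simplex_top = prob_simplex"
  by (simp add: simplex_top_def Metric_space.topspace_mtopology[OF Metric_space_proj_dist])

lemma space_simplex_borel: "space simplex_borel = prob_simplex"
  unfolding simplex_borel_def using openin_subset[of simplex_top]
  by (subst space_measure_of) (auto simp: topspace_simplex_top)

lemma sets_simplex_borel_eq_sigma:
  "sets simplex_borel = sigma_sets prob_simplex {U. openin simplex_top U}"
  unfolding simplex_borel_def using openin_subset[of simplex_top]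
  by (subst sets_measure_of) (auto simp: topspace_simplex_top)

lemma openin_simplex_top_Int_open:
  fixes V :: "(real^'n) set"
  assumes "open V"
  shows "openin simplex_top (V \<inter> prob_simplex)"
  unfolding openin_simplex_top
proof (intro conjI ballI)
  fix x :: "real^'n" assume x: "x \<in> V \<inter> prob_simplex"
  then obtain e where e: "0 < e" "\<And>y. dist y x < e \<Longrightarrow> y \<in> V"
    using assms unfolding open_dist by blast
  define r where "r = e / (2 * CARD('n))"
  show "\<exists>r>0. \<forall>y\<in>prob_simplex. proj_dist x y < r \<longrightarrow> y \<in> V \<inter> prob_simplex"
  proof (intro exI conjI ballI impI)
    show "0 < r" using e by (simp add: r_def)
    fix y assume y: "y \<in> prob_simplex" "proj_dist x y < r"
    have "norm (y - x) \<le> (\<Sum>i\<in>UNIV. \<bar>(y - x) $ i\<bar>)" by (rule norm_le_l1_cart)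
    also have "\<dots> \<le> (\<Sum>i\<in>(UNIV::'n set). gap x y)"
      using abs_diff_le_gap[of x y] x y by (intro sum_mono) (auto simp: abs_minus_commute)
    also have "\<dots> = CARD('n) * gap x y" by simp
    also have "\<dots> \<le> CARD('n) * (2 * proj_dist x y)"
      using gap_proj_dist(2)[of x y] x y by (intro mult_left_mono) auto
    also have "\<dots> < CARD('n) * (2 * r)" using y by simp
    also have "\<dots> = e" by (simp add: r_def)
    finally show "y \<in> V \<inter> prob_simplex" using e(2)[of y] y by (auto simp: dist_norm)
  qed
qed simp

text \<open>The relatively open face of the simplex whose points have support \<open>A\<close>. For \<open>A = UNIV\<close> it is
  the interior of the simplex.\<close>

definition face :: "'n set \<Rightarrow> (real^'n) set" where
  "face A = {x \<in> prob_simplex. {i. 0 < x $ i} = A}"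

lemma prob_simplex_borel: "prob_simplex \<in> sets borel"
proof -
  have "prob_simplex = (\<Inter>i. {x::real^'n. 0 \<le> x $ i}) \<inter> {x. (\<Sum>i\<in>UNIV. \<bar>x $ i\<bar>) = 1}"
    by (auto simp: prob_simplex_def l1_norm_def)
  also have "closed \<dots>" by (intro closed_Int closed_INT ballI closed_Collect_le closed_Collect_eq continuous_intros)
  finally show ?thesis by (rule borel_closed)
qed

lemma face_borel: "face A \<in> sets borel"
  for A :: "'n::finite set"
proof -
  have "face A = prob_simplex \<inter> (\<Inter>i\<in>A. {x::real^'n. 0 < x $ i}) \<inter> (\<Inter>i\<in>-A. {x::real^'n. x $ i \<le> 0})"
    unfolding face_def set_eq_iff by (auto simp: not_less[symmetric])
  moreover have "open (\<Inter>i\<in>A. {x::real^'n. 0 < x $ i})"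
    by (intro open_INT finite ballI open_Collect_less continuous_intros)
  moreover have "closed (\<Inter>i\<in>-A. {x::real^'n. x $ i \<le> 0})"
    by (intro closed_INT ballI closed_Collect_le continuous_intros)
  ultimately show ?thesis using prob_simplex_borel by (auto intro!: sets.Int)
qed

text \<open>On each open face the metric is topologically equivalent to the Euclidean one.\<close>

lemma face_nbhd:
  assumes "x \<in> face A" "0 < r"
  shows "\<exists>V. open V \<and> x \<in> V \<and> (\<forall>y\<in>V \<inter> face A. gap x y < r)"
proof -
  define \<epsilon> where "\<epsilon> = min (1 / 2) (r / 3)"
  have \<epsilon>: "0 < \<epsilon>" "\<epsilon> < 1" "2 * \<epsilon> < r" using assms by (auto simp: \<epsilon>_def)
  define V where "V = (\<Inter>i\<in>A. {y. \<bar>y $ i - x $ i\<bar> < \<epsilon> * x $ i})"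
  have pos: "0 < x $ i \<longleftrightarrow> i \<in> A" for i using assms by (auto simp: face_def)
  have "open V"
    unfolding V_def by (intro open_INT finite ballI open_Collect_less continuous_intros)
  moreover have "x \<in> V" using pos \<epsilon> by (simp add: V_def)
  moreover have "gap x y < r" if y: "y \<in> V \<inter> face A" for y
  proof -
    have xy: "x \<in> prob_simplex" "y \<in> prob_simplex" using assms y by (auto simp: face_def)
    have "y $ i = 0" if "x $ i = 0" for i
    proof -
      have "i \<notin> A" using pos[of i] that by simp
      then have "\<not> 0 < y $ i" using y by (auto simp: face_def)
      then show ?thesis using prob_simplexD(1)[OF xy(2), of i] by linarith
    qed
    then have "gap x y \<le> 2 * \<epsilon>"
      using xy \<epsilon> y pos by (intro gap_same_support_le) (auto simp: V_def less_imp_le)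
    then show ?thesis using \<epsilon> by simp
  qed
  ultimately show ?thesis by blast
qed

lemma openin_simplex_top_borel:
  assumes "openin simplex_top U"
  shows "U \<in> sets borel"
proof -
  have "U \<inter> face A \<in> sets borel" for A
  proof -
    define V where "V = \<Union>{V. open V \<and> V \<inter> face A \<subseteq> U}"
    have "U \<inter> face A \<subseteq> V"
    proof
      fix x assume x: "x \<in> U \<inter> face A"
      then obtain r where r: "0 < r" "\<And>y. y \<in> prob_simplex \<Longrightarrow> proj_dist x y < r \<Longrightarrow> y \<in> U"
        using assms unfolding openin_simplex_top by blast
      obtain W where W: "open W" "x \<in> W" "\<And>y. y \<in> W \<inter> face A \<Longrightarrow> gap x y < r"
        using face_nbhd[of x A r] x r by blast
      have "W \<inter> face A \<subseteq> U"
      proof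
        fix y assume y: "y \<in> W \<inter> face A"
        then have "x \<in> prob_simplex" "y \<in> prob_simplex" using x by (auto simp: face_def)
        then show "y \<in> U" using W(3)[OF y] gap_proj_dist(1)[of x y] r(2)[of y] by auto
      qed
      then show "x \<in> V" using W unfolding V_def by blast
    qed
    then have "U \<inter> face A = V \<inter> face A" by (auto simp: V_def)
    moreover have "open V" unfolding V_def by auto
    ultimately show ?thesis using face_borel by (auto intro!: sets.Int)
  qed
  then have "(\<Union>A\<in>UNIV. U \<inter> face A) \<in> sets borel" by (intro sets.finite_UN) auto
  moreover have "U = (\<Union>A\<in>UNIV. U \<inter> face A)"
    using assms unfolding openin_simplex_top by (auto simp: face_def)
  ultimately show ?thesis by simp
qed

text \<open>Although finer than the Euclidean topology, this topology has the same Borel sets, because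
  the simplex is a finite union of open faces.\<close>

lemma sets_simplex_borel: "sets simplex_borel = sets (restrict_space borel prob_simplex)"
proof (intro antisym subsetI)
  fix A :: "(real^'n) set"
  assume "A \<in> sets simplex_borel"
  then have "A \<in> sigma_sets prob_simplex {U. openin simplex_top U}" by (simp add: sets_simplex_borel_eq_sigma)
  then show "A \<in> sets (restrict_space borel prob_simplex)"
  proof induction
    case (Basic U)
    then show ?case
      using openin_simplex_top_borel[of U] openin_subset[of simplex_top U]
      by (auto simp: sets_restrict_space_iff prob_simplex_borel topspace_simplex_top)
  next
    case (Compl A)
    have "space (restrict_space borel prob_simplex) - A \<in> sets (restrict_space borel prob_simplex)"
      using Compl by (intro sets.compl_sets)
    then show ?case by (simp add: space_restrict_space)
  qed auto
next
  fix A :: "(real^'n) set"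
  assume "A \<in> sets (restrict_space borel prob_simplex)"
  then have A: "A \<in> sets borel" "A \<subseteq> prob_simplex"
    by (auto simp: sets_restrict_space_iff prob_simplex_borel)
  have "(\<lambda>x. x) \<in> simplex_borel \<rightarrow>\<^sub>M (borel :: (real^'n) measure)"
  proof (rule borel_measurableI)
    fix V :: "(real^'n) set" assume "open V"
    then have "V \<inter> prob_simplex \<in> sigma_sets prob_simplex {U. openin simplex_top U}"
      using openin_simplex_top_Int_open by blast
    then show "(\<lambda>x. x) -` V \<inter> space simplex_borel \<in> sets simplex_borel"
      by (simp add: space_simplex_borel sets_simplex_borel_eq_sigma)
  qed
  from measurable_sets[OF this A(1)] have "A \<inter> prob_simplex \<in> sets simplex_borel"
    by (simp add: space_simplex_borel)
  moreover have "A \<inter> prob_simplex = A" using A by blast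
  ultimately show "A \<in> sets simplex_borel" by simp
qed

lemma measurable_simplex_borel_id: "(\<lambda>x. x) \<in> simplex_borel \<rightarrow>\<^sub>M borel"
  using measurable_restrict_space1[OF measurable_ident]
  by (subst measurable_cong_sets[OF sets_simplex_borel refl]) (auto simp: id_def)

lemma measurable_simplex_borelI:
  assumes "f \<in> A \<rightarrow>\<^sub>M borel" "\<And>a. a \<in> space A \<Longrightarrow> f a \<in> prob_simplex"
  shows "f \<in> A \<rightarrow>\<^sub>M simplex_borel"
  by (subst measurable_cong_sets[OF refl sets_simplex_borel])
    (use assms in \<open>auto intro!: measurable_restrict_space2\<close>)

lemma nonneg_mats_borel: "nonneg_mats \<in> sets (borel :: (real^'n^'n) measure)"
proof -
  have "nonneg_mats = (\<Inter>i. \<Inter>j. {g::real^'n^'n. 0 \<le> g $ i $ j})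
      \<inter> ((\<Inter>i. \<Union>j. {g. 0 < g $ i $ j}) \<inter> (\<Inter>j. \<Union>i. {g. 0 < g $ i $ j}))"
    by (auto simp: nonneg_mats_def)
  moreover have "closed (\<Inter>i. \<Inter>j. {g::real^'n^'n. 0 \<le> g $ i $ j})"
    by (intro closed_INT ballI closed_Collect_le continuous_intros)
  moreover have "open ((\<Inter>i. \<Union>j. {g::real^'n^'n. 0 < g $ i $ j}) \<inter> (\<Inter>j. \<Union>i. {g. 0 < g $ i $ j}))"
    by (intro open_Int open_INT open_UN finite ballI open_Collect_less continuous_intros)
  ultimately show ?thesis by (metis sets.Int borel_open borel_closed)
qed

lemma space_mat_borel: "space mat_borel = nonneg_mats"
  by (simp add: mat_borel_def space_restrict_space)

lemma measurable_mat_borel_id: "(\<lambda>g. g) \<in> mat_borel \<rightarrow>\<^sub>M borel"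
  unfolding mat_borel_def using measurable_restrict_space1[OF measurable_ident] by (simp add: id_def)

lemma measurable_mat_borelI:
  assumes "f \<in> A \<rightarrow>\<^sub>M borel" "\<And>a. a \<in> space A \<Longrightarrow> f a \<in> nonneg_mats"
  shows "f \<in> A \<rightarrow>\<^sub>M mat_borel"
  unfolding mat_borel_def using assms by (auto intro!: measurable_restrict_space2)

lemma measurable_mat_borel_cont:
  assumes "continuous_on UNIV F"
  shows "F \<in> mat_borel \<rightarrow>\<^sub>M borel"
  using measurable_compose[OF measurable_mat_borel_id borel_measurable_continuous_onI[OF assms]] by simp

lemma measurable_pair_cont:
  assumes "continuous_on UNIV F"
    and "(\<lambda>x. x) \<in> A \<rightarrow>\<^sub>M borel" "(\<lambda>x. x) \<in> B \<rightarrow>\<^sub>M borel"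
  shows "(F :: 'a::second_countable_topology \<times> 'b::second_countable_topology \<Rightarrow> 'c::topological_space)
     \<in> A \<Otimes>\<^sub>M B \<rightarrow>\<^sub>M borel"
proof -
  have "(\<lambda>p. (fst p, snd p)) \<in> A \<Otimes>\<^sub>M B \<rightarrow>\<^sub>M (borel \<Otimes>\<^sub>M borel :: ('a \<times> 'b) measure)"
    using measurable_compose[OF measurable_fst assms(2)] measurable_compose[OF measurable_snd assms(3)]
    by (intro measurable_Pair)
  then have "(\<lambda>p. p) \<in> A \<Otimes>\<^sub>M B \<rightarrow>\<^sub>M (borel :: ('a \<times> 'b) measure)" by (simp add: borel_prod)
  from measurable_compose[OF this borel_measurable_continuous_onI[OF assms(1)]] show ?thesis by simp
qed

lemma continuous_matvec: "continuous_on A (\<lambda>p::(real^'n^'m) \<times> (real^'n). fst p *v snd p)"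
  unfolding matrix_vector_mult_def
  by (intro continuous_on_vec_lambda continuous_intros)

lemma continuous_matmul: "continuous_on A (\<lambda>p::(real^'n^'m) \<times> (real^'k^'n). fst p ** snd p)"
  unfolding matrix_matrix_mult_def
  by (intro continuous_on_vec_lambda continuous_intros)

lemma continuous_l1_norm: "continuous_on A l1_norm"
  unfolding l1_norm_def[abs_def] by (intro continuous_intros)

lemma measurable_l1_norm_matvec:
  "(\<lambda>p. l1_norm (fst p *v snd p)) \<in> borel_measurable (mat_borel \<Otimes>\<^sub>M simplex_borel)"
  by (intro measurable_pair_cont measurable_mat_borel_id measurable_simplex_borel_id
      continuous_on_compose2[OF continuous_l1_norm continuous_matvec]) auto

lemma measurable_cocycle:
  "(\<lambda>p. cocycle (fst p) (snd p)) \<in> borel_measurable (mat_borel \<Otimes>\<^sub>M simplex_borel)"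
  unfolding cocycle_def by (intro borel_measurable_ln measurable_l1_norm_matvec)

lemma measurable_act: "(\<lambda>p. act (fst p) (snd p)) \<in> mat_borel \<Otimes>\<^sub>M simplex_borel \<rightarrow>\<^sub>M simplex_borel"
proof (rule measurable_simplex_borelI)
  show "(\<lambda>p. act (fst p) (snd p)) \<in> mat_borel \<Otimes>\<^sub>M simplex_borel \<rightarrow>\<^sub>M borel"
    unfolding act_def
    by (intro borel_measurable_scaleR borel_measurable_divide borel_measurable_const measurable_l1_norm_matvec
        measurable_pair_cont measurable_mat_borel_id measurable_simplex_borel_id continuous_matvec)
qed (auto simp: space_pair_measure space_mat_borel space_simplex_borel act_in_simplex)

lemma measurable_matmul: "(\<lambda>p. fst p ** snd p) \<in> mat_borel \<Otimes>\<^sub>M mat_borel \<rightarrow>\<^sub>M mat_borel"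
  by (intro measurable_mat_borelI measurable_pair_cont measurable_mat_borel_id continuous_matmul)
    (auto simp: space_pair_measure space_mat_borel nonneg_mats_mult)

lemma measurable_col_sum: "(\<lambda>g. col_sum g j) \<in> borel_measurable mat_borel"
  unfolding col_sum_def by (intro measurable_mat_borel_cont continuous_intros)

lemma measurable_log_size: "log_size \<in> borel_measurable mat_borel"
  unfolding log_size_def[abs_def]
  by (intro borel_measurable_sum borel_measurable_abs borel_measurable_ln measurable_col_sum)

lemma sets_mat_borelI: "A \<in> sets borel \<Longrightarrow> A \<subseteq> nonneg_mats \<Longrightarrow> A \<in> sets mat_borel"
  by (simp add: mat_borel_def sets_restrict_space_iff nonneg_mats_borel)

lemma measurable_bounded_mats:
  fixes \<delta> :: real
  assumes "0 < \<delta>" shows "(bounded_mats \<delta> :: (real^'n^'n) set) \<in> sets mat_borel"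
proof (rule sets_mat_borelI)
  have "bounded_mats \<delta> = (\<Inter>i. \<Inter>j. {g::real^'n^'n. \<delta> \<le> g $ i $ j} \<inter> {g. g $ i $ j \<le> 1 / \<delta>})"
    by (auto simp: bounded_mats_def)
  also have "closed (\<Inter>i. \<Inter>j. {g::real^'n^'n. \<delta> \<le> g $ i $ j} \<inter> {g. g $ i $ j \<le> 1 / \<delta>})" by (intro closed_INT closed_Int ballI closed_Collect_le continuous_intros)
  finally show "(bounded_mats \<delta> :: (real^'n^'n) set) \<in> sets borel" by (rule borel_closed)
  have "(bounded_mats \<delta> :: (real^'n^'n) set) \<subseteq> pos_mats"
    using assms by (auto simp: bounded_mats_def pos_mats_def intro: less_le_trans)
  then show "(bounded_mats \<delta> :: (real^'n^'n) set) \<subseteq> nonneg_mats" using pos_mats_subset by blast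
qed

text \<open>Functions that are Lipschitz with respect to the gap, hence also with respect to the distance,
  with twice the constant.\<close>

definition gap_lipschitz :: "real \<Rightarrow> (real^'n \<Rightarrow> real) \<Rightarrow> bool" where
  "gap_lipschitz C u \<longleftrightarrow>
     (\<forall>x\<in>prob_simplex. \<forall>y\<in>prob_simplex. \<bar>u x - u y\<bar> \<le> C * gap x y)"

lemma gap_lipschitzD:
  "gap_lipschitz C u \<Longrightarrow> x \<in> prob_simplex \<Longrightarrow> y \<in> prob_simplex \<Longrightarrow> \<bar>u x - u y\<bar> \<le> C * gap x y"
  by (auto simp: gap_lipschitz_def)

lemma gap_lipschitz_proj_dist:
  assumes "gap_lipschitz C u" "x \<in> prob_simplex" "y \<in> prob_simplex" "0 \<le> C"
  shows "\<bar>u x - u y\<bar> \<le> 2 * C * proj_dist x y"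
proof -
  have "C * gap x y \<le> C * (2 * proj_dist x y)"
    using gap_proj_dist(2)[OF assms(2,3)] assms by (intro mult_left_mono) auto
  then show ?thesis using gap_lipschitzD[OF assms(1-3)] by simp
qed

lemma continuous_map_gap_lipschitz:
  assumes "gap_lipschitz C u" "0 \<le> C"
  shows "continuous_map simplex_top euclideanreal u"
proof -
  have "openin simplex_top {x \<in> prob_simplex. u x \<in> V}" if V: "open V" for V
    unfolding openin_simplex_top
  proof (intro conjI ballI)
    fix x assume x: "x \<in> {x \<in> prob_simplex. u x \<in> V}"
    then obtain e where e: "0 < e" "\<And>z. dist z (u x) < e \<Longrightarrow> z \<in> V"
      using V unfolding open_dist by blast
    show "\<exists>r>0. \<forall>y\<in>prob_simplex. proj_dist x y < r \<longrightarrow> y \<in> {x \<in> prob_simplex. u x \<in> V}"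
    proof (intro exI conjI ballI impI)
      show "0 < e / (2 * C + 1)" using e assms by simp
      fix y assume y: "y \<in> prob_simplex" "proj_dist x y < e / (2 * C + 1)"
      have nn: "0 \<le> proj_dist x y"
        using Metric_space.nonneg[OF Metric_space_proj_dist] .
      have "\<bar>u x - u y\<bar> \<le> (2 * C + 1) * proj_dist x y"
        using gap_lipschitz_proj_dist[OF assms(1) _ y(1) assms(2), of x] x nn by (simp add: algebra_simps)
      also have "\<dots> < e" using y assms by (simp add: field_simps)
      finally show "y \<in> {x \<in> prob_simplex. u x \<in> V}"
        using e(2)[of "u y"] y by (auto simp: dist_real_def abs_minus_commute)
    qed
  qed simp
  then show ?thesis
    by (simp add: continuous_map_def topspace_simplex_top)
qed

section \<open>The Markov operator and Poisson's equation\<close>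

lemma measurable_cocycle' [measurable (raw)]:
  assumes "f \<in> A \<rightarrow>\<^sub>M mat_borel" "k \<in> A \<rightarrow>\<^sub>M simplex_borel"
  shows "(\<lambda>a. cocycle (f a) (k a)) \<in> borel_measurable A"
  using measurable_compose[OF measurable_Pair[OF assms] measurable_cocycle] by simp

lemma measurable_act' [measurable (raw)]:
  assumes "f \<in> A \<rightarrow>\<^sub>M mat_borel" "k \<in> A \<rightarrow>\<^sub>M simplex_borel"
  shows "(\<lambda>a. act (f a) (k a)) \<in> A \<rightarrow>\<^sub>M simplex_borel"
  using measurable_compose[OF measurable_Pair[OF assms] measurable_act] by simp

lemma measurable_matmul' [measurable (raw)]:
  assumes "f \<in> A \<rightarrow>\<^sub>M mat_borel" "k \<in> A \<rightarrow>\<^sub>M mat_borel"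
  shows "(\<lambda>a. f a ** k a) \<in> A \<rightarrow>\<^sub>M mat_borel"
  using measurable_compose[OF measurable_Pair[OF assms] measurable_matmul] by simp

lemma measurable_log_size' [measurable (raw)]:
  "f \<in> A \<rightarrow>\<^sub>M mat_borel \<Longrightarrow> (\<lambda>a. log_size (f a)) \<in> borel_measurable A"
  by (rule measurable_compose[OF _ measurable_log_size])

text \<open>The law of the matrices, and an invariant law for the action on the simplex.\<close>

locale positive_walk =
  fixes \<mu> :: "(real^'n^'n) measure" and \<nu> :: "(real^'n) measure"
  assumes prob_mu: "prob_space \<mu>" and sets_mu [measurable_cong]: "sets \<mu> = sets mat_borel"
    and contracting: "strictly_contracting \<mu>" and moment: "has_moment 2 \<mu>"
    and invariant: "invariant_prob \<mu> \<nu>"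
begin

lemma prob_nu: "prob_space \<nu>" and sets_nu [measurable_cong]: "sets \<nu> = sets simplex_borel"
  using invariant by (auto simp: invariant_prob_def)

sublocale mu: prob_space \<mu> by (rule prob_mu)
sublocale nu: prob_space \<nu> by (rule prob_nu)

lemma space_mu: "space \<mu> = nonneg_mats"
  using sets_eq_imp_space_eq[OF sets_mu] by (simp add: space_mat_borel)

lemma space_nu: "space \<nu> = prob_simplex"
  using sets_eq_imp_space_eq[OF sets_nu] by (simp add: space_simplex_borel)

abbreviation mu_pow :: "nat \<Rightarrow> (real^'n^'n) measure" where "mu_pow \<equiv> conv_pow \<mu>"

lemma sets_mu_pow [measurable_cong]: "sets (mu_pow k) = sets mat_borel"
  by (cases k) auto

lemma space_mu_pow: "space (mu_pow k) = nonneg_mats"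
  using sets_eq_imp_space_eq[OF sets_mu_pow] by (simp add: space_mat_borel)

lemma prob_mu_pow: "prob_space (mu_pow k)"
proof (induction k)
  case 0
  then show ?case by (auto intro!: prob_space_return simp: space_mat_borel mat_1_nonneg_mats)
next
  case (Suc k)
  interpret mk: prob_space "mu_pow k" by (rule Suc)
  interpret pair_prob_space \<mu> "mu_pow k" ..
  show ?case by (simp, intro prob_space_distr) measurable
qed

lemma pair_prob_mu_pow: "pair_prob_space \<mu> (mu_pow k)"
  using prob_mu prob_mu_pow by (simp add: pair_prob_space_def pair_sigma_finite_def prob_space_imp_sigma_finite)

text \<open>The additional factor of \<open>conv_pow \<mu> (Suc n)\<close> stands on the left, that is, it acts last.\<close>

lemma nn_integral_mu_pow_Suc:
  assumes [measurable]: "F \<in> borel_measurable mat_borel"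
  shows "(\<integral>\<^sup>+ k. F k \<partial>mu_pow (Suc n)) = (\<integral>\<^sup>+ h. \<integral>\<^sup>+ g. F (g ** h) \<partial>\<mu> \<partial>mu_pow n)"
proof -
  interpret pair_prob_space \<mu> "mu_pow n" by (rule pair_prob_mu_pow)
  have "(\<integral>\<^sup>+ k. F k \<partial>mu_pow (Suc n)) = (\<integral>\<^sup>+ p. F (fst p ** snd p) \<partial>(\<mu> \<Otimes>\<^sub>M mu_pow n))"
    by (simp add: case_prod_beta' nn_integral_distr)
  also have "\<dots> = (\<integral>\<^sup>+ h. \<integral>\<^sup>+ g. F (g ** h) \<partial>\<mu> \<partial>mu_pow n)"
    by (subst nn_integral_snd[symmetric]) (auto simp: case_prod_beta')
  finally show ?thesis .
qed

lemma integral_mu_pow_Suc: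
  fixes F :: "real^'n^'n \<Rightarrow> 'b::{banach, second_countable_topology}"
  assumes [measurable]: "F \<in> borel_measurable mat_borel"
    and int: "integrable (\<mu> \<Otimes>\<^sub>M mu_pow n) (\<lambda>p. F (fst p ** snd p))"
  shows "integrable (mu_pow (Suc n)) F"
    and "(\<integral> k. F k \<partial>mu_pow (Suc n)) = (\<integral> h. \<integral> g. F (g ** h) \<partial>\<mu> \<partial>mu_pow n)"
proof -
  interpret pair_prob_space \<mu> "mu_pow n" by (rule pair_prob_mu_pow)
  show "integrable (mu_pow (Suc n)) F"
    using int by (simp add: case_prod_beta' integrable_distr_eq)
  have "(\<integral> k. F k \<partial>mu_pow (Suc n)) = (\<integral> p. F (fst p ** snd p) \<partial>(\<mu> \<Otimes>\<^sub>M mu_pow n))"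
    by (simp add: case_prod_beta' integral_distr)
  also have "\<dots> = (\<integral> h. \<integral> g. F (g ** h) \<partial>\<mu> \<partial>mu_pow n)"
    using integral_snd[of "\<lambda>g h. F (g ** h)"] int by (simp add: case_prod_beta')
  finally show "(\<integral> k. F k \<partial>mu_pow (Suc n)) = (\<integral> h. \<integral> g. F (g ** h) \<partial>\<mu> \<partial>mu_pow n)" .
qed

lemma mu_pow_1: "mu_pow 1 = \<mu>"
proof (rule measure_eqI)
  fix A assume "A \<in> sets (mu_pow 1)"
  then have A [measurable]: "A \<in> sets mat_borel" using sets_mu_pow by blast
  have "emeasure (mu_pow 1) A = (\<integral>\<^sup>+ k. indicator A k \<partial>mu_pow (Suc 0))"
    using A sets_mu_pow[of 1] by (subst nn_integral_indicator) auto
  also have "\<dots> = (\<integral>\<^sup>+ g. indicator A (g ** mat 1) \<partial>\<mu>)"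
    by (subst nn_integral_mu_pow_Suc) (auto simp: nn_integral_return space_mat_borel mat_1_nonneg_mats)
  also have "\<dots> = emeasure \<mu> A" using A sets_mu by simp
  finally show "emeasure (mu_pow 1) A = emeasure \<mu> A" .
qed (use sets_mu sets_mu_pow in auto)

subsection \<open>Invariance\<close>

lemma nn_integral_nu_act:
  assumes [measurable]: "f \<in> borel_measurable simplex_borel"
  shows "(\<integral>\<^sup>+ x. \<integral>\<^sup>+ g. f (act g x) \<partial>\<mu> \<partial>\<nu>) = (\<integral>\<^sup>+ x. f x \<partial>\<nu>)"
proof -
  interpret pair_prob_space \<mu> \<nu> ..
  have "(\<integral>\<^sup>+ x. \<integral>\<^sup>+ g. f (act g x) \<partial>\<mu> \<partial>\<nu>) = (\<integral>\<^sup>+ (g, x). f (act g x) \<partial>(\<mu> \<Otimes>\<^sub>M \<nu>))"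
    by (subst nn_integral_snd[symmetric]) auto
  then show ?thesis using invariant assms by (simp add: invariant_prob_def)
qed

lemma nn_integral_nu_act_pow:
  assumes "f \<in> borel_measurable simplex_borel"
  shows "(\<integral>\<^sup>+ x. \<integral>\<^sup>+ g. f (act g x) \<partial>mu_pow n \<partial>\<nu>) = (\<integral>\<^sup>+ x. f x \<partial>\<nu>)"
  using assms
proof (induction n arbitrary: f)
  case 0
  have [measurable]: "f \<in> borel_measurable simplex_borel" by (rule 0)
  have "(\<integral>\<^sup>+ g. f (act g x) \<partial>mu_pow 0) = f x" if "x \<in> space \<nu>" for x
  proof -
    have [measurable]: "x \<in> space simplex_borel" using that by (simp add: space_nu space_simplex_borel)
    show ?thesis using that
      by (simp, subst nn_integral_return) (auto simp: space_mat_borel mat_1_nonneg_mats act_one space_nu)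
  qed
  then show ?case by (intro nn_integral_cong)
next
  case (Suc n)
  have [measurable]: "f \<in> borel_measurable simplex_borel" by (rule Suc)
  have "(\<integral>\<^sup>+ g. f (act g x) \<partial>mu_pow (Suc n)) = (\<integral>\<^sup>+ h. (\<integral>\<^sup>+ g. f (act g (act h x)) \<partial>\<mu>) \<partial>mu_pow n)"
    if "x \<in> space \<nu>" for x
  proof -
    have [measurable]: "x \<in> space simplex_borel" using that by (simp add: space_nu space_simplex_borel)
    show ?thesis
      using that by (subst nn_integral_mu_pow_Suc)
        (auto intro!: nn_integral_cong simp: act_mult space_mu space_mu_pow space_nu)
  qed
  then have "(\<integral>\<^sup>+ x. \<integral>\<^sup>+ g. f (act g x) \<partial>mu_pow (Suc n) \<partial>\<nu>)
      = (\<integral>\<^sup>+ x. \<integral>\<^sup>+ h. (\<integral>\<^sup>+ g. f (act g (act h x)) \<partial>\<mu>) \<partial>mu_pow n \<partial>\<nu>)"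
    by (intro nn_integral_cong)
  also have "\<dots> = (\<integral>\<^sup>+ x. (\<integral>\<^sup>+ g. f (act g x) \<partial>\<mu>) \<partial>\<nu>)" by (rule Suc.IH) measurable
  also have "\<dots> = (\<integral>\<^sup>+ x. f x \<partial>\<nu>)" by (rule nn_integral_nu_act) measurable
  finally show ?case .
qed

subsection \<open>The Markov operator\<close>

text \<open>The transition operator of the Markov chain \<open>A\<^sub>n \<cdot> x\<close> on the simplex.\<close>

definition markov_op :: "(real^'n \<Rightarrow> real) \<Rightarrow> real^'n \<Rightarrow> real" where
  "markov_op u x = (\<integral> g. u (act g x) \<partial>\<mu>)"

text \<open>Measurable functions that are bounded by \<open>B\<close> on the simplex. Values outside the simplex are
  irrelevant.\<close>

definition bdd_meas :: "real \<Rightarrow> (real^'n \<Rightarrow> real) \<Rightarrow> bool" where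
  "bdd_meas B u \<longleftrightarrow> u \<in> borel_measurable simplex_borel \<and> (\<forall>x\<in>prob_simplex. \<bar>u x\<bar> \<le> B)"

lemma bdd_measD:
  assumes "bdd_meas B u"
  shows "u \<in> borel_measurable simplex_borel" "x \<in> prob_simplex \<Longrightarrow> \<bar>u x\<bar> \<le> B"
  using assms by (auto simp: bdd_meas_def)

lemma integrable_act:
  assumes "bdd_meas B u" "x \<in> prob_simplex"
  shows "integrable (mu_pow n) (\<lambda>g. u (act g x))"
proof -
  interpret mn: prob_space "mu_pow n" by (rule prob_mu_pow)
  have [measurable]: "u \<in> borel_measurable simplex_borel" "x \<in> space simplex_borel"
    using assms by (auto simp: bdd_meas_def space_simplex_borel)
  show ?thesis
    using bdd_measD(2)[OF assms(1)] assms(2)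
    by (intro mn.integrable_const_bound[of _ B]) (auto simp: space_mu_pow act_in_simplex)
qed

lemma integrable_act_mu:
  assumes "bdd_meas B u" "x \<in> prob_simplex"
  shows "integrable \<mu> (\<lambda>g. u (act g x))"
  using integrable_act[OF assms, of 1] by (simp only: mu_pow_1)

lemma markov_op_bdd_meas:
  assumes "bdd_meas B u"
  shows "bdd_meas B (markov_op u)"
proof -
  have [measurable]: "u \<in> borel_measurable simplex_borel" using assms by (auto simp: bdd_meas_def)
  have "markov_op u \<in> borel_measurable simplex_borel" unfolding markov_op_def[abs_def] by measurable
  moreover have "\<bar>markov_op u x\<bar> \<le> B" if x: "x \<in> prob_simplex" for x
  proof -
    have "\<bar>markov_op u x\<bar> \<le> (\<integral> g. \<bar>u (act g x)\<bar> \<partial>\<mu>)" unfolding markov_op_def by (rule integral_abs_bound)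
    also have "\<dots> \<le> (\<integral> g. B \<partial>\<mu>)"
      using assms x by (intro integral_mono integrable_abs integrable_act_mu[OF assms x])
        (auto simp: bdd_meas_def space_mu act_in_simplex)
    finally show ?thesis by (simp add: mu.prob_space)
  qed
  ultimately show ?thesis by (simp add: bdd_meas_def)
qed

lemma markov_op_pow_bdd_meas: "bdd_meas B u \<Longrightarrow> bdd_meas B ((markov_op ^^ n) u)"
  by (induction n) (auto intro: markov_op_bdd_meas)

lemma integral_mu_pow_act_Suc:
  assumes "bdd_meas B u" "x \<in> prob_simplex"
  shows "(\<integral> g. u (act g x) \<partial>mu_pow (Suc n)) = (\<integral> h. markov_op u (act h x) \<partial>mu_pow n)"
proof -
  interpret pair_prob_space \<mu> "mu_pow n" by (rule pair_prob_mu_pow)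
  have [measurable]: "u \<in> borel_measurable simplex_borel" "x \<in> space simplex_borel"
    using assms by (auto simp: bdd_meas_def space_simplex_borel)
  have "integrable (\<mu> \<Otimes>\<^sub>M mu_pow n) (\<lambda>p. u (act (fst p ** snd p) x))"
    using bdd_measD(2)[OF assms(1)] assms(2)
    by (intro P.integrable_const_bound[of _ B])
      (auto simp: space_pair_measure space_mu space_mu_pow act_in_simplex nonneg_mats_mult)
  then have "(\<integral> g. u (act g x) \<partial>mu_pow (Suc n)) = (\<integral> h. \<integral> g. u (act (g ** h) x) \<partial>\<mu> \<partial>mu_pow n)"
    by (intro integral_mu_pow_Suc) auto
  also have "\<dots> = (\<integral> h. markov_op u (act h x) \<partial>mu_pow n)"
    unfolding markov_op_def
    by (intro Bochner_Integration.integral_cong refl)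
      (auto simp: act_mult assms(2) space_mu space_mu_pow)
  finally show ?thesis .
qed

lemma markov_op_pow:
  assumes "bdd_meas B u" "x \<in> prob_simplex"
  shows "(markov_op ^^ n) u x = (\<integral> g. u (act g x) \<partial>mu_pow n)"
  using assms
proof (induction n arbitrary: u)
  case 0
  have [measurable]: "u \<in> borel_measurable simplex_borel" "x \<in> space simplex_borel"
    using 0 by (auto simp: bdd_meas_def space_simplex_borel)
  show ?case
    using 0 by (simp, subst integral_return) (auto simp: space_mat_borel mat_1_nonneg_mats act_one)
next
  case (Suc n)
  have "(markov_op ^^ Suc n) u x = (markov_op ^^ n) (markov_op u) x"
    by (simp add: funpow_Suc_right del: funpow.simps)
  also have "\<dots> = (\<integral> g. markov_op u (act g x) \<partial>mu_pow n)"
    by (rule Suc.IH[OF markov_op_bdd_meas[OF Suc.prems(1)] Suc.prems(2)])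
  finally show ?case using integral_mu_pow_act_Suc[OF Suc.prems] by simp
qed

lemma integrable_bdd_meas: "bdd_meas B u \<Longrightarrow> integrable \<nu> u"
  by (rule nu.integrable_const_bound[of _ B])
    (auto simp: bdd_meas_def space_nu measurable_cong_sets[OF sets_nu refl])

lemma integral_markov_op:
  assumes u: "bdd_meas B u"
  shows "(\<integral> x. markov_op u x \<partial>\<nu>) = (\<integral> x. u x \<partial>\<nu>)"
proof -
  interpret pair_prob_space \<mu> \<nu> ..
  have [measurable]: "u \<in> borel_measurable simplex_borel" using u by (auto simp: bdd_meas_def)
  have "\<nu> = distr (\<mu> \<Otimes>\<^sub>M \<nu>) simplex_borel (\<lambda>p. act (fst p) (snd p))"
  proof (rule measure_eqI)
    fix A assume "A \<in> sets \<nu>"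
    then have A [measurable]: "A \<in> sets simplex_borel" by (simp add: sets_nu)
    have "emeasure \<nu> A = (\<integral>\<^sup>+ x. indicator A x \<partial>\<nu>)" using A by (simp add: sets_nu)
    also have "\<dots> = (\<integral>\<^sup>+ x. \<integral>\<^sup>+ g. indicator A (act g x) \<partial>\<mu> \<partial>\<nu>)"
      by (rule nn_integral_nu_act[symmetric]) measurable
    also have "\<dots> = (\<integral>\<^sup>+ p. indicator A (act (fst p) (snd p)) \<partial>(\<mu> \<Otimes>\<^sub>M \<nu>))"
      by (subst nn_integral_snd[symmetric]) (auto simp: case_prod_beta')
    also have "\<dots> = (\<integral>\<^sup>+ x. indicator A x \<partial>distr (\<mu> \<Otimes>\<^sub>M \<nu>) simplex_borel (\<lambda>p. act (fst p) (snd p)))"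
      by (subst nn_integral_distr) auto
    finally show "emeasure \<nu> A = emeasure (distr (\<mu> \<Otimes>\<^sub>M \<nu>) simplex_borel (\<lambda>p. act (fst p) (snd p))) A"
      by simp
  qed (simp add: sets_nu)
  then have "(\<integral> x. u x \<partial>\<nu>) = (\<integral> x. u x \<partial>distr (\<mu> \<Otimes>\<^sub>M \<nu>) simplex_borel (\<lambda>p. act (fst p) (snd p)))"
    by simp
  also have "\<dots> = (\<integral> p. u (act (fst p) (snd p)) \<partial>(\<mu> \<Otimes>\<^sub>M \<nu>))"
    by (rule integral_distr) measurable
  also have "\<dots> = (\<integral> x. \<integral> g. u (act g x) \<partial>\<mu> \<partial>\<nu>)"
  proof -
    have "integrable (\<mu> \<Otimes>\<^sub>M \<nu>) (\<lambda>p. u (act (fst p) (snd p)))"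
      using bdd_measD(2)[OF u] by (intro P.integrable_const_bound[of _ B])
        (auto simp: space_pair_measure space_mu space_nu act_in_simplex)
    then show ?thesis using integral_snd[of "\<lambda>g x. u (act g x)"] by (simp add: case_prod_beta')
  qed
  finally show ?thesis by (simp add: markov_op_def)
qed

lemma integral_markov_op_pow:
  "bdd_meas B u \<Longrightarrow> (\<integral> x. (markov_op ^^ n) u x \<partial>\<nu>) = (\<integral> x. u x \<partial>\<nu>)"
  by (induction n) (auto simp: integral_markov_op[OF markov_op_pow_bdd_meas])

subsection \<open>Exponential contraction\<close>

lemma bounded_mats_positive_mass:
  "\<exists>r \<delta>. 1 \<le> r \<and> 0 < \<delta> \<and> \<delta> \<le> 1 \<and> 0 < measure (mu_pow r) (bounded_mats \<delta>)"
proof -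
  obtain r where r: "1 \<le> r" "0 < emeasure (mu_pow r) pos_mats"
    using contracting unfolding strictly_contracting_def by auto
  interpret mr: prob_space "mu_pow r" by (rule prob_mu_pow)
  have "\<exists>k. emeasure (mu_pow r) (bounded_mats (1 / real (Suc k))) \<noteq> 0"
  proof (rule ccontr)
    assume "\<not> ?thesis"
    then have "bounded_mats (1 / real (Suc k)) \<in> null_sets (mu_pow r)" for k
      using measurable_bounded_mats[of "1 / real (Suc k)"] by (auto simp: null_sets_def sets_mu_pow)
    then have "pos_mats \<in> null_sets (mu_pow r)" unfolding pos_mats_eq_UN by (rule null_sets_UN)
    then show False using r by (simp add: null_sets_def)
  qed
  then obtain k where "emeasure (mu_pow r) (bounded_mats (1 / real (Suc k))) \<noteq> 0" by blast
  then have "0 < measure (mu_pow r) (bounded_mats (1 / real (Suc k)))"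
    using measure_nonneg[of "mu_pow r"] by (simp add: mr.emeasure_eq_measure less_le)
  then show ?thesis using r(1) by (intro exI[of _ r] exI[of _ "1 / real (Suc k)"]) auto
qed

lemma markov_op_pow_lipschitz_block:
  assumes u: "bdd_meas B u" "gap_lipschitz C u" "0 \<le> C"
    and \<delta>: "0 < \<delta>" "\<delta> \<le> 1"
  shows "gap_lipschitz (C * (1 - \<delta> ^ 4 * measure (mu_pow n) (bounded_mats \<delta>))) ((markov_op ^^ n) u)"
  unfolding gap_lipschitz_def
proof (intro ballI)
  interpret mn: prob_space "mu_pow n" by (rule prob_mu_pow)
  fix x y :: "real^'n" assume xy: "x \<in> prob_simplex" "y \<in> prob_simplex"
  let ?K = "bounded_mats \<delta> :: (real^'n^'n) set"
  have K: "?K \<in> sets (mu_pow n)" using measurable_bounded_mats[OF \<delta>(1)] by (simp add: sets_mu_pow)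
  have intK: "integrable (mu_pow n) (indicator ?K :: _ \<Rightarrow> real)"
    by (rule integrable_real_indicator[OF K]) (simp add: mn.emeasure_eq_measure)
  have le: "\<bar>u (act g x) - u (act g y)\<bar> \<le> C * gap x y * (1 - \<delta> ^ 4 * indicator ?K g)"
    if g: "g \<in> nonneg_mats" for g
  proof -
    have "\<bar>u (act g x) - u (act g y)\<bar> \<le> C * gap (act g x) (act g y)"
      by (intro gap_lipschitzD[OF u(2)] act_in_simplex g xy)
    also have "gap (act g x) (act g y) \<le> (1 - \<delta> ^ 4 * indicator ?K g) * gap x y"
      using gap_act_contract[OF \<delta> _ xy, of g] gap_act_le[OF g xy] by (cases "g \<in> ?K") auto
    finally show ?thesis using u(3) by (simp add: mult_left_mono mult.assoc mult.commute[of "gap x y"])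
  qed
  have "(markov_op ^^ n) u x - (markov_op ^^ n) u y = (\<integral> g. u (act g x) - u (act g y) \<partial>mu_pow n)"
    using integrable_act[OF u(1)] xy by (simp add: markov_op_pow[OF u(1)])
  also have "\<bar>\<dots>\<bar> \<le> (\<integral> g. \<bar>u (act g x) - u (act g y)\<bar> \<partial>mu_pow n)" by (rule integral_abs_bound)
  also have "\<dots> \<le> (\<integral> g. C * gap x y * (1 - \<delta> ^ 4 * indicator ?K g) \<partial>mu_pow n)"
    using le xy intK
    by (intro integral_mono integrable_abs Bochner_Integration.integrable_diff integrable_act[OF u(1)]
        integrable_mult_right mn.integrable_const) (auto simp: space_mu_pow)
  also have "\<dots> = C * gap x y * (1 - \<delta> ^ 4 * measure (mu_pow n) ?K)"
    using K intK by (simp add: mn.prob_space)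
  finally show "\<bar>(markov_op ^^ n) u x - (markov_op ^^ n) u y\<bar>
      \<le> C * (1 - \<delta> ^ 4 * measure (mu_pow n) ?K) * gap x y" by (simp add: mult.assoc mult.commute[of "gap x y"])
qed

lemma gap_lipschitz_mono: "gap_lipschitz C u \<Longrightarrow> C \<le> C' \<Longrightarrow> gap_lipschitz C' u"
  unfolding gap_lipschitz_def by (meson gap_range(1) mult_right_mono order_trans)

lemma markov_op_pow_lipschitz_le:
  assumes "bdd_meas B u" "gap_lipschitz C u" "0 \<le> C"
  shows "gap_lipschitz C ((markov_op ^^ n) u)"
  using markov_op_pow_lipschitz_block[OF assms, of 1 n]
  by (rule gap_lipschitz_mono) (use assms in \<open>auto simp: mult_left_le\<close>)

text \<open>The constants \<open>\<theta>\<close> and \<open>K\<close> do not depend on the function.\<close>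

lemma exponential_contraction:
  "\<exists>\<theta> K. 0 < \<theta> \<and> \<theta> < 1 \<and> 0 \<le> K \<and>
     (\<forall>u B C n. bdd_meas B u \<longrightarrow> gap_lipschitz C u \<longrightarrow> 0 \<le> C \<longrightarrow>
        gap_lipschitz (C * (K * \<theta> ^ n)) ((markov_op ^^ n) u))"
proof -
  obtain r \<delta> where r: "1 \<le> r" and \<delta>: "0 < \<delta>" "\<delta> \<le> 1"
    and p: "0 < measure (mu_pow r) (bounded_mats \<delta>)"
    using bounded_mats_positive_mass by blast
  \<comment> \<open>The maximum keeps \<open>\<beta>\<close> positive, as is needed to divide by it below.\<close>
  define \<beta> where "\<beta> = max (1 / 2) (1 - \<delta> ^ 4 * measure (mu_pow r) (bounded_mats \<delta>))"
  have \<beta>: "0 < \<beta>" "\<beta> < 1" using \<delta> p by (auto simp: \<beta>_def)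
  define \<theta> where "\<theta> = root r \<beta>"
  have \<theta>: "0 < \<theta>" "\<theta> < 1" "\<theta> ^ r = \<beta>"
    using \<beta> r by (auto simp: \<theta>_def real_root_pow_pos2)
  have block: "gap_lipschitz (C * \<beta> ^ k) ((markov_op ^^ (k * r)) u)"
    if u: "bdd_meas B u" "gap_lipschitz C u" "0 \<le> C" for u B C k
  proof (induction k)
    case 0
    then show ?case using u by simp
  next
    case (Suc k)
    have "gap_lipschitz (C * \<beta> ^ k * (1 - \<delta> ^ 4 * measure (mu_pow r) (bounded_mats \<delta>)))
        ((markov_op ^^ r) ((markov_op ^^ (k * r)) u))"
      using u \<beta> by (intro markov_op_pow_lipschitz_block[OF markov_op_pow_bdd_meas[OF u(1)] Suc _ \<delta>]) auto
    then have "gap_lipschitz (C * \<beta> ^ k * \<beta>) ((markov_op ^^ r) ((markov_op ^^ (k * r)) u))"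
      using u \<beta> by (elim gap_lipschitz_mono) (auto intro!: mult_left_mono simp: \<beta>_def)
    moreover have "(markov_op ^^ r) ((markov_op ^^ (k * r)) u) = (markov_op ^^ (Suc k * r)) u"
      by (simp add: funpow_add)
    ultimately show ?case by (simp add: mult_ac)
  qed
  have "gap_lipschitz (C * (1 / \<beta> * \<theta> ^ n)) ((markov_op ^^ n) u)"
    if u: "bdd_meas B u" "gap_lipschitz C u" "0 \<le> C" for u B C n
  proof -
    have n: "n = n mod r + (n div r) * r" by simp
    have "gap_lipschitz (C * \<beta> ^ (n div r)) ((markov_op ^^ (n mod r)) ((markov_op ^^ (n div r * r)) u))"
      using u \<beta> by (intro markov_op_pow_lipschitz_le[OF markov_op_pow_bdd_meas[OF u(1)]] block) auto
    then have 1: "gap_lipschitz (C * \<beta> ^ (n div r)) ((markov_op ^^ n) u)"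
      by (subst n) (simp only: funpow_add o_apply)
    have "\<beta> \<le> \<theta> ^ (n mod r)"
      using \<theta> r by (subst \<theta>(3)[symmetric]) (intro power_decreasing, auto simp: less_imp_le)
    then have "\<beta> ^ (n div r) * \<beta> \<le> \<beta> ^ (n div r) * \<theta> ^ (n mod r)" using \<beta> by (intro mult_left_mono) auto
    also have "\<dots> = \<theta> ^ (n mod r + (n div r) * r)"
      by (simp only: \<theta>(3)[symmetric] power_add power_mult[symmetric] mult.commute)
    also have "\<dots> = \<theta> ^ n" using n by simp
    finally have "\<beta> ^ (n div r) \<le> 1 / \<beta> * \<theta> ^ n" using \<beta> by (simp add: field_simps)
    then show ?thesis using u(3) by (intro gap_lipschitz_mono[OF 1] mult_left_mono)
  qed
  then show ?thesis using \<theta> \<beta> by (intro exI[of _ \<theta>] exI[of _ "1 / \<beta>"]) auto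
qed

subsection \<open>Poisson's equation\<close>

text \<open>The solution of \<open>U - P U = u - \<integral>u d\<nu>\<close>, where \<open>P\<close> is the Markov operator, as the Neumann series
  of \<open>P\<close> applied to the centred function. The series converges exponentially fast on the simplex if \<open>u\<close> is
  bounded and Lipschitz.\<close>

definition poisson :: "(real^'n \<Rightarrow> real) \<Rightarrow> real^'n \<Rightarrow> real" where
  "poisson u x = (\<Sum>n. (markov_op ^^ n) u x - (\<integral> y. u y \<partial>\<nu>))"

lemma poisson_equation:
  assumes u: "bdd_meas B u" "gap_lipschitz C u" "0 \<le> C"
  shows "\<exists>C'\<ge>0. bdd_meas C' (poisson u) \<and> gap_lipschitz C' (poisson u)"
    and "x \<in> prob_simplex \<Longrightarrow> poisson u x - markov_op (poisson u) x = u x - (\<integral> y. u y \<partial>\<nu>)"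
proof -
  obtain \<theta> K where \<theta>: "0 < \<theta>" "\<theta> < 1" "0 \<le> K"
    and lip: "\<And>n. gap_lipschitz (C * (K * \<theta> ^ n)) ((markov_op ^^ n) u)"
    using exponential_contraction u by blast
  define c where "c = (\<integral> y. u y \<partial>\<nu>)"
  define a where "a n = C * (K * \<theta> ^ n)" for n
  have a: "summable a" "0 \<le> a n" for n
    unfolding a_def using \<theta> u(3) by (auto intro!: summable_mult summable_geometric)
  have bm: "bdd_meas B ((markov_op ^^ n) u)" for n by (rule markov_op_pow_bdd_meas[OF u(1)])
  note int_n = integrable_bdd_meas[OF bm]
  have dev: "\<bar>(markov_op ^^ n) u x - c\<bar> \<le> a n" if x: "x \<in> prob_simplex" for x n
  proof -
    have "(markov_op ^^ n) u x - c = (\<integral> y. (markov_op ^^ n) u x - (markov_op ^^ n) u y \<partial>\<nu>)"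
      using int_n integral_markov_op_pow[OF u(1), of n] by (simp add: nu.prob_space c_def)
    also have "\<bar>\<dots>\<bar> \<le> (\<integral> y. \<bar>(markov_op ^^ n) u x - (markov_op ^^ n) u y\<bar> \<partial>\<nu>)"
      by (rule integral_abs_bound)
    also have "\<dots> \<le> (\<integral> y. a n \<partial>\<nu>)"
    proof (intro integral_mono integrable_abs Bochner_Integration.integrable_diff nu.integrable_const int_n)
      fix y assume "y \<in> space \<nu>"
      then have y: "y \<in> prob_simplex" by (simp add: space_nu)
      have "a n * gap x y \<le> a n" using gap_range[OF x y] a by (simp add: mult_left_le)
      then show "\<bar>(markov_op ^^ n) u x - (markov_op ^^ n) u y\<bar> \<le> a n"
        using gap_lipschitzD[OF lip x y, of n] by (simp add: a_def)
    qed
    finally show ?thesis by (simp add: nu.prob_space)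
  qed
  have smb: "summable (\<lambda>n. \<bar>(markov_op ^^ n) u x - c\<bar>)" if x: "x \<in> prob_simplex" for x
    by (rule summable_comparison_test'[OF a(1), of 0]) (use dev[OF x] in auto)
  have sm: "summable (\<lambda>n. (markov_op ^^ n) u x - c)" if x: "x \<in> prob_simplex" for x
    by (rule summable_rabs_cancel[OF smb[OF x]])
  define C' where "C' = suminf a"
  have C': "0 \<le> C'" unfolding C'_def using a by (intro suminf_nonneg)
  have "poisson u \<in> borel_measurable simplex_borel"
    unfolding poisson_def[abs_def] using bdd_measD(1)[OF bm] by (intro borel_measurable_suminf) auto
  moreover have "\<bar>poisson u x\<bar> \<le> C'" if x: "x \<in> prob_simplex" for x
  proof -
    have "\<bar>poisson u x\<bar> \<le> (\<Sum>n. \<bar>(markov_op ^^ n) u x - c\<bar>)"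
      unfolding poisson_def c_def[symmetric] by (rule summable_rabs[OF smb[OF x]])
    also have "\<dots> \<le> C'" unfolding C'_def by (intro suminf_le smb[OF x] a dev[OF x])
    finally show ?thesis .
  qed
  ultimately have bp: "bdd_meas C' (poisson u)" by (simp add: bdd_meas_def)
  have "\<bar>poisson u x - poisson u y\<bar> \<le> C' * gap x y" if xy: "x \<in> prob_simplex" "y \<in> prob_simplex" for x y
  proof -
    have le: "\<bar>(markov_op ^^ n) u x - (markov_op ^^ n) u y\<bar> \<le> a n * gap x y" for n
      using gap_lipschitzD[OF lip xy, of n] by (simp add: a_def)
    have smd: "summable (\<lambda>n. \<bar>(markov_op ^^ n) u x - (markov_op ^^ n) u y\<bar>)"
      by (rule summable_comparison_test'[OF summable_mult2[OF a(1)], of 0]) (use le in auto)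
    have "poisson u x - poisson u y = (\<Sum>n. (markov_op ^^ n) u x - (markov_op ^^ n) u y)"
      unfolding poisson_def c_def[symmetric] using suminf_diff[OF sm[OF xy(1)] sm[OF xy(2)]] by simp
    also have "\<bar>\<dots>\<bar> \<le> (\<Sum>n. \<bar>(markov_op ^^ n) u x - (markov_op ^^ n) u y\<bar>)" by (rule summable_rabs[OF smd])
    also have "\<dots> \<le> (\<Sum>n. a n * gap x y)" by (intro suminf_le smd summable_mult2 a le)
    also have "\<dots> = C' * gap x y" unfolding C'_def using suminf_mult2[OF a(1)] by simp
    finally show ?thesis .
  qed
  then have "gap_lipschitz C' (poisson u)" by (simp add: gap_lipschitz_def)
  then show "\<exists>C'\<ge>0. bdd_meas C' (poisson u) \<and> gap_lipschitz C' (poisson u)" using bp C' by blast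
  assume x: "x \<in> prob_simplex"
  have in_s: "act g x \<in> prob_simplex" if "g \<in> space \<mu>" for g
    using that x by (simp add: space_mu act_in_simplex)
  have int: "integrable \<mu> (\<lambda>g. (markov_op ^^ n) u (act g x) - c)" for n
    using integrable_act_mu[OF bm x] by simp
  have "markov_op (poisson u) x = (\<integral> g. (\<Sum>n. (markov_op ^^ n) u (act g x) - c) \<partial>\<mu>)"
    by (simp add: markov_op_def poisson_def c_def)
  also have "\<dots> = (\<Sum>n. (\<integral> g. (markov_op ^^ n) u (act g x) - c \<partial>\<mu>))"
  proof (rule integral_suminf)
    show "integrable \<mu> (\<lambda>g. (markov_op ^^ n) u (act g x) - c)" for n by (rule int)
    show "AE g in \<mu>. summable (\<lambda>n. norm ((markov_op ^^ n) u (act g x) - c))"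
      using smb in_s by (intro AE_I2) auto
    show "summable (\<lambda>n. \<integral> g. norm ((markov_op ^^ n) u (act g x) - c) \<partial>\<mu>)"
    proof (rule summable_comparison_test'[OF a(1), of 0])
      fix n
      have "(\<integral> g. norm ((markov_op ^^ n) u (act g x) - c) \<partial>\<mu>) \<le> (\<integral> g. a n \<partial>\<mu>)"
        using dev in_s by (intro integral_mono integrable_norm int) auto
      then show "norm (\<integral> g. norm ((markov_op ^^ n) u (act g x) - c) \<partial>\<mu>) \<le> a n"
        by (simp add: mu.prob_space)
    qed
  qed
  also have "\<dots> = (\<Sum>n. (markov_op ^^ Suc n) u x - c)"
    using integrable_act_mu[OF bm x] by (intro suminf_cong) (simp add: markov_op_def mu.prob_space)
  also have "\<dots> = poisson u x - (u x - c)"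
    unfolding poisson_def c_def[symmetric] using suminf_split_head[OF sm[OF x]] by simp
  finally show "poisson u x - markov_op (poisson u) x = u x - (\<integral> y. u y \<partial>\<nu>)" by (simp add: c_def)
qed

end

section \<open>Martingale increments\<close>

lemma integrable_pair_fst:
  fixes f :: "'a \<Rightarrow> 'b::{banach, second_countable_topology}"
  assumes "prob_space N" "integrable M f"
  shows "integrable (M \<Otimes>\<^sub>M N) (\<lambda>p. f (fst p))"
  using integrable_distr[OF measurable_fst, of M N f] prob_space.distr_pair_fst[OF assms(1), of M] assms(2)
  by simp

lemma integrable_pair_snd:
  fixes f :: "'a \<Rightarrow> 'b::{banach, second_countable_topology}"
  assumes "prob_space N" "prob_space M" "integrable M f"
  shows "integrable (N \<Otimes>\<^sub>M M) (\<lambda>p. f (snd p))"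
proof -
  interpret pair_prob_space M N
    using assms by (simp add: pair_prob_space_def pair_sigma_finite_def prob_space_imp_sigma_finite)
  show ?thesis using integrable_product_swap[OF integrable_pair_fst[OF assms(1,3)]] by (simp add: case_prod_beta')
qed

lemma cmod_iexp_diff_le: "cmod (iexp a - iexp b) \<le> \<bar>a - b\<bar>"
proof -
  have "iexp a - iexp b = iexp b * (iexp (a - b) - 1)"
    by (simp add: algebra_simps flip: exp_add)
  then have "cmod (iexp a - iexp b) = cmod (iexp (a - b) - 1)" by (simp add: norm_mult)
  then show ?thesis using iexp_approx1[of "a - b" 0] by simp
qed

context positive_walk
begin

lemma integrable_log_size_sq: "integrable \<mu> (\<lambda>g. (log_size g)\<^sup>2)"
proof -
  define d where "d = real CARD('n)"
  have d: "0 < d" by (simp add: d_def)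
  have "integrable \<mu> (\<lambda>g. (log_size g / d)\<^sup>2)"
  proof (rule integrableI_nonneg)
    have "(\<integral>\<^sup>+ g. ennreal ((log_size g / d)\<^sup>2) \<partial>\<mu>) \<le> (\<integral>\<^sup>+ g. ennreal (ln (Nfun g) powr 2) \<partial>\<mu>)"
    proof (intro nn_integral_mono ennreal_leI)
      fix g assume "g \<in> space \<mu>"
      then have g: "g \<in> nonneg_mats" by (simp add: space_mu)
      have "log_size g / d \<le> ln (Nfun g)"
        using log_size_le_ln_Nfun(2)[OF g] d by (simp add: d_def field_simps)
      then have "(log_size g / d)\<^sup>2 \<le> (ln (Nfun g))\<^sup>2"
        using log_size_nonneg[of g] d by (intro power_mono) auto
      also have "\<dots> = ln (Nfun g) powr 2" using log_size_le_ln_Nfun(1)[OF g] by simp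
      finally show "(log_size g / d)\<^sup>2 \<le> ln (Nfun g) powr 2" .
    qed
    also have "\<dots> < \<infinity>" using moment by (simp add: has_moment_def)
    finally show "(\<integral>\<^sup>+ g. ennreal ((log_size g / d)\<^sup>2) \<partial>\<mu>) < \<infinity>" .
  qed auto
  then have "integrable \<mu> (\<lambda>g. d\<^sup>2 * (log_size g / d)\<^sup>2)" by (rule integrable_mult_right)
  then show ?thesis using d by (simp add: power_divide)
qed

lemma integrable_log_size: "integrable \<mu> log_size"
proof -
  have "log_size \<in> borel_measurable \<mu>" by measurable
  then show ?thesis by (rule mu.square_integrable_imp_integrable[OF _ integrable_log_size_sq])
qed

text \<open>The mean increment of the cocycle from a given point, and its stationary mean, which turns out
  to be the Lyapunov exponent.\<close>

definition drift :: "real^'n \<Rightarrow> real" where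
  "drift x = (\<integral> g. cocycle g x \<partial>\<mu>)"

definition lyap :: real where
  "lyap = (\<integral> x. drift x \<partial>\<nu>)"

lemma integrable_cocycle:
  assumes x: "x \<in> prob_simplex"
  shows "integrable \<mu> (\<lambda>g. cocycle g x)"
proof (rule Bochner_Integration.integrable_bound[OF integrable_log_size])
  have [measurable]: "x \<in> space simplex_borel" using x by (simp add: space_simplex_borel)
  show "(\<lambda>g. cocycle g x) \<in> borel_measurable \<mu>" by measurable
  show "AE g in \<mu>. norm (cocycle g x) \<le> norm (log_size g)"
    using abs_cocycle_le[OF _ x] by (intro AE_I2) (auto simp: space_mu log_size_nonneg)
qed

lemma drift_regular:
  "\<exists>B C. 0 \<le> C \<and> bdd_meas B drift \<and> gap_lipschitz C drift"
proof (intro exI conjI)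
  note int = integrable_log_size
  show "bdd_meas (\<integral> g. log_size g \<partial>\<mu>) drift"
    unfolding bdd_meas_def
  proof (intro conjI ballI)
    show "drift \<in> borel_measurable simplex_borel" unfolding drift_def[abs_def] by measurable
    fix x :: "real^'n" assume x: "x \<in> prob_simplex"
    have "\<bar>drift x\<bar> \<le> (\<integral> g. \<bar>cocycle g x\<bar> \<partial>\<mu>)" unfolding drift_def by (rule integral_abs_bound)
    also have "\<dots> \<le> (\<integral> g. log_size g \<partial>\<mu>)"
      using abs_cocycle_le[OF _ x] by (intro integral_mono integrable_abs integrable_cocycle x int) (auto simp: space_mu)
    finally show "\<bar>drift x\<bar> \<le> (\<integral> g. log_size g \<partial>\<mu>)" .
  qed
  show "gap_lipschitz (\<integral> g. 2 + 4 * log_size g \<partial>\<mu>) drift"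
    unfolding gap_lipschitz_def
  proof (intro ballI)
    fix x y :: "real^'n" assume xy: "x \<in> prob_simplex" "y \<in> prob_simplex"
    have "drift x - drift y = (\<integral> g. cocycle g x - cocycle g y \<partial>\<mu>)"
      unfolding drift_def using integrable_cocycle xy by simp
    also have "\<bar>\<dots>\<bar> \<le> (\<integral> g. \<bar>cocycle g x - cocycle g y\<bar> \<partial>\<mu>)" by (rule integral_abs_bound)
    also have "\<dots> \<le> (\<integral> g. (2 + 4 * log_size g) * gap x y \<partial>\<mu>)"
      using abs_cocycle_diff_le[OF _ xy]
      by (intro integral_mono integrable_abs Bochner_Integration.integrable_diff integrable_cocycle xy
          integrable_mult_left Bochner_Integration.integrable_add integrable_mult_right int mu.integrable_const)
        (auto simp: space_mu)
    finally show "\<bar>drift x - drift y\<bar> \<le> (\<integral> g. 2 + 4 * log_size g \<partial>\<mu>) * gap x y" by simp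
  qed
  show "0 \<le> (\<integral> g. 2 + 4 * log_size g \<partial>\<mu>)"
    by (intro integral_nonneg_AE AE_I2) (simp add: log_size_nonneg)
qed

text \<open>The corrector \<open>\<psi>\<close> that turns the centred cocycle into a martingale.\<close>

definition psi :: "real^'n \<Rightarrow> real" where
  "psi = poisson drift"

text \<open>Some constant that bounds both \<open>\<psi>\<close> on the simplex and its Lipschitz constant.\<close>

definition psi_bound :: real where
  "psi_bound = (SOME C. 0 \<le> C \<and> bdd_meas C psi \<and> gap_lipschitz C psi)"

lemma psi_props: "0 \<le> psi_bound" "bdd_meas psi_bound psi" "gap_lipschitz psi_bound psi"
proof -
  obtain B C where "0 \<le> C" "bdd_meas B drift" "gap_lipschitz C drift" using drift_regular by blast
  then have "\<exists>C. 0 \<le> C \<and> bdd_meas C psi \<and> gap_lipschitz C psi"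
    unfolding psi_def using poisson_equation(1)[of B drift C] by blast
  from someI_ex[OF this] show "0 \<le> psi_bound" "bdd_meas psi_bound psi" "gap_lipschitz psi_bound psi"
    by (auto simp: psi_bound_def)
qed

lemma abs_psi_le: "x \<in> prob_simplex \<Longrightarrow> \<bar>psi x\<bar> \<le> psi_bound"
  by (rule bdd_measD(2)[OF psi_props(2)])

lemma measurable_psi [measurable]: "psi \<in> borel_measurable simplex_borel"
  by (rule bdd_measD(1)[OF psi_props(2)])

lemma psi_equation: "x \<in> prob_simplex \<Longrightarrow> psi x - markov_op psi x = drift x - lyap"
  unfolding psi_def lyap_def using drift_regular poisson_equation(2) by blast

text \<open>The martingale increment, its sum along a product \<open>g\<close> of \<open>n\<close> matrices, where the correctors
  telescope, and a bound for the increment that does not depend on the point.\<close>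

definition incr :: "real^'n^'n \<Rightarrow> real^'n \<Rightarrow> real" where
  "incr g x = cocycle g x - lyap + psi (act g x) - psi x"

definition msum :: "nat \<Rightarrow> real^'n^'n \<Rightarrow> real^'n \<Rightarrow> real" where
  "msum n g x = cocycle g x - real n * lyap + psi (act g x) - psi x"

definition incr_bound :: "real^'n^'n \<Rightarrow> real" where
  "incr_bound g = log_size g + \<bar>lyap\<bar> + 2 * psi_bound"

lemma measurable_incr [measurable (raw)]:
  assumes [measurable]: "f \<in> A \<rightarrow>\<^sub>M mat_borel" "k \<in> A \<rightarrow>\<^sub>M simplex_borel"
  shows "(\<lambda>a. incr (f a) (k a)) \<in> borel_measurable A"
  unfolding incr_def by measurable

lemma measurable_msum [measurable (raw)]:
  assumes [measurable]: "f \<in> A \<rightarrow>\<^sub>M mat_borel" "k \<in> A \<rightarrow>\<^sub>M simplex_borel"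
  shows "(\<lambda>a. msum n (f a) (k a)) \<in> borel_measurable A"
  unfolding msum_def by measurable

lemma measurable_incr_bound [measurable]: "incr_bound \<in> borel_measurable mat_borel"
  unfolding incr_bound_def[abs_def] by measurable

lemma msum_1: "msum 1 = incr"
  by (simp add: msum_def incr_def fun_eq_iff)

lemma msum_mult:
  assumes "g \<in> nonneg_mats" "h \<in> nonneg_mats" "x \<in> prob_simplex"
  shows "msum (Suc n) (g ** h) x = msum n h x + incr g (act h x)"
  using assms by (simp add: msum_def incr_def act_mult cocycle_mult algebra_simps)

lemma msum_approx:
  assumes "g \<in> nonneg_mats" "x \<in> prob_simplex"
  shows "\<bar>(cocycle g x - real n * lyap) - msum n g x\<bar> \<le> 2 * psi_bound"
  using abs_psi_le[OF assms(2)] abs_psi_le[OF act_in_simplex[OF assms]] by (simp add: msum_def)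

lemma abs_incr_le:
  assumes "g \<in> nonneg_mats" "x \<in> prob_simplex"
  shows "\<bar>incr g x\<bar> \<le> incr_bound g"
  using abs_cocycle_le[OF assms] abs_psi_le[OF assms(2)] abs_psi_le[OF act_in_simplex[OF assms]]
  by (simp add: incr_def incr_bound_def)

lemma incr_bound_nonneg: "0 \<le> incr_bound g"
  using log_size_nonneg[of g] psi_props(1) by (simp add: incr_bound_def)

lemma integrable_incr_bound: "integrable \<mu> incr_bound" "integrable \<mu> (\<lambda>g. (incr_bound g)\<^sup>2)"
proof -
  define c where "c = \<bar>lyap\<bar> + 2 * psi_bound"
  have eq: "incr_bound = (\<lambda>g. log_size g + c)" by (simp add: incr_bound_def c_def add.assoc fun_eq_iff)
  show "integrable \<mu> incr_bound" unfolding eq using integrable_log_size by simp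
  have "(\<lambda>g. (incr_bound g)\<^sup>2) = (\<lambda>g. (log_size g)\<^sup>2 + 2 * c * log_size g + c\<^sup>2)"
    by (simp add: eq power2_sum fun_eq_iff algebra_simps)
  then show "integrable \<mu> (\<lambda>g. (incr_bound g)\<^sup>2)"
    using integrable_log_size integrable_log_size_sq by simp
qed

lemma integrable_incr:
  assumes x: "x \<in> prob_simplex"
  shows "integrable \<mu> (\<lambda>g. incr g x)" "integrable \<mu> (\<lambda>g. (incr g x)\<^sup>2)"
proof -
  have [measurable]: "x \<in> space simplex_borel" using x by (simp add: space_simplex_borel)
  show "integrable \<mu> (\<lambda>g. incr g x)"
  proof (rule Bochner_Integration.integrable_bound[OF integrable_incr_bound(1)])
    show "AE g in \<mu>. norm (incr g x) \<le> norm (incr_bound g)"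
      using abs_incr_le[OF _ x] incr_bound_nonneg by (intro AE_I2) (auto simp: space_mu)
  qed measurable
  show "integrable \<mu> (\<lambda>g. (incr g x)\<^sup>2)"
  proof (rule Bochner_Integration.integrable_bound[OF integrable_incr_bound(2)])
    show "AE g in \<mu>. norm ((incr g x)\<^sup>2) \<le> norm ((incr_bound g)\<^sup>2)"
      using abs_incr_le[OF _ x] incr_bound_nonneg
      by (intro AE_I2) (auto simp: space_mu intro!: power2_le_iff_abs_le[THEN iffD2])
  qed measurable
qed

lemma integral_incr: "x \<in> prob_simplex \<Longrightarrow> (\<integral> g. incr g x \<partial>\<mu>) = 0"
  using psi_equation[of x] integrable_cocycle[of x] integrable_act_mu[OF psi_props(2), of x]
  by (simp add: incr_def markov_op_def drift_def mu.prob_space)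

lemma abs_incr_diff_le:
  assumes g: "g \<in> nonneg_mats" and xy: "x \<in> prob_simplex" "y \<in> prob_simplex"
  shows "\<bar>incr g x - incr g y\<bar> \<le> (2 + 4 * incr_bound g) * gap x y"
proof -
  have "psi_bound * gap (act g x) (act g y) \<le> psi_bound * gap x y"
    using gap_act_le[OF g xy] psi_props(1) by (rule mult_left_mono)
  then have "\<bar>incr g x - incr g y\<bar> \<le> (2 + 4 * log_size g) * gap x y + 2 * (psi_bound * gap x y)"
    using abs_cocycle_diff_le[OF g xy] gap_lipschitzD[OF psi_props(3) xy]
      gap_lipschitzD[OF psi_props(3) act_in_simplex[OF g xy(1)] act_in_simplex[OF g xy(2)]]
    by (simp add: incr_def)
  also have "\<dots> = (2 + 4 * log_size g + 2 * psi_bound) * gap x y" by (simp add: algebra_simps)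
  also have "\<dots> \<le> (2 + 4 * incr_bound g) * gap x y"
    using psi_props(1) gap_range[OF xy] by (intro mult_right_mono) (auto simp: incr_bound_def)
  finally show ?thesis .
qed

text \<open>The conditional variance of an increment, and its stationary mean, which is the asymptotic
  variance \<open>s\<^sup>2\<close>.\<close>

definition cond_var :: "real^'n \<Rightarrow> real" where
  "cond_var x = (\<integral> g. (incr g x)\<^sup>2 \<partial>\<mu>)"

definition asym_var :: real where
  "asym_var = (\<integral> x. cond_var x \<partial>\<nu>)"

lemma cond_var_nonneg: "0 \<le> cond_var x"
  unfolding cond_var_def by (intro integral_nonneg_AE AE_I2) auto

lemma asym_var_nonneg: "0 \<le> asym_var"
  unfolding asym_var_def using cond_var_nonneg by (intro integral_nonneg_AE AE_I2) auto

lemma cond_var_regular: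
  "\<exists>B C. 0 \<le> C \<and> bdd_meas B cond_var \<and> gap_lipschitz C cond_var"
proof (intro exI conjI)
  define C where "C = (\<integral> g. (2 + 4 * incr_bound g) * (2 * incr_bound g) \<partial>\<mu>)"
  have intC: "integrable \<mu> (\<lambda>g. (2 + 4 * incr_bound g) * (2 * incr_bound g))"
    using integrable_incr_bound by (simp add: algebra_simps flip: power2_eq_square)
  show "0 \<le> C" unfolding C_def using incr_bound_nonneg by (intro integral_nonneg_AE AE_I2) auto
  show "bdd_meas (\<integral> g. (incr_bound g)\<^sup>2 \<partial>\<mu>) cond_var"
    unfolding bdd_meas_def
  proof (intro conjI ballI)
    show "cond_var \<in> borel_measurable simplex_borel" unfolding cond_var_def[abs_def] by measurable
    fix x :: "real^'n" assume x: "x \<in> prob_simplex"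
    have "cond_var x \<le> (\<integral> g. (incr_bound g)\<^sup>2 \<partial>\<mu>)"
      unfolding cond_var_def using abs_incr_le[OF _ x]
      by (intro integral_mono integrable_incr x integrable_incr_bound)
        (auto simp: space_mu incr_bound_nonneg intro!: power2_le_iff_abs_le[THEN iffD2])
    then show "\<bar>cond_var x\<bar> \<le> (\<integral> g. (incr_bound g)\<^sup>2 \<partial>\<mu>)" using cond_var_nonneg[of x] by simp
  qed
  show "gap_lipschitz C cond_var"
    unfolding gap_lipschitz_def
  proof (intro ballI)
    fix x y :: "real^'n" assume xy: "x \<in> prob_simplex" "y \<in> prob_simplex"
    have le: "\<bar>(incr g x)\<^sup>2 - (incr g y)\<^sup>2\<bar> \<le> (2 + 4 * incr_bound g) * (2 * incr_bound g) * gap x y"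
      if "g \<in> space \<mu>" for g
    proof -
      have g: "g \<in> nonneg_mats" using that by (simp add: space_mu)
      have "\<bar>(incr g x)\<^sup>2 - (incr g y)\<^sup>2\<bar> = \<bar>incr g x - incr g y\<bar> * \<bar>incr g x + incr g y\<bar>"
        by (simp add: power2_eq_square square_diff_square_factored abs_mult mult.commute)
      also have "\<dots> \<le> ((2 + 4 * incr_bound g) * gap x y) * (2 * incr_bound g)"
        using abs_incr_diff_le[OF g xy] abs_incr_le[OF g xy(1)] abs_incr_le[OF g xy(2)]
          gap_range[OF xy] incr_bound_nonneg[of g]
        by (intro mult_mono) auto
      finally show ?thesis by (simp add: mult_ac)
    qed
    have "cond_var x - cond_var y = (\<integral> g. (incr g x)\<^sup>2 - (incr g y)\<^sup>2 \<partial>\<mu>)"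
      unfolding cond_var_def using integrable_incr xy by simp
    also have "\<bar>\<dots>\<bar> \<le> (\<integral> g. \<bar>(incr g x)\<^sup>2 - (incr g y)\<^sup>2\<bar> \<partial>\<mu>)" by (rule integral_abs_bound)
    also have "\<dots> \<le> (\<integral> g. (2 + 4 * incr_bound g) * (2 * incr_bound g) * gap x y \<partial>\<mu>)"
      using le by (intro integral_mono integrable_abs Bochner_Integration.integrable_diff integrable_incr xy
          integrable_mult_left intC)
    also have "\<dots> = C * gap x y" by (simp add: C_def)
    finally show "\<bar>cond_var x - cond_var y\<bar> \<le> C * gap x y" .
  qed
qed

section \<open>The second moment\<close>

text \<open>Orthogonality of the increments: the mixed term vanishes because \<open>incr\<close> has mean zero from
  every point.\<close>

lemma integral_msum_sq:
  assumes x: "x \<in> prob_simplex"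
  shows "integrable (mu_pow n) (\<lambda>g. (msum n g x)\<^sup>2)
    \<and> (\<integral> g. (msum n g x)\<^sup>2 \<partial>mu_pow n) = (\<Sum>k<n. (markov_op ^^ k) cond_var x)"
proof (induction n)
  case 0
  have [measurable]: "x \<in> space simplex_borel" using x by (simp add: space_simplex_borel)
  have "(\<lambda>g. (msum 0 g x)\<^sup>2) \<in> borel_measurable mat_borel" by measurable
  then have "integrable (mu_pow 0) (\<lambda>g. (msum 0 g x)\<^sup>2)"
    unfolding integrable_iff_bounded
    by (simp, subst nn_integral_return) (auto simp: space_mat_borel mat_1_nonneg_mats)
  moreover have "(\<integral> g. (msum 0 g x)\<^sup>2 \<partial>mu_pow 0) = (msum 0 (mat 1) x)\<^sup>2"
    by (simp, subst integral_return) (auto simp: space_mat_borel mat_1_nonneg_mats)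
  ultimately show ?case by (simp add: msum_def cocycle_one act_one x)
next
  case (Suc n)
  have [measurable]: "x \<in> space simplex_borel" using x by (simp add: space_simplex_borel)
  interpret mn: prob_space "mu_pow n" by (rule prob_mu_pow)
  obtain B C where V: "bdd_meas B cond_var" "gap_lipschitz C cond_var" using cond_var_regular by blast
  have intM: "integrable (mu_pow n) (\<lambda>h. (msum n h x)\<^sup>2)" using Suc by blast
  have intM1: "integrable (mu_pow n) (\<lambda>h. msum n h x)"
    by (rule mn.square_integrable_imp_integrable[OF _ intM]) measurable
  have "integrable (\<mu> \<Otimes>\<^sub>M mu_pow n) (\<lambda>p. 2 * (msum n (snd p) x)\<^sup>2 + 2 * (incr_bound (fst p))\<^sup>2)"
    by (intro Bochner_Integration.integrable_add integrable_mult_right integrable_pair_fst[OF prob_mu_pow]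
        integrable_pair_snd[OF prob_mu prob_mu_pow] intM integrable_incr_bound)
  then have int: "integrable (\<mu> \<Otimes>\<^sub>M mu_pow n) (\<lambda>p. (msum (Suc n) (fst p ** snd p) x)\<^sup>2)"
  proof (rule Bochner_Integration.integrable_bound)
    show "AE p in \<mu> \<Otimes>\<^sub>M mu_pow n. norm ((msum (Suc n) (fst p ** snd p) x)\<^sup>2)
        \<le> norm (2 * (msum n (snd p) x)\<^sup>2 + 2 * (incr_bound (fst p))\<^sup>2)"
    proof (rule AE_I2)
      fix p assume "p \<in> space (\<mu> \<Otimes>\<^sub>M mu_pow n)"
      then have p: "fst p \<in> nonneg_mats" "snd p \<in> nonneg_mats"
        by (auto simp: space_pair_measure space_mu space_mu_pow)
      let ?a = "msum n (snd p) x" and ?b = "incr (fst p) (act (snd p) x)"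
      have "?b\<^sup>2 \<le> (incr_bound (fst p))\<^sup>2"
        using abs_incr_le[OF p(1) act_in_simplex[OF p(2) x]] incr_bound_nonneg
        by (intro power2_le_iff_abs_le[THEN iffD2]) auto
      moreover have "(?a + ?b)\<^sup>2 + (?a - ?b)\<^sup>2 = 2 * ?a\<^sup>2 + 2 * ?b\<^sup>2"
        by (simp add: power2_eq_square algebra_simps)
      ultimately have "(?a + ?b)\<^sup>2 \<le> 2 * ?a\<^sup>2 + 2 * (incr_bound (fst p))\<^sup>2"
        using zero_le_power2[of "?a - ?b"] by linarith
      then show "norm ((msum (Suc n) (fst p ** snd p) x)\<^sup>2)
          \<le> norm (2 * (msum n (snd p) x)\<^sup>2 + 2 * (incr_bound (fst p))\<^sup>2)"
        by (simp add: msum_mult[OF p x])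
    qed
  qed measurable
  have meas: "(\<lambda>g. (msum (Suc n) g x)\<^sup>2) \<in> borel_measurable mat_borel" by measurable
  note step = integral_mu_pow_Suc[OF meas int]
  have "(\<integral> g. (msum (Suc n) g x)\<^sup>2 \<partial>mu_pow (Suc n))
      = (\<integral> h. \<integral> g. (msum (Suc n) (g ** h) x)\<^sup>2 \<partial>\<mu> \<partial>mu_pow n)" by (rule step(2))
  also have "\<dots> = (\<integral> h. (msum n h x)\<^sup>2 + cond_var (act h x) \<partial>mu_pow n)"
  proof (intro Bochner_Integration.integral_cong refl)
    fix h assume "h \<in> space (mu_pow n)"
    then have h: "h \<in> nonneg_mats" by (simp add: space_mu_pow)
    note y = act_in_simplex[OF h x]
    have "(\<integral> g. (msum (Suc n) (g ** h) x)\<^sup>2 \<partial>\<mu>)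
        = (\<integral> g. (msum n h x)\<^sup>2 + (2 * msum n h x * incr g (act h x) + (incr g (act h x))\<^sup>2) \<partial>\<mu>)"
      by (intro Bochner_Integration.integral_cong refl) (auto simp: msum_mult h x space_mu power2_sum)
    also have "\<dots> = (msum n h x)\<^sup>2 + cond_var (act h x)"
      using integrable_incr[OF y] integral_incr[OF y] by (simp add: cond_var_def mu.prob_space)
    finally show "(\<integral> g. (msum (Suc n) (g ** h) x)\<^sup>2 \<partial>\<mu>) = (msum n h x)\<^sup>2 + cond_var (act h x)" .
  qed
  also have "\<dots> = (\<integral> h. (msum n h x)\<^sup>2 \<partial>mu_pow n) + (\<integral> h. cond_var (act h x) \<partial>mu_pow n)"
    by (intro Bochner_Integration.integral_add intM integrable_act[OF V(1) x])
  also have "\<dots> = (\<Sum>k<Suc n. (markov_op ^^ k) cond_var x)"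
    using Suc by (simp add: markov_op_pow[OF V(1) x])
  finally show ?case using step(1) by blast
qed

lemma nn_integral_msum_sq:
  "(\<integral>\<^sup>+ p. ennreal ((msum n (fst p) (snd p))\<^sup>2) \<partial>(mu_pow n \<Otimes>\<^sub>M \<nu>)) = ennreal (real n * asym_var)"
proof -
  interpret pair_prob_space "mu_pow n" \<nu>
    using prob_nu prob_mu_pow by (simp add: pair_prob_space_def pair_sigma_finite_def prob_space_imp_sigma_finite)
  obtain B C where V: "bdd_meas B cond_var" "gap_lipschitz C cond_var" using cond_var_regular by blast
  have nn: "0 \<le> (\<Sum>k<n. (markov_op ^^ k) cond_var x)" if "x \<in> prob_simplex" for x
    unfolding markov_op_pow[OF V(1) that] using cond_var_nonneg
    by (intro sum_nonneg integral_nonneg_AE AE_I2) auto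
  have "(\<integral>\<^sup>+ p. ennreal ((msum n (fst p) (snd p))\<^sup>2) \<partial>(mu_pow n \<Otimes>\<^sub>M \<nu>))
      = (\<integral>\<^sup>+ x. \<integral>\<^sup>+ g. ennreal ((msum n g x)\<^sup>2) \<partial>mu_pow n \<partial>\<nu>)"
    by (subst nn_integral_snd[symmetric]) (auto simp: case_prod_beta')
  also have "\<dots> = (\<integral>\<^sup>+ x. ennreal (\<Sum>k<n. (markov_op ^^ k) cond_var x) \<partial>\<nu>)"
    using integral_msum_sq[of _ n] by (intro nn_integral_cong) (simp add: space_nu nn_integral_eq_integral)
  also have "\<dots> = ennreal (\<integral> x. (\<Sum>k<n. (markov_op ^^ k) cond_var x) \<partial>\<nu>)"
    using nn by (intro nn_integral_eq_integral Bochner_Integration.integrable_sum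
        integrable_bdd_meas[OF markov_op_pow_bdd_meas[OF V(1)]] AE_I2) (auto simp: space_nu)
  also have "(\<integral> x. (\<Sum>k<n. (markov_op ^^ k) cond_var x) \<partial>\<nu>) = real n * asym_var"
    by (subst Bochner_Integration.integral_sum)
      (auto simp: integrable_bdd_meas[OF markov_op_pow_bdd_meas[OF V(1)]] integral_markov_op_pow[OF V(1)] asym_var_def)
  finally show ?thesis .
qed

end

section \<open>Characteristic functions\<close>

context positive_walk
begin

text \<open>The corrector that compensates the fluctuations of the conditional variance, and some bound for
  it.\<close>

definition corr :: "real^'n \<Rightarrow> real" where
  "corr = poisson cond_var"

definition corr_bound :: real where
  "corr_bound = (SOME C. 0 \<le> C \<and> bdd_meas C corr)"

lemma corr_props: "0 \<le> corr_bound" "bdd_meas corr_bound corr"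
proof -
  obtain B C where "0 \<le> C" "bdd_meas B cond_var" "gap_lipschitz C cond_var" using cond_var_regular by blast
  then have "\<exists>C. 0 \<le> C \<and> bdd_meas C corr"
    unfolding corr_def using poisson_equation(1)[of B cond_var C] by blast
  from someI_ex[OF this] show "0 \<le> corr_bound" "bdd_meas corr_bound corr"
    by (auto simp: corr_bound_def)
qed

lemma corr_equation: "x \<in> prob_simplex \<Longrightarrow> corr x - markov_op corr x = cond_var x - asym_var"
  unfolding corr_def asym_var_def using cond_var_regular poisson_equation(2) by blast

lemma measurable_corr [measurable]: "corr \<in> borel_measurable simplex_borel"
  by (rule bdd_measD(1)[OF corr_props(2)])

text \<open>The Markov operator of \<open>n\<close> steps, and of one step, twisted by the character \<open>exp (i s \<cdot>)\<close> of
  the martingale. At the constant function \<open>1\<close> the former is the characteristic function of \<open>msum n\<close>.\<close>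

definition twisted :: "nat \<Rightarrow> real \<Rightarrow> (real^'n \<Rightarrow> real) \<Rightarrow> real^'n \<Rightarrow> complex" where
  "twisted n s u x = (\<integral> g. iexp (s * msum n g x) * complex_of_real (u (act g x)) \<partial>mu_pow n)"

definition twisted_step :: "real \<Rightarrow> (real^'n \<Rightarrow> real) \<Rightarrow> real^'n \<Rightarrow> complex" where
  "twisted_step s u x = (\<integral> g. iexp (s * incr g x) * complex_of_real (u (act g x)) \<partial>\<mu>)"

lemma integrable_twisted:
  assumes u: "bdd_meas B u" and x: "x \<in> prob_simplex"
  shows "integrable (mu_pow n) (\<lambda>g. iexp (s * msum n g x) * complex_of_real (u (act g x)))"
proof -
  interpret mn: prob_space "mu_pow n" by (rule prob_mu_pow)
  have [measurable]: "u \<in> borel_measurable simplex_borel" "x \<in> space simplex_borel"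
    using u x by (auto simp: bdd_meas_def space_simplex_borel)
  show ?thesis
    using bdd_measD(2)[OF u] x
    by (intro mn.integrable_const_bound[of _ B]) (auto simp: norm_mult space_mu_pow act_in_simplex)
qed

lemma integrable_twisted_step:
  assumes u: "bdd_meas B u" and x: "x \<in> prob_simplex"
  shows "integrable \<mu> (\<lambda>g. iexp (s * incr g x) * complex_of_real (u (act g x)))"
  using integrable_twisted[OF assms, of 1 s] unfolding mu_pow_1 msum_1 .

lemma twisted_Suc:
  assumes u: "bdd_meas B u" and x: "x \<in> prob_simplex"
  shows "twisted (Suc n) s u x = (\<integral> h. iexp (s * msum n h x) * twisted_step s u (act h x) \<partial>mu_pow n)"
proof -
  interpret pair_prob_space \<mu> "mu_pow n" by (rule pair_prob_mu_pow)
  have [measurable]: "u \<in> borel_measurable simplex_borel" "x \<in> space simplex_borel"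
    using u x by (auto simp: bdd_meas_def space_simplex_borel)
  let ?F = "\<lambda>g. iexp (s * msum (Suc n) g x) * complex_of_real (u (act g x))"
  have "integrable (\<mu> \<Otimes>\<^sub>M mu_pow n) (\<lambda>p. ?F (fst p ** snd p))"
    using bdd_measD(2)[OF u] x
    by (intro P.integrable_const_bound[of _ B])
      (auto simp: space_pair_measure space_mu space_mu_pow norm_mult act_in_simplex nonneg_mats_mult)
  then have "twisted (Suc n) s u x = (\<integral> h. \<integral> g. ?F (g ** h) \<partial>\<mu> \<partial>mu_pow n)"
    unfolding twisted_def by (intro integral_mu_pow_Suc) auto
  also have "\<dots> = (\<integral> h. iexp (s * msum n h x) * twisted_step s u (act h x) \<partial>mu_pow n)"
  proof (intro Bochner_Integration.integral_cong refl)
    fix h assume "h \<in> space (mu_pow n)"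
    then have h: "h \<in> nonneg_mats" by (simp add: space_mu_pow)
    have "(\<integral> g. ?F (g ** h) \<partial>\<mu>) = (\<integral> g. iexp (s * msum n h x) *
        (iexp (s * incr g (act h x)) * complex_of_real (u (act g (act h x)))) \<partial>\<mu>)"
      by (intro Bochner_Integration.integral_cong refl)
        (simp add: msum_mult act_mult h x space_mu algebra_simps exp_add)
    then show "(\<integral> g. ?F (g ** h) \<partial>\<mu>) = iexp (s * msum n h x) * twisted_step s u (act h x)"
      unfolding twisted_step_def by simp
  qed
  finally show ?thesis .
qed

text \<open>If one twisted step acts on \<open>u\<close> as multiplication by \<open>a\<close> up to an error \<open>e\<close>, then \<open>n\<close> steps
  act as multiplication by \<open>a ^ n\<close> up to \<open>n e\<close>.\<close>

lemma twisted_geometric: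
  assumes u: "bdd_meas B u" and a: "\<bar>a\<bar> \<le> 1"
    and step: "\<And>y. y \<in> prob_simplex \<Longrightarrow> cmod (twisted_step s u y - a * u y) \<le> e"
    and x: "x \<in> prob_simplex"
  shows "cmod (twisted n s u x - a ^ n * u x) \<le> real n * e"
proof (induction n)
  case 0
  have [measurable]: "u \<in> borel_measurable simplex_borel" "x \<in> space simplex_borel"
    using u x by (auto simp: bdd_meas_def space_simplex_borel)
  have "twisted 0 s u x = iexp (s * msum 0 (mat 1) x) * complex_of_real (u (act (mat 1) x))"
    unfolding twisted_def by (simp, subst integral_return) (auto simp: space_mat_borel mat_1_nonneg_mats)
  then show ?case by (simp add: msum_def cocycle_one act_one x)
next
  case (Suc n)
  interpret mn: prob_space "mu_pow n" by (rule prob_mu_pow)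
  have [measurable]: "u \<in> borel_measurable simplex_borel" "x \<in> space simplex_borel"
    using u x by (auto simp: bdd_meas_def space_simplex_borel)
  let ?z = "\<lambda>h. iexp (s * msum n h x)"
  let ?r = "\<lambda>h. twisted_step s u (act h x) - a * u (act h x)"
  have [measurable]: "twisted_step s u \<in> borel_measurable simplex_borel"
    unfolding twisted_step_def[abs_def] by measurable
  have bnd: "cmod (?z h * ?r h) \<le> e" if "h \<in> space (mu_pow n)" for h
    using step[of "act h x"] that x by (simp add: norm_mult act_in_simplex space_mu_pow)
  have int1: "integrable (mu_pow n) (\<lambda>h. ?z h * ?r h)"
    using bnd by (intro mn.integrable_const_bound[of _ e]) auto
  have int2: "integrable (mu_pow n) (\<lambda>h. complex_of_real a * (?z h * complex_of_real (u (act h x))))"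
    by (intro integrable_mult_right integrable_twisted[OF u x])
  have "twisted (Suc n) s u x = (\<integral> h. ?z h * ?r h
      + complex_of_real a * (?z h * complex_of_real (u (act h x))) \<partial>mu_pow n)"
    unfolding twisted_Suc[OF u x] by (intro Bochner_Integration.integral_cong) (auto simp: algebra_simps)
  also have "\<dots> = (\<integral> h. ?z h * ?r h \<partial>mu_pow n)
      + complex_of_real a * twisted n s u x"
    by (subst Bochner_Integration.integral_add[OF int1 int2]) (simp add: twisted_def)
  finally have eq: "twisted (Suc n) s u x - a ^ Suc n * u x =
      (\<integral> h. ?z h * ?r h \<partial>mu_pow n)
      + complex_of_real a * (twisted n s u x - a ^ n * u x)" by (simp add: algebra_simps)
  have "cmod (\<integral> h. ?z h * ?r h \<partial>mu_pow n) \<le> (\<integral> h. e \<partial>mu_pow n)"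
    using bnd int1 by (intro integral_norm_bound[THEN order_trans] integral_mono) auto
  then have 1: "cmod (\<integral> h. ?z h * ?r h \<partial>mu_pow n) \<le> e"
    by (simp add: mn.prob_space)
  have "cmod (complex_of_real a * (twisted n s u x - a ^ n * u x)) \<le> 1 * (real n * e)"
    unfolding norm_mult using a Suc by (intro mult_mono) auto
  then show ?case unfolding eq using 1 by (intro norm_triangle_le) (simp add: algebra_simps)
qed

text \<open>An error bound for one twisted step, relative to \<open>s\<^sup>2\<close>. The first term is the Taylor remainder
  under a second moment only, the second comes from replacing the character by \<open>1\<close> in front of the
  corrector, and the third from the product of the two terms of order \<open>s\<^sup>2\<close>.\<close>

definition step_error :: "real \<Rightarrow> real" where
  "step_error s = (\<integral> g. min (6 * (incr_bound g)\<^sup>2) (\<bar>s\<bar> * incr_bound g ^ 3) \<partial>\<mu>) / 6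
     + \<bar>s\<bar> * corr_bound * (\<integral> g. incr_bound g \<partial>\<mu>) / 2 + s\<^sup>2 * asym_var * corr_bound / 4"

lemma integrable_min_incr_bound:
  "integrable \<mu> (\<lambda>g. min (6 * (incr_bound g)\<^sup>2) (\<bar>s\<bar> * incr_bound g ^ 3))"
proof (rule Bochner_Integration.integrable_bound)
  show "integrable \<mu> (\<lambda>g. 6 * (incr_bound g)\<^sup>2)" using integrable_incr_bound by simp
  show "AE g in \<mu>. norm (min (6 * (incr_bound g)\<^sup>2) (\<bar>s\<bar> * incr_bound g ^ 3)) \<le> norm (6 * (incr_bound g)\<^sup>2)"
    using incr_bound_nonneg by (intro AE_I2) (auto simp: min_def)
qed measurable

text \<open>By Taylor expansion a step twisted by \<open>s\<close> maps \<open>1\<close> to \<open>1 - s\<^sup>2 V / 2\<close> up to \<open>o(s\<^sup>2)\<close>, where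
  \<open>V\<close> is the conditional variance. The corrector solving Poisson's equation for \<open>V\<close> replaces \<open>V\<close>
  by its mean.\<close>

lemma twisted_step_corr:
  fixes s :: real
  assumes x: "x \<in> prob_simplex"
  defines "u \<equiv> \<lambda>y. 1 - s\<^sup>2 / 2 * corr y" and "a \<equiv> 1 - s\<^sup>2 * asym_var / 2"
  shows "cmod (twisted_step s u x - a * u x) \<le> s\<^sup>2 * step_error s"
proof -
  have [measurable]: "x \<in> space simplex_borel" using x by (simp add: space_simplex_borel)
  let ?z = "\<lambda>g. iexp (s * incr g x)" and ?c = "\<lambda>g. complex_of_real (corr (act g x))"
  let ?h = "\<lambda>g. min (6 * (incr g x)\<^sup>2) (\<bar>s\<bar> * \<bar>incr g x\<bar> ^ 3)"
    and ?H = "\<lambda>g. min (6 * (incr_bound g)\<^sup>2) (\<bar>s\<bar> * incr_bound g ^ 3)"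
  have one: "bdd_meas 1 (\<lambda>_. 1)" by (simp add: bdd_meas_def)
  have intz: "integrable \<mu> (\<lambda>g. ?z g)"
    using integrable_twisted_step[OF one x, of s] by simp
  note intc = integrable_twisted_step[OF corr_props(2) x, of s]
  define T1 where "T1 = (\<integral> g. ?z g \<partial>\<mu>) - (1 - s\<^sup>2 * cond_var x / 2)"
  define T2 where "T2 = (\<integral> g. ?z g * ?c g \<partial>\<mu>)
      - complex_of_real (markov_op corr x)"
  have "twisted_step s u x = (\<integral> g. ?z g
      - complex_of_real (s\<^sup>2 / 2) * (?z g * ?c g) \<partial>\<mu>)"
    unfolding twisted_step_def u_def by (intro Bochner_Integration.integral_cong) (auto simp: algebra_simps)
  also have "\<dots> = (\<integral> g. ?z g \<partial>\<mu>)
      - complex_of_real (s\<^sup>2 / 2) * (\<integral> g. ?z g * ?c g \<partial>\<mu>)"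
    using intz intc by (subst Bochner_Integration.integral_diff) auto
  also have "\<dots> = T1 - (s\<^sup>2 / 2) * T2 + complex_of_real (1 - s\<^sup>2 * cond_var x / 2 - s\<^sup>2 / 2 * markov_op corr x)"
    by (simp add: T1_def T2_def algebra_simps)
  also have "1 - s\<^sup>2 * cond_var x / 2 - s\<^sup>2 / 2 * markov_op corr x
      = a * u x - s\<^sup>2 * s\<^sup>2 * asym_var * corr x / 4"
  proof -
    have cv: "cond_var x = corr x - markov_op corr x + asym_var" using corr_equation[OF x] by simp
    show ?thesis unfolding cv u_def a_def by (simp add: field_simps)
  qed
  finally have step: "twisted_step s u x = T1 - (s\<^sup>2 / 2) * T2
      + complex_of_real (a * u x - s\<^sup>2 * s\<^sup>2 * asym_var * corr x / 4)" .
  have eq: "twisted_step s u x - a * u x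
      = (T1 - (s\<^sup>2 / 2) * T2) - complex_of_real (s\<^sup>2 * s\<^sup>2 * asym_var * corr x / 4)"
    by (subst step) simp
  have "cmod T1 \<le> (s\<^sup>2 / 6) * (\<integral> g. ?h g \<partial>\<mu>)"
  proof -
    have char_eq: "char (distr \<mu> borel (\<lambda>g. incr g x)) s = (\<integral> g. ?z g \<partial>\<mu>)"
      unfolding char_def by (rule integral_distr) measurable
    have "cmod (char (distr \<mu> borel (\<lambda>g. incr g x)) s - (1 - s\<^sup>2 * cond_var x / 2))
        \<le> (s\<^sup>2 / 6) * (\<integral> g. ?h g \<partial>\<mu>)"
      using mu.char_approx3'[of "\<lambda>g. incr g x" "cond_var x" "distr \<mu> borel (\<lambda>g. incr g x)" s]
        integrable_incr[OF x] integral_incr[OF x] by (simp add: cond_var_def)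
    then show ?thesis by (simp add: T1_def char_eq)
  qed
  also have "\<dots> \<le> (s\<^sup>2 / 6) * (\<integral> g. ?H g \<partial>\<mu>)"
  proof (intro mult_left_mono integral_mono integrable_min_incr_bound)
    show "integrable \<mu> (\<lambda>g. ?h g)"
    proof (rule Bochner_Integration.integrable_bound)
      show "integrable \<mu> (\<lambda>g. 6 * (incr g x)\<^sup>2)" using integrable_incr[OF x] by simp
      show "AE g in \<mu>. norm (?h g) \<le> norm (6 * (incr g x)\<^sup>2)"
        by (intro AE_I2) (auto simp: min_def)
    qed measurable
    fix g assume "g \<in> space \<mu>"
    then have g: "g \<in> nonneg_mats" by (simp add: space_mu)
    have le: "\<bar>incr g x\<bar> \<le> incr_bound g" by (rule abs_incr_le[OF g x])
    have "(incr g x)\<^sup>2 \<le> (incr_bound g)\<^sup>2" using le incr_bound_nonneg by (intro power2_le_iff_abs_le[THEN iffD2])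
    moreover have "\<bar>s\<bar> * \<bar>incr g x\<bar> ^ 3 \<le> \<bar>s\<bar> * incr_bound g ^ 3"
      using le by (intro mult_left_mono power_mono) auto
    ultimately show "?h g
        \<le> ?H g" by (intro min.mono) auto
  qed auto
  finally have T1: "cmod T1 \<le> (s\<^sup>2 / 6) * (\<integral> g. ?H g \<partial>\<mu>)" .
  have T2: "cmod T2 \<le> \<bar>s\<bar> * corr_bound * (\<integral> g. incr_bound g \<partial>\<mu>)"
  proof -
    have intr: "integrable \<mu> (\<lambda>g. ?c g)"
      using integrable_act_mu[OF corr_props(2) x] by simp
    have "T2 = (\<integral> g. ?z g * ?c g - ?c g \<partial>\<mu>)"
      unfolding T2_def markov_op_def by (subst Bochner_Integration.integral_diff[OF intc intr]) simp
    also have "cmod \<dots> \<le> (\<integral> g. cmod (?z g * ?c g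
        - ?c g) \<partial>\<mu>)" by (rule integral_norm_bound)
    also have "\<dots> \<le> (\<integral> g. \<bar>s\<bar> * corr_bound * incr_bound g \<partial>\<mu>)"
    proof (intro integral_mono integrable_norm Bochner_Integration.integrable_diff intc intr integrable_mult_right
        integrable_incr_bound)
      fix g assume "g \<in> space \<mu>"
      then have g: "g \<in> nonneg_mats" by (simp add: space_mu)
      have "?z g * ?c g - ?c g
          = (?z g - iexp 0) * ?c g"
        by (simp add: left_diff_distrib)
      then have "cmod (?z g * ?c g - ?c g)
          = cmod (?z g - iexp 0) * \<bar>corr (act g x)\<bar>"
        by (simp only: norm_mult norm_of_real)
      also have "\<dots> \<le> \<bar>s * incr g x - 0\<bar> * corr_bound"
        using bdd_measD(2)[OF corr_props(2) act_in_simplex[OF g x]]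
        by (intro mult_mono cmod_iexp_diff_le) auto
      also have "\<dots> \<le> (\<bar>s\<bar> * incr_bound g) * corr_bound"
        using abs_incr_le[OF g x] corr_props(1) by (intro mult_right_mono) (auto simp: abs_mult mult_left_mono)
      finally show "cmod (?z g * ?c g - ?c g)
          \<le> \<bar>s\<bar> * corr_bound * incr_bound g" by (simp add: mult_ac)
    qed
    finally show ?thesis by simp
  qed
  have "cmod (complex_of_real (s\<^sup>2 * s\<^sup>2 * asym_var * corr x / 4)) = s\<^sup>2 * s\<^sup>2 * asym_var * \<bar>corr x\<bar> / 4"
    using asym_var_nonneg by (simp only: norm_of_real) (simp add: abs_mult)
  also have "\<dots> \<le> s\<^sup>2 * s\<^sup>2 * asym_var * corr_bound / 4"
    using bdd_measD(2)[OF corr_props(2) x] asym_var_nonneg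
    by (intro divide_right_mono mult_left_mono mult_nonneg_nonneg) auto
  finally have T3: "cmod (complex_of_real (s\<^sup>2 * s\<^sup>2 * asym_var * corr x / 4))
      \<le> s\<^sup>2 * s\<^sup>2 * asym_var * corr_bound / 4" .
  have "cmod (twisted_step s u x - a * u x) \<le> (cmod T1 + (s\<^sup>2 / 2) * cmod T2)
      + cmod (complex_of_real (s\<^sup>2 * s\<^sup>2 * asym_var * corr x / 4))"
  proof -
    have "cmod ((s\<^sup>2 / 2) * T2) = (s\<^sup>2 / 2) * cmod T2" by (simp add: norm_mult norm_divide norm_power)
    then show ?thesis unfolding eq
      using norm_triangle_ineq4[of "T1 - (s\<^sup>2 / 2) * T2" "complex_of_real (s\<^sup>2 * s\<^sup>2 * asym_var * corr x / 4)"]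
        norm_triangle_ineq4[of T1 "(s\<^sup>2 / 2) * T2"] by linarith
  qed
  also have "\<dots> \<le> ((s\<^sup>2 / 6) * (\<integral> g. ?H g \<partial>\<mu>)
      + (s\<^sup>2 / 2) * (\<bar>s\<bar> * corr_bound * (\<integral> g. incr_bound g \<partial>\<mu>))) + s\<^sup>2 * s\<^sup>2 * asym_var * corr_bound / 4"
    by (intro add_mono T1 T3 mult_left_mono T2) auto
  also have "\<dots> = s\<^sup>2 * step_error s" by (simp add: step_error_def algebra_simps)
  finally show ?thesis .
qed

lemma step_error_tendsto_0:
  assumes "s \<longlonglongrightarrow> 0"
  shows "(\<lambda>n. step_error (s n)) \<longlonglongrightarrow> 0"
proof -
  let ?H = "\<lambda>n g. min (6 * (incr_bound g)\<^sup>2) (\<bar>s n\<bar> * incr_bound g ^ 3)"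
  have "(\<lambda>n. \<integral> g. ?H n g \<partial>\<mu>) \<longlonglongrightarrow> (\<integral> g. 0 \<partial>\<mu>)"
  proof (rule integral_dominated_convergence)
    show "integrable \<mu> (\<lambda>g. 6 * (incr_bound g)\<^sup>2)" using integrable_incr_bound by simp
    show "AE g in \<mu>. (\<lambda>n. ?H n g) \<longlonglongrightarrow> 0"
    proof (rule AE_I2)
      fix g
      have "(\<lambda>n. ?H n g)
          \<longlonglongrightarrow> min (6 * (incr_bound g)\<^sup>2) (\<bar>0\<bar> * incr_bound g ^ 3)"
        by (intro tendsto_intros assms)
      then show "(\<lambda>n. ?H n g) \<longlonglongrightarrow> 0" by simp
    qed
    show "AE g in \<mu>. norm (?H n g) \<le> 6 * (incr_bound g)\<^sup>2" for n
      using incr_bound_nonneg by (intro AE_I2) (auto simp: min_def)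
  qed measurable
  then have "(\<lambda>n. step_error (s n)) \<longlonglongrightarrow>
      0 / 6 + \<bar>0\<bar> * corr_bound * (\<integral> g. incr_bound g \<partial>\<mu>) / 2 + 0\<^sup>2 * asym_var * corr_bound / 4"
    unfolding step_error_def by (intro tendsto_intros assms) auto
  then show ?thesis by simp
qed

text \<open>The bound on \<open>s\<close> ensures that the multiplier \<open>1 - s\<^sup>2 asym_var / 2\<close> lies in \<open>[-1, 1]\<close>.\<close>

lemma twisted_one_bound:
  assumes x: "x \<in> prob_simplex" and small: "s\<^sup>2 * asym_var \<le> 4"
  shows "cmod (twisted n s (\<lambda>_. 1) x - complex_of_real ((1 - s\<^sup>2 * asym_var / 2) ^ n))
      \<le> real n * (s\<^sup>2 * step_error s) + s\<^sup>2 * corr_bound"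
proof -
  interpret mn: prob_space "mu_pow n" by (rule prob_mu_pow)
  have one: "bdd_meas 1 (\<lambda>_. 1)" by (simp add: bdd_meas_def)
  define u where "u = (\<lambda>y. 1 - s\<^sup>2 / 2 * corr y)"
  define a where "a = 1 - s\<^sup>2 * asym_var / 2"
  have a: "\<bar>a\<bar> \<le> 1" using small asym_var_nonneg by (simp add: a_def abs_le_iff)
  have close: "\<bar>1 - u y\<bar> \<le> s\<^sup>2 / 2 * corr_bound" if "y \<in> prob_simplex" for y
    using bdd_measD(2)[OF corr_props(2) that] by (simp add: u_def abs_mult mult_left_mono)
  have u: "bdd_meas (1 + s\<^sup>2 / 2 * corr_bound) u"
    unfolding bdd_meas_def using close by (auto simp: u_def abs_le_iff) (smt (verit))+
  let ?z = "\<lambda>g. iexp (s * msum n g x)" and ?u = "\<lambda>g. complex_of_real (u (act g x))"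
  have b1: "cmod (twisted n s (\<lambda>_. 1) x - twisted n s u x) \<le> s\<^sup>2 / 2 * corr_bound"
  proof -
    have int: "integrable (mu_pow n) (\<lambda>g. ?z g * complex_of_real 1
        - ?z g * ?u g)"
      by (intro Bochner_Integration.integrable_diff integrable_twisted[OF one x] integrable_twisted[OF u x])
    have "twisted n s (\<lambda>_. 1) x - twisted n s u x = (\<integral> g. ?z g * complex_of_real 1
        - ?z g * ?u g \<partial>mu_pow n)"
      unfolding twisted_def
      by (rule Bochner_Integration.integral_diff[symmetric, OF integrable_twisted[OF one x] integrable_twisted[OF u x]])
    also have "cmod \<dots> \<le> (\<integral> g. cmod (?z g * complex_of_real 1
        - ?z g * ?u g) \<partial>mu_pow n)" by (rule integral_norm_bound)
    also have "\<dots> \<le> (\<integral> g. s\<^sup>2 / 2 * corr_bound \<partial>mu_pow n)"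
    proof (intro integral_mono integrable_norm int mn.integrable_const)
      fix g assume "g \<in> space (mu_pow n)"
      then have g: "g \<in> nonneg_mats" by (simp add: space_mu_pow)
      have "cmod (?z g * complex_of_real 1 - ?z g * ?u g)
          = cmod (?z g) * cmod (complex_of_real (1 - u (act g x)))"
        unfolding norm_mult[symmetric] by (simp add: algebra_simps)
      also have "\<dots> \<le> s\<^sup>2 / 2 * corr_bound"
        using close[OF act_in_simplex[OF g x]] by (simp only: norm_of_real norm_exp_i_times mult_1)
      finally show "cmod (?z g * complex_of_real 1 - ?z g * ?u g)
          \<le> s\<^sup>2 / 2 * corr_bound" .
    qed
    finally show ?thesis by (simp add: mn.prob_space)
  qed
  have b2: "cmod (twisted n s u x - a ^ n * u x) \<le> real n * (s\<^sup>2 * step_error s)"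
    by (rule twisted_geometric[OF u a _ x]) (use twisted_step_corr in \<open>simp add: u_def a_def\<close>)
  have b3: "cmod (a ^ n * u x - complex_of_real (a ^ n)) \<le> s\<^sup>2 / 2 * corr_bound"
  proof -
    have "a ^ n * u x - complex_of_real (a ^ n) = complex_of_real (a ^ n * (u x - 1))" by (simp add: algebra_simps)
    then have "cmod (a ^ n * u x - complex_of_real (a ^ n)) = \<bar>a\<bar> ^ n * \<bar>1 - u x\<bar>"
      by (simp only: norm_of_real) (simp add: abs_mult power_abs abs_minus_commute)
    also have "\<dots> \<le> 1 * (s\<^sup>2 / 2 * corr_bound)" using a close[OF x] by (intro mult_mono power_le_one) auto
    finally show ?thesis by simp
  qed
  have tri: "cmod (A - D) \<le> cmod (A - B) + cmod (B - C) + cmod (C - D)" for A B C D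
    using norm_triangle_ineq[of "A - B" "B - C"] norm_triangle_ineq[of "A - C" "C - D"] by simp
  have "cmod (twisted n s (\<lambda>_. 1) x - complex_of_real (a ^ n))
      \<le> s\<^sup>2 / 2 * corr_bound + real n * (s\<^sup>2 * step_error s) + s\<^sup>2 / 2 * corr_bound"
    using b1 b2 b3 tri[of "twisted n s (\<lambda>_. 1) x" "complex_of_real (a ^ n)" "twisted n s u x" "a ^ n * u x"]
    by linarith
  then show ?thesis unfolding a_def by linarith
qed

lemma integral_iexp_msum_tendsto:
  "(\<lambda>n. \<integral> p. iexp (t / sqrt (real n) * msum n (fst p) (snd p)) \<partial>(mu_pow n \<Otimes>\<^sub>M \<nu>))
     \<longlonglongrightarrow> complex_of_real (exp (- (t\<^sup>2 * asym_var / 2)))"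
proof -
  define s where "s n = t / sqrt (real n)" for n :: nat
  define J where "J n = (\<integral> p. iexp (s n * msum n (fst p) (snd p)) \<partial>(mu_pow n \<Otimes>\<^sub>M \<nu>))" for n
  have s0: "s \<longlonglongrightarrow> 0" unfolding s_def
    by (intro tendsto_divide_0[OF tendsto_const] filterlim_at_top_imp_at_infinity
        filterlim_compose[OF sqrt_at_top filterlim_real_sequentially])
  have s2: "(s n)\<^sup>2 = t\<^sup>2 / real n" for n by (simp add: s_def power_divide)
  have bound: "cmod (J n - complex_of_real ((1 - (s n)\<^sup>2 * asym_var / 2) ^ n))
      \<le> real n * ((s n)\<^sup>2 * step_error (s n)) + (s n)\<^sup>2 * corr_bound"
    if small: "(s n)\<^sup>2 * asym_var \<le> 4" for n
  proof -
    interpret pair_prob_space "mu_pow n" \<nu>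
      using prob_nu prob_mu_pow by (simp add: pair_prob_space_def pair_sigma_finite_def prob_space_imp_sigma_finite)
    let ?a = "complex_of_real ((1 - (s n)\<^sup>2 * asym_var / 2) ^ n)"
    let ?e = "real n * ((s n)\<^sup>2 * step_error (s n)) + (s n)\<^sup>2 * corr_bound"
    have int: "integrable (mu_pow n \<Otimes>\<^sub>M \<nu>) (case_prod (\<lambda>g x. iexp (s n * msum n g x)))"
      by (intro P.integrable_const_bound[of _ 1]) (auto simp: case_prod_beta')
    have "J n = (\<integral> x. \<integral> g. iexp (s n * msum n g x) \<partial>mu_pow n \<partial>\<nu>)"
      unfolding J_def using integral_snd[OF int] by (simp add: case_prod_beta')
    then have J: "J n = (\<integral> x. twisted n (s n) (\<lambda>_. 1) x \<partial>\<nu>)" by (simp add: twisted_def)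
    have intt: "integrable \<nu> (\<lambda>x. twisted n (s n) (\<lambda>_. 1) x)"
      using integrable_snd[OF int] by (simp add: twisted_def)
    have "J n - ?a = (\<integral> x. twisted n (s n) (\<lambda>_. 1) x - ?a \<partial>\<nu>)"
      unfolding J using intt by (subst Bochner_Integration.integral_diff) (auto simp: nu.prob_space)
    also have "cmod \<dots> \<le> (\<integral> x. cmod (twisted n (s n) (\<lambda>_. 1) x - ?a) \<partial>\<nu>)" by (rule integral_norm_bound)
    also have "\<dots> \<le> (\<integral> x. ?e \<partial>\<nu>)"
      using twisted_one_bound[OF _ small] intt by (intro integral_mono) (auto simp: space_nu)
    finally show ?thesis by (simp add: nu.prob_space)
  qed
  have "(\<lambda>n. (s n)\<^sup>2 * asym_var) \<longlonglongrightarrow> 0\<^sup>2 * asym_var" by (intro tendsto_intros s0)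
  then have "\<forall>\<^sub>F n in sequentially. (s n)\<^sup>2 * asym_var < 4" by (rule order_tendstoD) simp
  then have "\<forall>\<^sub>F n in sequentially. cmod (J n - complex_of_real ((1 - (s n)\<^sup>2 * asym_var / 2) ^ n))
      \<le> t\<^sup>2 * step_error (s n) + (s n)\<^sup>2 * corr_bound"
    using eventually_gt_at_top[of 0]
  proof eventually_elim
    case (elim n)
    then show ?case using bound[of n] by (simp add: s2)
  qed
  moreover have "(\<lambda>n. t\<^sup>2 * step_error (s n) + (s n)\<^sup>2 * corr_bound) \<longlonglongrightarrow> t\<^sup>2 * 0 + 0\<^sup>2 * corr_bound"
    by (intro tendsto_intros s0 step_error_tendsto_0)
  then have "(\<lambda>n. t\<^sup>2 * step_error (s n) + (s n)\<^sup>2 * corr_bound) \<longlonglongrightarrow> 0" by simp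
  ultimately have diff: "(\<lambda>n. J n - complex_of_real ((1 - (s n)\<^sup>2 * asym_var / 2) ^ n)) \<longlonglongrightarrow> 0"
    by (rule Lim_null_comparison)
  have "(\<lambda>n. (1 + (- (t\<^sup>2 * asym_var / 2)) / real n) ^ n) \<longlonglongrightarrow> exp (- (t\<^sup>2 * asym_var / 2))"
    by (rule tendsto_exp_limit_sequentially)
  then have "(\<lambda>n. (1 - (s n)\<^sup>2 * asym_var / 2) ^ n) \<longlonglongrightarrow> exp (- (t\<^sup>2 * asym_var / 2))"
    by (simp add: s2 field_simps)
  then have "(\<lambda>n. complex_of_real ((1 - (s n)\<^sup>2 * asym_var / 2) ^ n)) \<longlonglongrightarrow> complex_of_real (exp (- (t\<^sup>2 * asym_var / 2)))"
    by (rule tendsto_of_real)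
  from tendsto_add[OF diff this] show ?thesis by (simp add: J_def s_def)
qed

end

section \<open>Spectral radius and aperiodicity\<close>

text \<open>An orbit of a nonnegative matrix that grows like \<open>exp (c k)\<close> up to bounded factors, and starts
  in the interior of the cone, determines the spectral radius. Comparison with this orbit bounds every
  eigenvalue, and a limit of Cesaro means of the normalised orbit is an eigenvector for \<open>exp c\<close>.\<close>

lemma ln_spec_radius_eqI:
  fixes g :: "real^'n^'n" and b :: "nat \<Rightarrow> real^'n"
  assumes g: "\<And>i j. 0 \<le> g $ i $ j"
    and orbit: "\<And>k. g *v b k = exp c *\<^sub>R b (Suc k)"
    and b0: "\<And>i. 0 < b 0 $ i"
    and bR: "\<And>k i. 0 \<le> b k $ i" "\<And>k i. b k $ i \<le> R"
    and low: "0 < \<rho>" "\<And>k. \<rho> \<le> (\<Sum>i\<in>UNIV. b k $ i)"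
  shows "ln (spec_radius g) = c"
proof -
  let ?A = "(\<chi> i j. complex_of_real (g $ i $ j)) :: complex^'n^'n"
  let ?E = "{cmod z |z. \<exists>x::complex^'n. x \<noteq> 0 \<and> ?A *v x = z *s x}"
  \<comment> \<open>With \<open>\<bar>v\<bar> \<le> Q b\<^sub>0\<close> coordinatewise, applying \<open>g\<close> repeatedly gives
    \<open>\<bar>z\<bar>\<^sup>k \<bar>v\<bar> \<le> Q exp (c k) b\<^sub>k\<close>, where the right factor stays bounded.\<close>
  have upper: "cmod z \<le> exp c" if v: "v \<noteq> 0" "?A *v v = z *s v" for z and v :: "complex^'n"
  proof (rule ccontr)
    assume "\<not> cmod z \<le> exp c"
    then have q: "1 < cmod z / exp c" by simp
    define Q where "Q = (\<Sum>i\<in>UNIV. cmod (v $ i) / b 0 $ i)"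
    have "0 \<le> Q" unfolding Q_def using b0 by (intro sum_nonneg) (auto simp: less_imp_le)
    have le: "cmod z ^ k * cmod (v $ i) \<le> Q * exp c ^ k * b k $ i" for k i
    proof (induction k arbitrary: i)
      case 0
      have "cmod (v $ i) / b 0 $ i \<le> Q"
        unfolding Q_def using b0 by (intro member_le_sum) (auto simp: less_imp_le)
      then show ?case using b0[of i] by (simp add: field_simps)
    next
      case (Suc k)
      have "z * v $ i = (\<Sum>j\<in>UNIV. complex_of_real (g $ i $ j) * v $ j)"
        using arg_cong[OF v(2), of "\<lambda>u. u $ i"] by (simp add: matrix_vector_mult_def)
      then have "cmod z * cmod (v $ i) = cmod (\<Sum>j\<in>UNIV. complex_of_real (g $ i $ j) * v $ j)"
        by (simp only: norm_mult[symmetric])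
      also have "\<dots> \<le> (\<Sum>j\<in>UNIV. g $ i $ j * cmod (v $ j))"
        using g by (intro order_trans[OF norm_sum] sum_mono) (simp add: norm_mult)
      finally have "cmod z ^ k * (cmod z * cmod (v $ i)) \<le> cmod z ^ k * (\<Sum>j\<in>UNIV. g $ i $ j * cmod (v $ j))"
        by (rule mult_left_mono) simp
      also have "\<dots> = (\<Sum>j\<in>UNIV. g $ i $ j * (cmod z ^ k * cmod (v $ j)))"
        unfolding sum_distrib_left by (intro sum.cong refl mult.left_commute)
      also have "\<dots> \<le> (\<Sum>j\<in>UNIV. g $ i $ j * (Q * exp c ^ k * b k $ j))"
        by (intro sum_mono mult_left_mono Suc g)
      also have "\<dots> = Q * exp c ^ k * (g *v b k) $ i"
        unfolding matrix_vector_mult_def by (simp add: sum_distrib_left mult.left_commute)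
      finally show ?case unfolding orbit by (simp add: mult.assoc mult.left_commute)
    qed
    obtain i where i: "v $ i \<noteq> 0" using v(1) by (auto simp: vec_eq_iff)
    have bd: "(cmod z / exp c) ^ k \<le> Q * R / cmod (v $ i)" for k
    proof -
      have "cmod z ^ k * cmod (v $ i) \<le> Q * exp c ^ k * R"
        using le[of k i] bR(2)[of k i] \<open>0 \<le> Q\<close> by (elim order_trans) (intro mult_left_mono, auto)
      then show ?thesis using i by (simp add: field_simps power_divide)
    qed
    obtain k where "Q * R / cmod (v $ i) < (cmod z / exp c) ^ k" using real_arch_pow[OF q] by blast
    then show False using bd[of k] by simp
  qed
  \<comment> \<open>The Cesaro means are almost fixed by \<open>exp (- c) g\<close>. Their coordinate sums are at least \<open>\<rho>\<close>,
    so no limit point vanishes.\<close>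
  define m where "m K = (1 / real (Suc K)) *\<^sub>R (\<Sum>k<Suc K. b k)" for K
  have m_nth: "m K $ i = (\<Sum>k<Suc K. b k $ i) / real (Suc K)" for K i
    by (simp add: m_def sum_component del: sum.lessThan_Suc)
  have m_bd: "0 \<le> m K $ i \<and> m K $ i \<le> R" for K i
  proof -
    have "(\<Sum>k<Suc K. b k $ i) \<le> (\<Sum>k<Suc K. R)" by (intro sum_mono bR)
    then have "(\<Sum>k<Suc K. b k $ i) \<le> real (Suc K) * R" by (simp del: sum.lessThan_Suc)
    moreover have "0 \<le> (\<Sum>k<Suc K. b k $ i)" by (intro sum_nonneg bR)
    ultimately show ?thesis unfolding m_nth by (simp add: divide_le_eq mult.commute del: sum.lessThan_Suc)
  qed
  have m_low: "\<rho> \<le> (\<Sum>i\<in>UNIV. m K $ i)" for K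
  proof -
    have "real (Suc K) * \<rho> = (\<Sum>k<Suc K. \<rho>)" by (simp del: sum.lessThan_Suc)
    also have "\<dots> \<le> (\<Sum>k<Suc K. \<Sum>i\<in>UNIV. b k $ i)" by (intro sum_mono low)
    also have "\<dots> = (\<Sum>i\<in>UNIV. \<Sum>k<Suc K. b k $ i)" by (rule sum.swap)
    finally show ?thesis unfolding m_nth
      by (simp add: sum_divide_distrib[symmetric] le_divide_eq mult.commute del: sum.lessThan_Suc)
  qed
  have m_eig: "g *v m K - exp c *\<^sub>R m K = (exp c / real (Suc K)) *\<^sub>R (b (Suc K) - b 0)" for K
  proof -
    have gs: "g *v (\<Sum>k<N. b k) = exp c *\<^sub>R (\<Sum>k<N. b (Suc k))" for N
      by (induction N) (auto simp: matrix_vector_mult_0_right matrix_vector_right_distrib orbit scaleR_add_right)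
    have "(\<Sum>k<Suc K. b (Suc k)) - (\<Sum>k<Suc K. b k) = b (Suc K) - b 0"
      by (simp only: sum_subtractf[symmetric] sum_lessThan_telescope)
    then show ?thesis
      unfolding m_def matrix_vector_mult_scaleR gs
      by (simp only: scaleR_scaleR scaleR_diff_right[symmetric] mult.commute) (simp add: scaleR_scaleR)
  qed
  have "norm (m K) \<le> (\<Sum>i\<in>(UNIV::'n set). R)" for K
    using m_bd by (intro order_trans[OF norm_le_l1_cart] sum_mono) auto
  then have "bounded (range m)" unfolding bounded_iff by blast
  then obtain l r where r: "strict_mono r" "(m \<circ> r) \<longlonglongrightarrow> l"
    using bounded_imp_convergent_subsequence[of m] by blast
  have l_low: "\<rho> \<le> (\<Sum>i\<in>UNIV. l $ i)"
  proof (rule LIMSEQ_le_const)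
    show "(\<lambda>K. \<Sum>i\<in>UNIV. (m \<circ> r) K $ i) \<longlonglongrightarrow> (\<Sum>i\<in>UNIV. l $ i)" by (intro tendsto_intros r)
  qed (use m_low in auto)
  then have l0: "l \<noteq> 0" using low(1) by auto
  have cont: "continuous_on UNIV (\<lambda>x. g *v x - exp c *\<^sub>R x)"
    unfolding matrix_vector_mult_def by (intro continuous_intros continuous_on_vec_lambda)
  have lim1: "(\<lambda>K. g *v (m \<circ> r) K - exp c *\<^sub>R (m \<circ> r) K) \<longlonglongrightarrow> g *v l - exp c *\<^sub>R l"
    by (rule continuous_on_tendsto_compose[OF cont r(2)]) auto
  have lim2: "(\<lambda>K. g *v m K - exp c *\<^sub>R m K) \<longlonglongrightarrow> 0"
  proof (rule Lim_null_comparison)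
    show "\<forall>\<^sub>F K in sequentially. norm (g *v m K - exp c *\<^sub>R m K)
        \<le> (exp c * (2 * (CARD('n) * R))) * inverse (real (Suc K))"
    proof (intro always_eventually allI)
      fix K
      have nb: "norm (b k) \<le> CARD('n) * R" for k
      proof -
        have "norm (b k) \<le> (\<Sum>i\<in>UNIV. \<bar>b k $ i\<bar>)" by (rule norm_le_l1_cart)
        also have "\<dots> \<le> (\<Sum>i\<in>(UNIV::'n set). R)" using bR by (intro sum_mono) auto
        finally show ?thesis by simp
      qed
      have "norm (b (Suc K) - b 0) \<le> 2 * (CARD('n) * R)"
        using norm_triangle_ineq4[of "b (Suc K)" "b 0"] nb[of "Suc K"] nb[of 0] by linarith
      then have "(exp c / real (Suc K)) * norm (b (Suc K) - b 0) \<le> (exp c / real (Suc K)) * (2 * (CARD('n) * R))"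
        by (intro mult_left_mono) auto
      then show "norm (g *v m K - exp c *\<^sub>R m K) \<le> (exp c * (2 * (CARD('n) * R))) * inverse (real (Suc K))"
        unfolding m_eig by (simp add: divide_inverse mult_ac)
    qed
    show "(\<lambda>K. (exp c * (2 * (CARD('n) * R))) * inverse (real (Suc K))) \<longlonglongrightarrow> 0"
      using tendsto_mult_right_zero[OF LIMSEQ_inverse_real_of_nat] by blast
  qed
  have "(\<lambda>K. g *v (m \<circ> r) K - exp c *\<^sub>R (m \<circ> r) K) \<longlonglongrightarrow> 0"
    using LIMSEQ_subseq_LIMSEQ[OF lim2 r(1)] by (simp add: o_def)
  then have "g *v l - exp c *\<^sub>R l = 0" by (rule LIMSEQ_unique[OF lim1])
  then have eig: "g *v l = exp c *\<^sub>R l" by (simp only: right_minus_eq)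
  have "exp c \<in> ?E"
  proof (intro CollectI exI conjI)
    show "exp c = cmod (complex_of_real (exp c))" by simp
    show "(\<chi> i. complex_of_real (l $ i)) \<noteq> 0" using l0 by (simp add: vec_eq_iff)
    show "?A *v (\<chi> i. complex_of_real (l $ i)) = complex_of_real (exp c) *s (\<chi> i. complex_of_real (l $ i))"
    proof (simp add: vec_eq_iff matrix_vector_mult_def, intro allI)
      fix i
      have "(\<Sum>j\<in>UNIV. g $ i $ j * l $ j) = exp c * l $ i"
        using arg_cong[OF eig, of "\<lambda>u. u $ i"] by (simp add: matrix_vector_mult_def)
      from arg_cong[OF this, of complex_of_real]
      show "(\<Sum>j\<in>UNIV. complex_of_real (g $ i $ j) * complex_of_real (l $ j))
          = complex_of_real (exp c) * complex_of_real (l $ i)" by simp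
    qed
  qed
  then have "spec_radius g = exp c"
    unfolding spec_radius_def using upper by (intro cSup_eq_maximum) auto
  then show ?thesis by simp
qed

lemma face_UNIV: "face UNIV = {x \<in> prob_simplex. \<forall>i. 0 < x $ i}"
  by (auto simp: face_def)

lemma act_positive:
  assumes g: "g \<in> nonneg_mats" and x: "x \<in> face UNIV"
  shows "act g x \<in> face UNIV"
proof -
  have x': "x \<in> prob_simplex" "\<And>i. 0 < x $ i" using x by (auto simp: face_UNIV)
  have "0 < (g *v x) $ i" for i
  proof -
    obtain j where "0 < g $ i $ j" using nonneg_matsD(2)[OF g] by blast
    then show ?thesis unfolding matrix_vector_mult_def
      using x' nonneg_matsD(1)[OF g] by (auto intro!: sum_pos2[where i = j] simp: less_imp_le)
  qed
  then have "0 < act g x $ i" for i using l1_norm_matvec_pos[OF g x'(1)] by (simp add: act_def)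
  then show ?thesis using act_in_simplex[OF g x'(1)] by (auto simp: face_UNIV)
qed

lemma act_pos_mats:
  assumes g: "g \<in> pos_mats" and x: "x \<in> prob_simplex"
  shows "act g x \<in> face UNIV"
proof -
  have g': "g \<in> nonneg_mats" using g pos_mats_subset by blast
  obtain j where j: "0 < x $ j" using prob_simplexD(3)[OF x] by blast
  have "0 < (g *v x) $ i" for i
    unfolding matrix_vector_mult_def
    using j g prob_simplexD(1)[OF x] by (auto intro!: sum_pos2[where i = j] simp: pos_mats_def less_imp_le)
  then have "0 < act g x $ i" for i using l1_norm_matvec_pos[OF g' x] by (simp add: act_def)
  then show ?thesis using act_in_simplex[OF g' x] by (auto simp: face_UNIV)
qed

lemma continuous_on_l1_norm_matvec:
  "continuous_on (nonneg_mats \<times> prob_simplex) (\<lambda>p. l1_norm (fst p *v snd p))"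
  by (rule continuous_on_compose2[OF continuous_l1_norm continuous_matvec]) auto

lemma continuous_on_act:
  "continuous_on (nonneg_mats \<times> prob_simplex) (\<lambda>p. act (fst p) (snd p))"
  unfolding act_def using l1_norm_matvec_pos
  by (intro continuous_on_scaleR continuous_on_divide continuous_on_const continuous_on_l1_norm_matvec continuous_matvec)
    (auto simp: less_le)

lemma continuous_on_cocycle:
  "continuous_on (nonneg_mats \<times> prob_simplex) (\<lambda>p. cocycle (fst p) (snd p))"
  unfolding cocycle_def using l1_norm_matvec_pos
  by (intro continuous_on_ln continuous_on_l1_norm_matvec) (auto simp: less_le)

text \<open>On a single face, Lipschitz functions are continuous for the Euclidean topology. On the whole
  simplex this fails.\<close>

lemma continuous_on_face_gap_lipschitz:
  assumes "gap_lipschitz C u" "0 \<le> C"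
  shows "continuous_on (face A) u"
  unfolding continuous_on_topological
proof (intro ballI allI impI)
  fix x B assume x: "x \<in> face A" and B: "open B" "u x \<in> B"
  then obtain e where e: "0 < e" "\<And>z. dist z (u x) < e \<Longrightarrow> z \<in> B" unfolding open_dist by blast
  obtain V where V: "open V" "x \<in> V" "\<And>y. y \<in> V \<inter> face A \<Longrightarrow> gap x y < e / (C + 1)"
    using face_nbhd[OF x, of "e / (C + 1)"] e assms by auto
  have "u y \<in> B" if y: "y \<in> face A" "y \<in> V" for y
  proof (rule e(2))
    have xy: "x \<in> prob_simplex" "y \<in> prob_simplex" using x y by (auto simp: face_def)
    have "\<bar>u x - u y\<bar> \<le> C * gap x y" by (rule gap_lipschitzD[OF assms(1) xy])
    also have "\<dots> \<le> (C + 1) * gap x y" using gap_range[OF xy] by (simp add: algebra_simps)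
    also have "\<dots> < e" using V(3)[of y] y assms by (simp add: field_simps)
    finally show "dist (u y) (u x) < e" by (simp add: dist_real_def abs_minus_commute)
  qed
  then show "\<exists>V. open V \<and> x \<in> V \<and> (\<forall>y\<in>face A. y \<in> V \<longrightarrow> u y \<in> B)" using V by blast
qed

context positive_walk
begin

lemma measurable_face: "face A \<in> sets simplex_borel"
  unfolding sets_simplex_borel
  using face_borel[of A] by (auto simp: sets_restrict_space_iff prob_simplex_borel face_def)

text \<open>A positive matrix occurs with positive probability in a product of bounded length, and the
  interior of the simplex is absorbing, so the invariant measure does not charge the boundary.\<close>

lemma AE_nu_positive: "AE x in \<nu>. x \<in> face UNIV"
proof -
  obtain r \<delta> where \<delta>: "0 < \<delta>" and p: "0 < measure (mu_pow r) (bounded_mats \<delta>)"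
    using bounded_mats_positive_mass by blast
  let ?K = "bounded_mats \<delta> :: (real^'n^'n) set" and ?N = "prob_simplex - face UNIV :: (real^'n) set"
  interpret mr: prob_space "mu_pow r" by (rule prob_mu_pow)
  have K: "?K \<in> sets (mu_pow r)" using measurable_bounded_mats[OF \<delta>] by (simp add: sets_mu_pow)
  have N [measurable]: "?N \<in> sets simplex_borel"
    using sets.compl_sets[OF measurable_face[of UNIV]] by (simp add: space_simplex_borel)
  have Kpos: "?K \<subseteq> pos_mats" using \<delta> by (auto simp: bounded_mats_def pos_mats_def intro: less_le_trans)
  have "emeasure \<nu> ?N = (\<integral>\<^sup>+ x. indicator ?N x \<partial>\<nu>)" using N by (simp add: sets_nu)
  also have "\<dots> = (\<integral>\<^sup>+ x. \<integral>\<^sup>+ g. indicator ?N (act g x) \<partial>mu_pow r \<partial>\<nu>)"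
    by (rule nn_integral_nu_act_pow[symmetric]) measurable
  also have "\<dots> \<le> (\<integral>\<^sup>+ x. \<integral>\<^sup>+ g. indicator ?N x * indicator (space (mu_pow r) - ?K) g \<partial>mu_pow r \<partial>\<nu>)"
  proof (intro nn_integral_mono)
    fix x g assume "x \<in> space \<nu>" "g \<in> space (mu_pow r)"
    then have xg: "x \<in> prob_simplex" "g \<in> nonneg_mats" by (auto simp: space_nu space_mu_pow)
    show "indicator ?N (act g x) \<le> (indicator ?N x * indicator (space (mu_pow r) - ?K) g :: ennreal)"
      using act_positive[OF xg(2), of x] act_pos_mats[of g x] Kpos xg
      by (auto split: split_indicator simp: space_mu_pow)
  qed
  also have "\<dots> = (\<integral>\<^sup>+ x. indicator ?N x * emeasure (mu_pow r) (space (mu_pow r) - ?K) \<partial>\<nu>)"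
    using K by (intro nn_integral_cong) (simp add: nn_integral_cmult)
  also have "\<dots> = emeasure \<nu> ?N * emeasure (mu_pow r) (space (mu_pow r) - ?K)"
    using N by (subst nn_integral_multc) (auto simp: sets_nu)
  finally have "ennreal (measure \<nu> ?N) \<le> ennreal (measure \<nu> ?N * (1 - measure (mu_pow r) ?K))"
    using mr.prob_compl[OF K] by (simp add: nu.emeasure_eq_measure mr.emeasure_eq_measure ennreal_mult)
  moreover have "0 \<le> measure \<nu> ?N * (1 - measure (mu_pow r) ?K)" by (intro mult_nonneg_nonneg) auto
  ultimately have "measure \<nu> ?N \<le> measure \<nu> ?N * (1 - measure (mu_pow r) ?K)" by (simp add: ennreal_le_iff)
  then have "measure \<nu> ?N * measure (mu_pow r) ?K \<le> 0" by (simp add: algebra_simps)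
  then have "measure \<nu> ?N = 0" using p measure_nonneg[of \<nu> ?N] by (simp add: mult_le_0_iff)
  then have "?N \<in> null_sets \<nu>" using N by (simp add: null_sets_def sets_nu nu.emeasure_eq_measure)
  then show ?thesis by (rule AE_I') (auto simp: space_nu)
qed

lemma AE_incr_zero:
  assumes "asym_var = 0"
  shows "AE p in \<mu> \<Otimes>\<^sub>M \<nu>. incr (fst p) (snd p) = 0"
proof -
  have "(\<integral>\<^sup>+ p. ennreal ((incr (fst p) (snd p))\<^sup>2) \<partial>(\<mu> \<Otimes>\<^sub>M \<nu>)) = 0"
    using nn_integral_msum_sq[of 1] assms unfolding mu_pow_1 msum_1 by simp
  then have "AE p in \<mu> \<Otimes>\<^sub>M \<nu>. ennreal ((incr (fst p) (snd p))\<^sup>2) = 0"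
    by (subst (asm) nn_integral_0_iff_AE) auto
  then show ?thesis by eventually_elim simp
qed

text \<open>The part of the support of the invariant measure that lies in the interior of the simplex,
  where the topology is the Euclidean one.\<close>

definition nu_support :: "(real^'n) set" where
  "nu_support = {x \<in> face UNIV. \<forall>U. open U \<and> x \<in> U \<longrightarrow> 0 < emeasure \<nu> (U \<inter> face UNIV)}"

lemma measurable_open_face: "open U \<Longrightarrow> U \<inter> face A \<in> sets simplex_borel"
  unfolding sets_simplex_borel
  using face_borel[of A] by (auto simp: sets_restrict_space_iff prob_simplex_borel face_def intro!: sets.Int)

lemma nu_support_nonempty: "nu_support \<noteq> {}"
proof
  assume empty: "nu_support = {}"
  define F where "F = {U. open U \<and> emeasure \<nu> (U \<inter> face UNIV) = 0}"
  have cover: "face UNIV \<subseteq> \<Union>F"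
  proof
    fix x :: "real^'n" assume "x \<in> face UNIV"
    then show "x \<in> \<Union>F" using empty unfolding nu_support_def F_def by (auto simp: not_less)
  qed
  obtain F' where F': "F' \<subseteq> F" "countable F'" "\<Union>F' = \<Union>F"
    using Lindelof[of F] by (auto simp: F_def)
  have "U \<inter> face UNIV \<in> null_sets \<nu>" if "U \<in> F'" for U
  proof -
    have "U \<in> F" using that F'(1) by blast
    then show ?thesis by (simp add: F_def null_sets_def sets_nu measurable_open_face)
  qed
  then have "(\<Union>U\<in>F'. U \<inter> face UNIV) \<in> null_sets \<nu>"
    using F'(2) by (intro null_sets_UN')
  moreover have "(\<Union>U\<in>F'. U \<inter> face UNIV) = (face UNIV :: (real^'n) set)" using cover F' by auto
  ultimately have "face UNIV \<in> null_sets \<nu>" by simp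
  then have "AE x in \<nu>. x \<notin> face UNIV" by (rule AE_not_in)
  with AE_nu_positive have "AE x in \<nu>. False" by eventually_elim simp
  then show False by (simp add: nu.AE_False)
qed

lemma closedin_nu_support: "closedin (top_of_set (face UNIV)) nu_support"
proof -
  define F where "F = {U. open U \<and> emeasure \<nu> (U \<inter> face UNIV) = 0}"
  have "nu_support = face UNIV \<inter> - \<Union>F"
    unfolding nu_support_def F_def by (auto simp: zero_less_iff_neq_zero)
  moreover have "closed (- \<Union>F)" unfolding F_def by (intro closed_Compl open_Union) auto
  ultimately show ?thesis by (simp add: closedin_closed_Int)
qed

text \<open>A neighbourhood of a point in the product of both supports contains a measurable rectangle of
  positive measure.\<close>

lemma support_nbhd:
  assumes O: "openin (top_of_set (nonneg_mats \<times> face UNIV)) Q" "(g, x) \<in> Q"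
    and g: "g \<in> msupport \<mu>" and x: "x \<in> nu_support"
  shows "\<exists>U V. U \<in> sets \<mu> \<and> V \<in> sets \<nu> \<and> 0 < emeasure \<mu> U \<and> 0 < emeasure \<nu> V \<and> U \<times> V \<subseteq> Q"
proof -
  obtain W where W: "open W" "Q = (nonneg_mats \<times> face UNIV) \<inter> W" using O(1) unfolding openin_open by blast
  then obtain U V where UV: "open U" "open V" "g \<in> U" "x \<in> V" "U \<times> V \<subseteq> W"
    using O(2) by (elim open_prod_elim[of W "(g, x)"]) auto
  have "0 < emeasure \<mu> (nonneg_mats \<inter> U)"
    using g UV unfolding msupport_def by (auto simp: openin_open_Int)
  moreover have "0 < emeasure \<nu> (V \<inter> face UNIV)"
    using x UV unfolding nu_support_def by blast
  moreover have "nonneg_mats \<inter> U \<in> sets \<mu>"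
    unfolding sets_mu using UV nonneg_mats_borel by (intro sets_mat_borelI sets.Int) auto
  moreover have "V \<inter> face UNIV \<in> sets \<nu>" unfolding sets_nu by (rule measurable_open_face[OF UV(2)])
  moreover have "(nonneg_mats \<inter> U) \<times> (V \<inter> face UNIV) \<subseteq> Q" using UV W by auto
  ultimately show ?thesis by blast
qed

lemma face_subset: "face A \<subseteq> prob_simplex"
  by (auto simp: face_def)

lemma continuous_on_act_face:
  "continuous_on (nonneg_mats \<times> face UNIV) (\<lambda>p. act (fst p) (snd p))"
  by (rule continuous_on_subset[OF continuous_on_act]) (use face_subset in auto)

lemma continuous_on_psi: "continuous_on (face A) psi"
  by (rule continuous_on_face_gap_lipschitz[OF psi_props(3,1)])

lemma continuous_on_incr: "continuous_on (nonneg_mats \<times> face UNIV) (\<lambda>p. incr (fst p) (snd p))"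
  unfolding incr_def
proof (intro continuous_on_diff continuous_on_add continuous_on_const)
  show "continuous_on (nonneg_mats \<times> face UNIV) (\<lambda>p. cocycle (fst p) (snd p))"
    by (rule continuous_on_subset[OF continuous_on_cocycle]) (use face_subset in auto)
  show "continuous_on (nonneg_mats \<times> face UNIV) (\<lambda>p. psi (act (fst p) (snd p)))"
    by (rule continuous_on_compose2[OF continuous_on_psi[of UNIV] continuous_on_act_face]) (auto simp: act_positive)
  show "continuous_on (nonneg_mats \<times> face UNIV) (\<lambda>p. psi (snd p))"
    by (rule continuous_on_compose2[OF continuous_on_psi[of UNIV] continuous_on_snd[OF continuous_on_id]]) auto
qed

lemma incr_zero_on_support:
  assumes "asym_var = 0" "g \<in> msupport \<mu>" "x \<in> nu_support"
  shows "incr g x = 0"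
proof (rule ccontr)
  assume ne: "incr g x \<noteq> 0"
  let ?Q = "(nonneg_mats \<times> face UNIV) \<inter> (\<lambda>p. incr (fst p) (snd p)) -` (- {0})"
  have opn: "openin (top_of_set (nonneg_mats \<times> face UNIV)) ?Q"
    by (rule continuous_openin_preimage_gen[OF continuous_on_incr]) auto
  have mem: "(g, x) \<in> ?Q" using ne assms by (auto simp: msupport_def nu_support_def)
  obtain U V where UV: "U \<in> sets \<mu>" "V \<in> sets \<nu>" "0 < emeasure \<mu> U" "0 < emeasure \<nu> V" "U \<times> V \<subseteq> ?Q"
    using support_nbhd[OF opn mem assms(2,3)] by blast
  have "AE p in \<mu> \<Otimes>\<^sub>M \<nu>. p \<notin> U \<times> V"
    using AE_incr_zero[OF assms(1)] by eventually_elim (use UV in auto)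
  then have "emeasure (\<mu> \<Otimes>\<^sub>M \<nu>) (U \<times> V) = 0"
    using UV by (subst (asm) AE_iff_measurable[of "U \<times> V"]) (auto dest: sets.sets_into_space simp: space_pair_measure)
  then show False using UV by (auto simp: nu.emeasure_pair_measure_Times)
qed

lemma act_nu_support:
  assumes g: "g \<in> msupport \<mu>" and x: "x \<in> nu_support"
  shows "act g x \<in> nu_support"
  unfolding nu_support_def
proof (intro CollectI conjI allI impI)
  have gx: "g \<in> nonneg_mats" "x \<in> face UNIV" using assms by (auto simp: msupport_def nu_support_def)
  show "act g x \<in> face UNIV" by (rule act_positive[OF gx])
  fix W :: "(real^'n) set" assume W: "open W \<and> act g x \<in> W"
  let ?Q = "(nonneg_mats \<times> face UNIV) \<inter> (\<lambda>p. act (fst p) (snd p)) -` W"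
  have opn: "openin (top_of_set (nonneg_mats \<times> face UNIV)) ?Q"
    using W by (intro continuous_openin_preimage_gen[OF continuous_on_act_face]) auto
  have mem: "(g, x) \<in> ?Q" using W gx by auto
  obtain U V where UV: "U \<in> sets \<mu>" "V \<in> sets \<nu>" "0 < emeasure \<mu> U" "0 < emeasure \<nu> V" "U \<times> V \<subseteq> ?Q"
    using support_nbhd[OF opn mem assms] by blast
  have [measurable]: "W \<inter> face UNIV \<in> sets simplex_borel" using W measurable_open_face by blast
  have "emeasure \<mu> U * emeasure \<nu> V = (\<integral>\<^sup>+ x. \<integral>\<^sup>+ g. indicator U g * indicator V x \<partial>\<mu> \<partial>\<nu>)"
    using UV by (simp add: nn_integral_multc nn_integral_cmult)
  also have "\<dots> \<le> (\<integral>\<^sup>+ x. \<integral>\<^sup>+ g. indicator (W \<inter> face UNIV) (act g x) \<partial>\<mu> \<partial>\<nu>)"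
    using UV(5) by (intro nn_integral_mono) (auto split: split_indicator simp: act_positive)
  also have "\<dots> = (\<integral>\<^sup>+ x. indicator (W \<inter> face UNIV) x \<partial>\<nu>)" by (rule nn_integral_nu_act) measurable
  also have "\<dots> = emeasure \<nu> (W \<inter> face UNIV)" by (simp add: sets_nu)
  finally show "0 < emeasure \<nu> (W \<inter> face UNIV)"
    using UV(3,4) by (auto simp: zero_less_iff_neq_zero)
qed

text \<open>The matrices that map this part of the support into itself and for which the cocycle,
  corrected by \<open>\<psi>\<close>, takes one single value on it, this value being an integer multiple of the Lyapunov exponent.\<close>

definition lattice_mats :: "(real^'n^'n) set" where
  "lattice_mats = {g \<in> nonneg_mats. (\<forall>x\<in>nu_support. act g x \<in> nu_support) \<and>
     (\<exists>c\<in>(\<lambda>t. lyap *\<^sub>R t) ` \<int>. \<forall>x\<in>nu_support. cocycle g x + psi (act g x) - psi x = c)}"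

lemma nu_support_subset: "nu_support \<subseteq> face UNIV"
  by (auto simp: nu_support_def)

text \<open>The multiples of the Lyapunov exponent form a closed set, and on the interior of the simplex
  the action and the corrected cocycle depend continuously on the matrix.\<close>

lemma closedin_lattice_mats: "closedin (top_of_set nonneg_mats) lattice_mats"
proof -
  define F where "F x g = cocycle g x + psi (act g x) - psi x" for x g
  obtain x0 where x0: "x0 \<in> nu_support" using nu_support_nonempty by blast
  have cont_act: "continuous_on nonneg_mats (\<lambda>g. act g x)" if "x \<in> nu_support" for x
    using that nu_support_subset
    by (intro continuous_on_compose2[OF continuous_on_act_face, of _ "\<lambda>g. (g, x)", simplified] continuous_intros) auto
  have cont_F: "continuous_on nonneg_mats (F x)" if x: "x \<in> nu_support" for x
  proof -
    have "continuous_on nonneg_mats (\<lambda>g. incr g x + lyap)"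
      using that nu_support_subset
      by (intro continuous_on_add continuous_on_const
          continuous_on_compose2[OF continuous_on_incr, of _ "\<lambda>g. (g, x)", simplified] continuous_intros) auto
    then show ?thesis by (simp add: F_def[abs_def] incr_def add_diff_eq)
  qed
  have "lattice_mats = (\<Inter>x\<in>nu_support. nonneg_mats \<inter> (\<lambda>g. act g x) -` nu_support)
      \<inter> (nonneg_mats \<inter> F x0 -` ((\<lambda>t. lyap *\<^sub>R t) ` \<int>))
      \<inter> (\<Inter>x\<in>nu_support. nonneg_mats \<inter> (\<lambda>g. F x g - F x0 g) -` {0})"
    using x0 unfolding lattice_mats_def F_def[symmetric] by auto
  moreover have "closedin (top_of_set nonneg_mats) (nonneg_mats \<inter> F x0 -` ((\<lambda>t. lyap *\<^sub>R t) ` \<int>))"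
    by (intro continuous_closedin_preimage cont_F x0 closed_scaling closed_Ints)
  moreover have "closedin (top_of_set nonneg_mats) (\<Inter>x\<in>nu_support. nonneg_mats \<inter> (\<lambda>g. act g x) -` nu_support)"
  proof (rule closedin_INT[OF nu_support_nonempty])
    fix x assume x: "x \<in> nu_support"
    then show "closedin (top_of_set nonneg_mats) (nonneg_mats \<inter> (\<lambda>g. act g x) -` nu_support)"
      using nu_support_subset
      by (intro continuous_closedin_preimage_gen[OF cont_act _ closedin_nu_support]) (auto intro: act_positive)
  qed
  moreover have "closedin (top_of_set nonneg_mats)
      (\<Inter>x\<in>nu_support. nonneg_mats \<inter> (\<lambda>g. F x g - F x0 g) -` {0})"
  proof (rule closedin_INT[OF nu_support_nonempty])
    fix x assume x: "x \<in> nu_support"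
    then show "closedin (top_of_set nonneg_mats) (nonneg_mats \<inter> (\<lambda>g. F x g - F x0 g) -` {0})"
      using x0 by (intro continuous_closedin_preimage continuous_on_diff cont_F closed_singleton)
  qed
  ultimately show ?thesis by (simp only: closedin_Int)
qed

lemma lattice_mats_mult:
  assumes "g \<in> lattice_mats" "h \<in> lattice_mats"
  shows "g ** h \<in> lattice_mats"
proof -
  have gh: "g \<in> nonneg_mats" "h \<in> nonneg_mats" using assms by (auto simp: lattice_mats_def)
  obtain s t where st: "s \<in> \<int>" "t \<in> \<int>"
    "\<And>x. x \<in> nu_support \<Longrightarrow> cocycle g x + psi (act g x) - psi x = lyap * s"
    "\<And>x. x \<in> nu_support \<Longrightarrow> cocycle h x + psi (act h x) - psi x = lyap * t"
    using assms unfolding lattice_mats_def by auto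
  have inv: "act g x \<in> nu_support" "act h x \<in> nu_support" if "x \<in> nu_support" for x
    using assms that by (auto simp: lattice_mats_def)
  have simplex: "x \<in> prob_simplex" if "x \<in> nu_support" for x
    using that nu_support_subset face_subset by blast
  have "cocycle (g ** h) x + psi (act (g ** h) x) - psi x = lyap *\<^sub>R (s + t)" if x: "x \<in> nu_support" for x
    using st(3)[OF inv(2)[OF x]] st(4)[OF x] by (simp add: cocycle_mult act_mult gh simplex[OF x] algebra_simps)
  moreover have "act (g ** h) x \<in> nu_support" if "x \<in> nu_support" for x
    using inv that by (simp add: act_mult gh simplex)
  ultimately show ?thesis unfolding lattice_mats_def using nonneg_mats_mult[OF gh] st(1,2) by auto
qed

lemma closed_semigroup_subset_lattice_mats:
  assumes "asym_var = 0"
  shows "closed_semigroup \<mu> \<subseteq> lattice_mats"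
proof -
  have "msupport \<mu> \<subseteq> lattice_mats"
  proof
    fix g assume g: "g \<in> msupport \<mu>"
    have "cocycle g x + psi (act g x) - psi x = lyap *\<^sub>R 1" if "x \<in> nu_support" for x
      using incr_zero_on_support[OF assms g that] by (simp add: incr_def)
    then have "\<exists>c\<in>(\<lambda>t. lyap *\<^sub>R t) ` \<int>. \<forall>x\<in>nu_support. cocycle g x + psi (act g x) - psi x = c"
      by (intro bexI[of _ "lyap *\<^sub>R 1"]) auto
    moreover have "g \<in> nonneg_mats" using g by (simp add: msupport_def)
    ultimately show "g \<in> lattice_mats"
      using act_nu_support[OF g] unfolding lattice_mats_def by blast
  qed
  then show ?thesis
    unfolding closed_semigroup_def using closedin_lattice_mats lattice_mats_mult by blast
qed

text \<open>Along the orbit \<open>y\<^sub>k\<close> of a point of the support, put \<open>b\<^sub>k = exp (- \<psi>(y\<^sub>k)) y\<^sub>k\<close>. Then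
  \<open>g\<close> maps \<open>b\<^sub>k\<close> to exactly \<open>exp c\<close> times \<open>b\<close> at \<open>k + 1\<close>, where \<open>c\<close> is the value belonging to \<open>g\<close>.\<close>

lemma ln_spec_radius_lattice_mats:
  assumes "g \<in> lattice_mats"
  shows "ln (spec_radius g) \<in> (\<lambda>t. lyap *\<^sub>R t) ` \<int>"
proof -
  obtain c where c: "c \<in> (\<lambda>t. lyap *\<^sub>R t) ` \<int>"
    "\<And>x. x \<in> nu_support \<Longrightarrow> cocycle g x + psi (act g x) - psi x = c"
    and g: "g \<in> nonneg_mats" and inv: "\<And>x. x \<in> nu_support \<Longrightarrow> act g x \<in> nu_support"
    using assms unfolding lattice_mats_def by blast
  obtain x0 where x0: "x0 \<in> nu_support" using nu_support_nonempty by blast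
  define y where "y k = (act g ^^ k) x0" for k
  have y: "y k \<in> nu_support" for k by (induction k) (auto simp: y_def x0 inv)
  have yp: "y k \<in> face UNIV" "y k \<in> prob_simplex" for k
    using y nu_support_subset face_subset by blast+
  define b where "b k = exp (- psi (y k)) *\<^sub>R y k" for k
  have "ln (spec_radius g) = c"
  proof (rule ln_spec_radius_eqI[where b = b and R = "exp psi_bound" and \<rho> = "exp (- psi_bound)"])
    show "0 \<le> g $ i $ j" for i j by (rule nonneg_matsD(1)[OF g])
    show "g *v b k = exp c *\<^sub>R b (Suc k)" for k
    proof -
      have pos: "0 < l1_norm (g *v y k)" by (rule l1_norm_matvec_pos[OF g yp(2)])
      have Suc: "y (Suc k) = act g (y k)" by (simp add: y_def)
      have "g *v y k = l1_norm (g *v y k) *\<^sub>R y (Suc k)" using pos by (simp add: Suc act_def)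
      also have "l1_norm (g *v y k) = exp (cocycle g (y k))" using pos by (simp add: cocycle_def)
      also have "cocycle g (y k) = c - psi (y (Suc k)) + psi (y k)" using c(2)[OF y[of k]] by (simp add: Suc)
      finally have "g *v y k = exp (c - psi (y (Suc k)) + psi (y k)) *\<^sub>R y (Suc k)" .
      then show ?thesis by (simp add: b_def matrix_vector_mult_scaleR flip: exp_add)
    qed
    show "0 < b 0 $ i" for i using yp(1)[of 0] by (simp add: b_def face_UNIV)
    show "0 \<le> b k $ i" for k i using prob_simplexD(1)[OF yp(2)] by (simp add: b_def)
    have psi: "\<bar>psi (y k)\<bar> \<le> psi_bound" for k by (rule abs_psi_le[OF yp(2)])
    show "b k $ i \<le> exp psi_bound" for k i
    proof -
      have "y k $ i \<le> (\<Sum>i\<in>UNIV. y k $ i)" using prob_simplexD(1)[OF yp(2)] by (intro member_le_sum) auto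
      then have "y k $ i \<le> 1" using prob_simplexD(2)[OF yp(2)] by simp
      moreover have "exp (- psi (y k)) \<le> exp psi_bound" using psi[of k] by simp
      ultimately have "exp (- psi (y k)) * y k $ i \<le> exp psi_bound * 1"
        using prob_simplexD(1)[OF yp(2)] by (intro mult_mono) auto
      then show ?thesis by (simp add: b_def)
    qed
    show "exp (- psi_bound) \<le> (\<Sum>i\<in>UNIV. b k $ i)" for k
      using psi[of k] prob_simplexD(2)[OF yp(2)] by (simp add: b_def flip: sum_distrib_left)
  qed simp
  then show ?thesis using c(1) by simp
qed

lemma aperiodic_asym_var:
  assumes "aperiodic \<mu>"
  shows "asym_var \<noteq> 0"
proof
  assume zero: "asym_var = 0"
  let ?L = "(\<lambda>t. lyap *\<^sub>R t) ` \<int> :: real set"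
  have diff: "a - b \<in> ?L" if "a \<in> ?L" "b \<in> ?L" for a b
  proof -
    obtain s where s: "s \<in> \<int>" "a = lyap * s" using \<open>a \<in> ?L\<close> by auto
    moreover obtain t where t: "t \<in> \<int>" "b = lyap * t" using \<open>b \<in> ?L\<close> by auto
    ultimately have "s - t \<in> \<int>" "a - b = lyap * (s - t)" by (auto simp: algebra_simps)
    then show ?thesis by auto
  qed
  have "s \<in> ?L" if "s \<in> group_closure ((\<lambda>g. ln (spec_radius g)) ` closed_semigroup \<mu>)" for s
    using that
  proof induction
    case (base s)
    have "0 \<in> ?L" by (rule image_eqI[of _ _ 0]) auto
    then show ?case
      using base ln_spec_radius_lattice_mats closed_semigroup_subset_lattice_mats[OF zero] by auto
  next
    case (diff s t)
    then show ?case using \<open>\<And>a b. a \<in> ?L \<Longrightarrow> b \<in> ?L \<Longrightarrow> a - b \<in> ?L\<close> by blast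
  qed
  then have "closure (group_closure ((\<lambda>g. ln (spec_radius g)) ` closed_semigroup \<mu>)) \<subseteq> ?L"
    by (intro closure_minimal closed_scaling closed_Ints) blast
  then have all: "UNIV \<subseteq> ?L" using assms by (simp add: aperiodic_def)
  show False
  proof (cases "lyap = 0")
    case True
    then show False using all by (auto dest!: subsetD[of _ _ 1])
  next
    case False
    have "lyap / 2 \<in> ?L" using all by blast
    then obtain t where t: "t \<in> \<int>" "lyap / 2 = lyap * t" by auto
    then have "t = 1 / 2" using False by (simp add: field_simps)
    moreover obtain k :: int where "t = of_int k" using t(1) by (auto elim: Ints_cases)
    ultimately have "2 * real_of_int k = 1" by simp
    then have "real_of_int (2 * k) = real_of_int 1" by simp
    then have "2 * k = 1" by (simp only: of_int_eq_iff)
    then show False by presburger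
  qed
qed

end

section \<open>Limits for the cocycle\<close>

context positive_walk
begin

lemma pair_prob_pow_nu: "pair_prob_space (mu_pow n) \<nu>"
  using prob_nu prob_mu_pow by (simp add: pair_prob_space_def pair_sigma_finite_def prob_space_imp_sigma_finite)

text \<open>Replacing the martingale by the centred cocycle, at bounded distance, changes the second moment
  by \<open>O(\<surd>n)\<close>.\<close>

lemma second_moment_tendsto:
  "(\<lambda>n. ennreal (1 / real n) *
      (\<integral>\<^sup>+ p. ennreal ((cocycle (fst p) (snd p) - real n * lyap)\<^sup>2) \<partial>(mu_pow n \<Otimes>\<^sub>M \<nu>)))
    \<longlonglongrightarrow> ennreal asym_var"
proof -
  define D where "D = 2 * psi_bound"
  define R where "R n = (\<integral> p. (cocycle (fst p) (snd p) - real n * lyap)\<^sup>2 \<partial>(mu_pow n \<Otimes>\<^sub>M \<nu>))" for n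
  have main: "(\<integral>\<^sup>+ p. ennreal ((cocycle (fst p) (snd p) - real n * lyap)\<^sup>2) \<partial>(mu_pow n \<Otimes>\<^sub>M \<nu>)) = ennreal (R n)
      \<and> \<bar>R n - real n * asym_var\<bar> \<le> real n * asym_var / sqrt (real n) + (sqrt (real n) + 1) * D\<^sup>2"
    if n: "0 < n" for n
  proof -
    interpret pair_prob_space "mu_pow n" \<nu> by (rule pair_prob_pow_nu)
    let ?M = "mu_pow n \<Otimes>\<^sub>M \<nu>"
    let ?X = "\<lambda>p. cocycle (fst p) (snd p) - real n * lyap" and ?m = "\<lambda>p. msum n (fst p) (snd p)"
    have m_int: "integrable ?M (\<lambda>p. (?m p)\<^sup>2)"
      by (rule integrableI_nonneg) (auto simp: nn_integral_msum_sq)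
    have m_val: "(\<integral> p. (?m p)\<^sup>2 \<partial>?M) = real n * asym_var"
      using nn_integral_msum_sq[of n] asym_var_nonneg by (subst integral_eq_nn_integral) auto
    have diff: "\<bar>(?X p)\<^sup>2 - (?m p)\<^sup>2\<bar> \<le> (?m p)\<^sup>2 / sqrt (real n) + (sqrt (real n) + 1) * D\<^sup>2"
      if p: "p \<in> space ?M" for p
    proof -
      have "\<bar>?X p - ?m p\<bar> \<le> D"
        unfolding D_def using p by (intro msum_approx) (auto simp: space_pair_measure space_mu_pow space_nu)
      define b where "b = ?X p - ?m p"
      have b: "\<bar>b\<bar> \<le> D" using \<open>\<bar>?X p - ?m p\<bar> \<le> D\<close> by (simp add: b_def)
      have bD: "b\<^sup>2 \<le> D\<^sup>2" using b by (intro power2_le_iff_abs_le[THEN iffD2]) auto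
      have r: "0 < sqrt (real n)" using n by simp
      define q where "q = sqrt (real n)"
      have q: "0 < q" using r by (simp add: q_def)
      \<comment> \<open>The weight \<open>q = \<surd>n\<close> balances a main term of order \<open>n\<close> against a bounded one.\<close>
      have "2 * \<bar>?m p\<bar> * \<bar>b\<bar> \<le> (?m p)\<^sup>2 / q + q * b\<^sup>2"
      proof -
        have "0 \<le> (\<bar>?m p\<bar> - q * \<bar>b\<bar>)\<^sup>2" by simp
        then have "2 * \<bar>?m p\<bar> * \<bar>b\<bar> * q \<le> (?m p)\<^sup>2 + (q * q) * b\<^sup>2"
          by (simp add: power2_diff power_mult_distrib) (simp add: power2_eq_square mult_ac)
        then show ?thesis using q by (simp add: field_simps)
      qed
      moreover have "(?X p)\<^sup>2 - (?m p)\<^sup>2 = 2 * ?m p * b + b\<^sup>2"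
        by (simp add: b_def power2_eq_square algebra_simps)
      then have "\<bar>(?X p)\<^sup>2 - (?m p)\<^sup>2\<bar> \<le> 2 * \<bar>?m p\<bar> * \<bar>b\<bar> + b\<^sup>2"
        using abs_triangle_ineq[of "2 * ?m p * b" "b\<^sup>2"] by (simp add: abs_mult)
      moreover have "q * b\<^sup>2 \<le> q * D\<^sup>2" using bD q by (intro mult_left_mono) auto
      ultimately show ?thesis using bD by (simp add: q_def algebra_simps)
    qed
    let ?bnd = "\<lambda>p. (?m p)\<^sup>2 / sqrt (real n) + (sqrt (real n) + 1) * D\<^sup>2"
    have bnd_int: "integrable ?M ?bnd" using m_int by simp
    have X_int: "integrable ?M (\<lambda>p. (?X p)\<^sup>2)"
    proof (rule Bochner_Integration.integrable_bound)
      show "integrable ?M (\<lambda>p. (?m p)\<^sup>2 + ?bnd p)" using m_int bnd_int by (rule Bochner_Integration.integrable_add)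
      show "AE p in ?M. norm ((?X p)\<^sup>2) \<le> norm ((?m p)\<^sup>2 + ?bnd p)"
        using diff by (intro AE_I2) fastforce
    qed measurable
    have "R n - real n * asym_var = (\<integral> p. (?X p)\<^sup>2 - (?m p)\<^sup>2 \<partial>?M)"
      unfolding R_def using X_int m_int m_val by simp
    also have "\<bar>\<dots>\<bar> \<le> (\<integral> p. \<bar>(?X p)\<^sup>2 - (?m p)\<^sup>2\<bar> \<partial>?M)" by (rule integral_abs_bound)
    also have "\<dots> \<le> (\<integral> p. ?bnd p \<partial>?M)"
      using diff by (intro integral_mono integrable_abs Bochner_Integration.integrable_diff X_int m_int bnd_int)
    also have "\<dots> = real n * asym_var / sqrt (real n) + (sqrt (real n) + 1) * D\<^sup>2"
      using m_int m_val by (simp add: P.prob_space)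
    finally have "\<bar>R n - real n * asym_var\<bar> \<le> real n * asym_var / sqrt (real n) + (sqrt (real n) + 1) * D\<^sup>2" .
    moreover have "(\<integral>\<^sup>+ p. ennreal ((?X p)\<^sup>2) \<partial>?M) = ennreal (R n)"
      unfolding R_def by (rule nn_integral_eq_integral[OF X_int]) auto
    ultimately show ?thesis by blast
  qed
  have "(\<lambda>n. R n / real n - asym_var) \<longlonglongrightarrow> 0"
  proof (rule Lim_null_comparison)
    show "\<forall>\<^sub>F n in sequentially. norm (R n / real n - asym_var)
        \<le> asym_var * (1 / sqrt (real n)) + D\<^sup>2 * (1 / sqrt (real n) + 1 / real n)"
      using eventually_gt_at_top[of 0]
    proof eventually_elim
      case (elim n)
      have sq: "sqrt (real n) / real n = 1 / sqrt (real n)"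
        using elim by (simp add: field_simps)
      have "\<bar>R n / real n - asym_var\<bar> = \<bar>R n - real n * asym_var\<bar> / real n"
      proof -
        have "R n / real n - asym_var = (R n - real n * asym_var) / real n"
          using elim by (simp add: diff_divide_distrib)
        then show ?thesis by (simp add: abs_divide)
      qed
      also have "\<dots> \<le> (real n * asym_var / sqrt (real n) + (sqrt (real n) + 1) * D\<^sup>2) / real n"
        using main[OF elim] by (intro divide_right_mono) auto
      also have "\<dots> = asym_var * (1 / sqrt (real n)) + D\<^sup>2 * (sqrt (real n) / real n + 1 / real n)"
        using elim by (simp add: field_simps)
      finally show ?case by (simp add: sq)
    qed
    have "(\<lambda>n. 1 / sqrt (real n)) \<longlonglongrightarrow> 0"
      by (intro tendsto_divide_0[OF tendsto_const] filterlim_at_top_imp_at_infinity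
        filterlim_compose[OF sqrt_at_top filterlim_real_sequentially])
    moreover have "(\<lambda>n. 1 / real n) \<longlonglongrightarrow> 0"
      by (intro tendsto_divide_0[OF tendsto_const] filterlim_at_top_imp_at_infinity filterlim_real_sequentially)
    ultimately have "(\<lambda>n. asym_var * (1 / sqrt (real n)) + D\<^sup>2 * (1 / sqrt (real n) + 1 / real n))
        \<longlonglongrightarrow> asym_var * 0 + D\<^sup>2 * (0 + 0)"
      by (intro tendsto_intros)
    then show "(\<lambda>n. asym_var * (1 / sqrt (real n)) + D\<^sup>2 * (1 / sqrt (real n) + 1 / real n)) \<longlonglongrightarrow> 0" by simp
  qed
  then have "(\<lambda>n. R n / real n) \<longlonglongrightarrow> asym_var" by (simp add: LIM_zero_iff)
  then have "(\<lambda>n. ennreal (R n / real n)) \<longlonglongrightarrow> ennreal asym_var" by (rule tendsto_ennrealI)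
  then show ?thesis
  proof (rule Lim_transform_eventually)
    show "\<forall>\<^sub>F n in sequentially. ennreal (R n / real n) = ennreal (1 / real n) *
        (\<integral>\<^sup>+ p. ennreal ((cocycle (fst p) (snd p) - real n * lyap)\<^sup>2) \<partial>(mu_pow n \<Otimes>\<^sub>M \<nu>))"
      using eventually_gt_at_top[of 0]
    proof eventually_elim
      case (elim n)
      have "0 \<le> R n" unfolding R_def by (intro integral_nonneg_AE AE_I2) auto
      then show ?case using main[OF elim] by (simp add: ennreal_mult[symmetric])
    qed
  qed
qed

lemma integral_iexp_cocycle_tendsto:
  "(\<lambda>n. \<integral> p. iexp (t * (1 / sqrt (real n) * (cocycle (fst p) (snd p) - real n * lyap))) \<partial>(mu_pow n \<Otimes>\<^sub>M \<nu>))
     \<longlonglongrightarrow> complex_of_real (exp (- (t\<^sup>2 * asym_var / 2)))"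
proof -
  define I where "I n = (\<integral> p. iexp (t * (1 / sqrt (real n) * (cocycle (fst p) (snd p) - real n * lyap)))
      \<partial>(mu_pow n \<Otimes>\<^sub>M \<nu>))" for n
  define J where "J n = (\<integral> p. iexp (t / sqrt (real n) * msum n (fst p) (snd p)) \<partial>(mu_pow n \<Otimes>\<^sub>M \<nu>))" for n
  have bound: "cmod (I n - J n) \<le> \<bar>t\<bar> * (2 * psi_bound) * (1 / sqrt (real n))" for n
  proof -
    interpret pair_prob_space "mu_pow n" \<nu> by (rule pair_prob_pow_nu)
    let ?M = "mu_pow n \<Otimes>\<^sub>M \<nu>"
    define a where "a p = t * (1 / sqrt (real n) * (cocycle (fst p) (snd p) - real n * lyap))" for p :: "(real^'n^'n) \<times> (real^'n)"
    define b where "b p = t / sqrt (real n) * msum n (fst p) (snd p)" for p :: "(real^'n^'n) \<times> (real^'n)"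
    have [measurable]: "a \<in> borel_measurable ?M" "b \<in> borel_measurable ?M"
      unfolding a_def[abs_def] b_def[abs_def] by measurable
    have int: "integrable ?M (\<lambda>p. iexp (a p))" "integrable ?M (\<lambda>p. iexp (b p))"
      by (intro P.integrable_const_bound[of _ 1]; auto)+
    have "I n - J n = (\<integral> p. iexp (a p) - iexp (b p) \<partial>?M)"
      unfolding I_def J_def a_def[symmetric] b_def[symmetric]
      by (rule Bochner_Integration.integral_diff[symmetric, OF int])
    also have "cmod \<dots> \<le> (\<integral> p. cmod (iexp (a p) - iexp (b p)) \<partial>?M)" by (rule integral_norm_bound)
    also have "\<dots> \<le> (\<integral> p. \<bar>t\<bar> * (2 * psi_bound) * (1 / sqrt (real n)) \<partial>?M)"
    proof (intro integral_mono integrable_norm Bochner_Integration.integrable_diff int P.integrable_const)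
      fix p assume p: "p \<in> space ?M"
      have "cmod (iexp (a p) - iexp (b p)) \<le> \<bar>a p - b p\<bar>" by (rule cmod_iexp_diff_le)
      also have "a p - b p = t / sqrt (real n) * ((cocycle (fst p) (snd p) - real n * lyap) - msum n (fst p) (snd p))"
      proof -
        have "t * (1 / q * X) - t / q * m = t / q * (X - m)" for q X m :: real
          by (simp add: right_diff_distrib diff_divide_distrib)
        then show ?thesis unfolding a_def b_def .
      qed
      also have "\<bar>\<dots>\<bar> = \<bar>t\<bar> / sqrt (real n) * \<bar>(cocycle (fst p) (snd p) - real n * lyap) - msum n (fst p) (snd p)\<bar>"
        by (simp add: abs_mult)
      also have "\<dots> \<le> \<bar>t\<bar> / sqrt (real n) * (2 * psi_bound)"
        using p by (intro mult_left_mono msum_approx) (auto simp: space_pair_measure space_mu_pow space_nu)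
      finally show "cmod (iexp (a p) - iexp (b p)) \<le> \<bar>t\<bar> * (2 * psi_bound) * (1 / sqrt (real n))"
        by (simp add: mult_ac)
    qed
    finally show ?thesis by (simp add: P.prob_space)
  qed
  have "(\<lambda>n. \<bar>t\<bar> * (2 * psi_bound) * (1 / sqrt (real n))) \<longlonglongrightarrow> 0"
    by (intro tendsto_mult_right_zero tendsto_divide_0[OF tendsto_const] filterlim_at_top_imp_at_infinity
        filterlim_compose[OF sqrt_at_top filterlim_real_sequentially])
  then have "(\<lambda>n. I n - J n) \<longlonglongrightarrow> 0"
    by (rule Lim_null_comparison[OF always_eventually[OF allI[OF bound]]])
  moreover have "J \<longlonglongrightarrow> complex_of_real (exp (- (t\<^sup>2 * asym_var / 2)))"
    unfolding J_def by (rule integral_iexp_msum_tendsto)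
  ultimately have "(\<lambda>n. (I n - J n) + J n) \<longlonglongrightarrow> 0 + complex_of_real (exp (- (t\<^sup>2 * asym_var / 2)))"
    by (rule tendsto_add)
  then show ?thesis by (simp add: I_def)
qed

lemma asym_var_zero_coboundary:
  assumes "asym_var = 0"
  shows "AE (g, x) in conv_pow \<mu> 1 \<Otimes>\<^sub>M \<nu>. cocycle g x - real 1 * lyap = psi x - psi (act g x)"
  unfolding mu_pow_1 using AE_incr_zero[OF assms] by eventually_elim (auto simp: incr_def)

lemma continuous_psi: "continuous_map simplex_top euclideanreal psi"
  by (rule continuous_map_gap_lipschitz[OF psi_props(3,1)])

end

section \<open>Normal laws\<close>

lemma normal_law_char:
  assumes "0 \<le> s2"
  shows "real_distribution (normal_law s2)"
    and "char (normal_law s2) t = complex_of_real (exp (- (t\<^sup>2 * s2 / 2)))"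
proof -
  have "real_distribution (normal_law s2)
    \<and> char (normal_law s2) t = complex_of_real (exp (- (t\<^sup>2 * s2 / 2)))"
  proof (cases "s2 = 0")
    case True
    interpret prob_space "return borel (0::real)" by (rule prob_space_return) simp
    have "real_distribution (distr (return borel (0::real)) borel (\<lambda>x. x))" by (rule real_distribution_distr) simp
    moreover have "distr (return borel (0::real)) borel (\<lambda>x. x) = return borel 0" by (subst distr_return) auto
    ultimately have "real_distribution (return borel (0::real))" by simp
    moreover have "char (return borel 0) t = 1" unfolding char_def by (subst integral_return) auto
    ultimately show ?thesis using True by (simp add: normal_law_def)
  next
    case False
    define \<sigma> where "\<sigma> = sqrt s2"
    have \<sigma>: "0 < \<sigma>" "\<sigma>\<^sup>2 = s2" using False assms by (auto simp: \<sigma>_def)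
    interpret N: real_distribution std_normal_distribution by (rule real_dist_normal_dist)
    have "distributed std_normal_distribution lborel (\<lambda>x. x) std_normal_density"
      unfolding distributed_def by (auto intro!: measure_eqI simp: emeasure_distr)
    from N.normal_density_affine[OF this, of \<sigma> 0] \<sigma>(1)
    have "distributed std_normal_distribution lborel (\<lambda>x. \<sigma> * x) (normal_density 0 \<sigma>)" by simp
    then have "distr std_normal_distribution lborel (\<lambda>x. \<sigma> * x) = density lborel (normal_density 0 \<sigma>)"
      by (simp add: distributed_def)
    moreover have "distr std_normal_distribution lborel (\<lambda>x. \<sigma> * x) = distr std_normal_distribution borel (\<lambda>x. \<sigma> * x)"
      by (rule distr_cong) auto
    ultimately have eq: "normal_law s2 = distr std_normal_distribution borel (\<lambda>x. \<sigma> * x)"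
      using False by (simp add: normal_law_def \<sigma>_def)
    have "char (normal_law s2) t = char std_normal_distribution (t * \<sigma>)"
      unfolding eq char_def by (subst integral_distr) (auto simp: mult_ac)
    also have "\<dots> = complex_of_real (exp (- (t\<^sup>2 * s2 / 2)))"
      by (simp add: char_std_normal_distribution power_mult_distrib \<sigma>(2))
    finally show ?thesis unfolding eq by (auto intro!: N.real_distribution_distr)
  qed
  then show "real_distribution (normal_law s2)"
    and "char (normal_law s2) t = complex_of_real (exp (- (t\<^sup>2 * s2 / 2)))" by auto
qed

section \<open>Random products\<close>

text \<open>The product as a function on the sequence space, which transfers independence of the factors
  to products.\<close>

lemma measurable_mat_prod_coordinates:
  assumes "{1..n} \<subseteq> I"
  shows "mat_prod (\<lambda>i (f :: nat \<Rightarrow> real^'n^'n). f i) n \<in> (\<Pi>\<^sub>M i\<in>I. mat_borel) \<rightarrow>\<^sub>M mat_borel"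
  using assms
proof (induction n)
  case 0
  then show ?case by (simp add: space_mat_borel mat_1_nonneg_mats cong: measurable_cong)
next
  case (Suc n)
  have sub: "{1..n} \<subseteq> I" "Suc n \<in> I" using Suc.prems by (force simp: subset_iff)+
  have [measurable]: "mat_prod (\<lambda>i (f :: nat \<Rightarrow> real^'n^'n). f i) n \<in> (\<Pi>\<^sub>M i\<in>I. mat_borel) \<rightarrow>\<^sub>M mat_borel"
    by (rule Suc.IH[OF sub(1)])
  have [measurable]: "(\<lambda>f :: nat \<Rightarrow> real^'n^'n. f (Suc n)) \<in> (\<Pi>\<^sub>M i\<in>I. mat_borel) \<rightarrow>\<^sub>M mat_borel"
    using sub(2) by (rule measurable_component_singleton)
  show ?case unfolding mat_prod.simps[abs_def] by measurable
qed

lemma mat_prod_restrict: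
  "{1..n} \<subseteq> I \<Longrightarrow> mat_prod Y n \<omega> = mat_prod (\<lambda>i f. f i) n (\<lambda>i\<in>I. Y i \<omega>)"
proof (induction n)
  case (Suc n)
  have "{1..n} \<subseteq> I" "Suc n \<in> I" using Suc.prems by (force simp: subset_iff)+
  then show ?case using Suc.IH by simp
qed simp

lemma distr_mat_prod:
  fixes Y :: "nat \<Rightarrow> 'w \<Rightarrow> real^'n^'n"
  assumes "prob_space M" and sets: "sets \<mu> = sets mat_borel"
    and indep: "prob_space.indep_vars M (\<lambda>_. mat_borel) Y {1..}"
    and law: "\<And>n. n \<ge> 1 \<Longrightarrow> distr M mat_borel (Y n) = \<mu>"
  shows "distr M mat_borel (mat_prod Y n) = conv_pow \<mu> n"
proof (induction n)
  case 0
  interpret prob_space M by fact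
  have "distr M mat_borel (\<lambda>_. mat 1) = return mat_borel (mat 1)"
    by (rule distr_const) (simp add: space_mat_borel mat_1_nonneg_mats)
  then show ?case by (simp add: fun_eq_iff)
next
  case (Suc n)
  interpret prob_space M by fact
  have "indep_var mat_borel ((\<lambda>f. f (Suc n)) \<circ> (\<lambda>\<omega>. \<lambda>i\<in>{Suc n}. Y i \<omega>))
      mat_borel (mat_prod (\<lambda>i f. f i) n \<circ> (\<lambda>\<omega>. \<lambda>i\<in>{1..n}. Y i \<omega>))"
    by (rule indep_var_compose[OF indep_var_restrict[OF indep]])
      (auto intro!: measurable_component_singleton measurable_mat_prod_coordinates)
  moreover have "(\<lambda>f. f (Suc n)) \<circ> (\<lambda>\<omega>. \<lambda>i\<in>{Suc n}. Y i \<omega>) = Y (Suc n)" by (simp add: o_def)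
  moreover have "mat_prod (\<lambda>i f. f i) n \<circ> (\<lambda>\<omega>. \<lambda>i\<in>{1..n}. Y i \<omega>) = mat_prod Y n"
    by (rule ext) (simp only: o_apply, rule mat_prod_restrict[OF order_refl, symmetric])
  ultimately have ind: "indep_var mat_borel (Y (Suc n)) mat_borel (mat_prod Y n)" by simp
  note eq = ind[unfolded indep_var_distribution_eq]
  have [measurable]: "Y (Suc n) \<in> M \<rightarrow>\<^sub>M mat_borel" "mat_prod Y n \<in> M \<rightarrow>\<^sub>M mat_borel" using eq by auto
  have "mat_prod Y (Suc n) = (\<lambda>(g, h). g ** h) \<circ> (\<lambda>\<omega>. (Y (Suc n) \<omega>, mat_prod Y n \<omega>))"
    by (simp add: fun_eq_iff)
  then have "distr M mat_borel (mat_prod Y (Suc n))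
      = distr M mat_borel ((\<lambda>(g, h). g ** h) \<circ> (\<lambda>\<omega>. (Y (Suc n) \<omega>, mat_prod Y n \<omega>)))" by simp
  also have "\<dots> = distr (distr M (mat_borel \<Otimes>\<^sub>M mat_borel) (\<lambda>\<omega>. (Y (Suc n) \<omega>, mat_prod Y n \<omega>)))
      mat_borel (\<lambda>(g, h). g ** h)"
    by (rule distr_distr[symmetric]) measurable
  also have "distr M (mat_borel \<Otimes>\<^sub>M mat_borel) (\<lambda>\<omega>. (Y (Suc n) \<omega>, mat_prod Y n \<omega>)) = \<mu> \<Otimes>\<^sub>M conv_pow \<mu> n"
    using eq Suc law[of "Suc n"] by simp
  finally show ?case by simp
qed

lemma distr_mat_prod_start:
  fixes Y :: "nat \<Rightarrow> 'w \<Rightarrow> real^'n^'n" and W :: "'w \<Rightarrow> real^'n"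
  assumes M: "prob_space M" and sets: "sets \<mu> = sets mat_borel"
    and indep: "prob_space.indep_vars M (\<lambda>_. mat_borel) Y {1..}"
    and law: "\<And>n. n \<ge> 1 \<Longrightarrow> distr M mat_borel (Y n) = \<mu>"
    and W: "W \<in> M \<rightarrow>\<^sub>M simplex_borel" "distr M simplex_borel W = \<nu>"
    and start: "indep_of_seq M W Y"
  shows "mat_prod Y n \<in> M \<rightarrow>\<^sub>M mat_borel"
    and "distr M (mat_borel \<Otimes>\<^sub>M simplex_borel) (\<lambda>\<omega>. (mat_prod Y n \<omega>, W \<omega>)) = conv_pow \<mu> n \<Otimes>\<^sub>M \<nu>"
proof -
  interpret prob_space M by fact
  have Y [measurable]: "Y i \<in> M \<rightarrow>\<^sub>M mat_borel" if "i \<ge> 1" for i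
    using indep that unfolding indep_vars_def by auto
  define S where "S = (\<lambda>\<omega>. \<lambda>i\<in>{1..}. Y i \<omega>)"
  have S [measurable]: "S \<in> M \<rightarrow>\<^sub>M (\<Pi>\<^sub>M i\<in>{1..}. mat_borel)"
    unfolding S_def by (rule measurable_restrict) (use Y in auto)
  have G: "mat_prod (\<lambda>i (f :: nat \<Rightarrow> real^'n^'n). f i) n \<in> (\<Pi>\<^sub>M i\<in>{1..}. mat_borel) \<rightarrow>\<^sub>M mat_borel"
    by (rule measurable_mat_prod_coordinates) auto
  have A: "mat_prod Y n \<omega> = mat_prod (\<lambda>i f. f i) n (S \<omega>)" for \<omega>
    unfolding S_def by (rule mat_prod_restrict) auto
  show meas: "mat_prod Y n \<in> M \<rightarrow>\<^sub>M mat_borel"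
    using measurable_compose[OF S G] by (simp add: A[abs_def])
  note W(1)[measurable] meas[measurable]
  have law_A: "distr M mat_borel (mat_prod Y n) = conv_pow \<mu> n" by (rule distr_mat_prod[OF M sets indep law])
  have pA: "prob_space (conv_pow \<mu> n)" unfolding law_A[symmetric] by (rule prob_space_distr) (rule meas)
  have pW: "prob_space \<nu>" unfolding W(2)[symmetric] by (rule prob_space_distr) (rule W)
  show "distr M (mat_borel \<Otimes>\<^sub>M simplex_borel) (\<lambda>\<omega>. (mat_prod Y n \<omega>, W \<omega>)) = conv_pow \<mu> n \<Otimes>\<^sub>M \<nu>"
  proof (rule sym, rule pair_measure_eqI)
    show "sigma_finite_measure (conv_pow \<mu> n)" "sigma_finite_measure \<nu>"
      using pA pW by (auto intro: prob_space_imp_sigma_finite)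
    show "sets (conv_pow \<mu> n \<Otimes>\<^sub>M \<nu>)
        = sets (distr M (mat_borel \<Otimes>\<^sub>M simplex_borel) (\<lambda>\<omega>. (mat_prod Y n \<omega>, W \<omega>)))"
      unfolding sets_distr law_A[symmetric] W(2)[symmetric] by (intro sets_pair_measure_cong) auto
    fix B C assume "B \<in> sets (conv_pow \<mu> n)" "C \<in> sets \<nu>"
    then have B [measurable]: "B \<in> sets mat_borel" and C [measurable]: "C \<in> sets simplex_borel"
      unfolding law_A[symmetric] W(2)[symmetric] by auto
    let ?b = "mat_prod Y n -` B \<inter> space M" and ?c = "W -` C \<inter> space M"
    have "?c \<in> sets (vimage_algebra (space M) W simplex_borel)" by (rule in_vimage_algebra[OF C])
    moreover have "?b \<in> sets (vimage_algebra (space M) S (\<Pi>\<^sub>M i\<in>{1..}. mat_borel))"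
    proof -
      have "S -` (mat_prod (\<lambda>i f. f i) n -` B \<inter> space (\<Pi>\<^sub>M i\<in>{1..}. mat_borel)) \<inter> space M = ?b"
        using measurable_space[OF S] by (auto simp: A)
      then show ?thesis using in_vimage_algebra[OF measurable_sets[OF G B], of S "space M"] by simp
    qed
    ultimately have "prob (?c \<inter> ?b) = prob ?c * prob ?b"
      using start unfolding indep_of_seq_def S_def[symmetric] by (intro indep_setD)
    moreover have "(\<lambda>\<omega>. (mat_prod Y n \<omega>, W \<omega>)) -` (B \<times> C) \<inter> space M = ?c \<inter> ?b" by auto
    ultimately show "emeasure (conv_pow \<mu> n) B * emeasure \<nu> C
        = emeasure (distr M (mat_borel \<Otimes>\<^sub>M simplex_borel) (\<lambda>\<omega>. (mat_prod Y n \<omega>, W \<omega>))) (B \<times> C)"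
      unfolding law_A[symmetric] W(2)[symmetric]
      by (simp add: emeasure_distr emeasure_eq_measure ennreal_mult mult.commute)
  qed
qed

section \<open>The central limit theorem\<close>

theorem proposition5p2:
  fixes \<mu> :: "(real^'n^'n) measure"
    and \<nu> :: "(real^'n) measure"
    and M :: "'w measure"
    and Y :: "nat \<Rightarrow> 'w \<Rightarrow> real^'n^'n"
    and W0 :: "'w \<Rightarrow> real^'n"
    and lam :: real
  assumes "CARD('n) \<ge> 2"
    and "prob_space \<mu>" and "sets \<mu> = sets mat_borel"
    and "strictly_contracting \<mu>"
    and "has_moment 2 \<mu>"
    and "invariant_prob \<mu> \<nu>"
    and "prob_space M"
    and "prob_space.indep_vars M (\<lambda>_. mat_borel) Y {1..}"
    and "\<And>n. n \<ge> 1 \<Longrightarrow> distr M mat_borel (Y n) = \<mu>"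
    and "W0 \<in> M \<rightarrow>\<^sub>M simplex_borel"
    and "distr M simplex_borel W0 = \<nu>"
    and "indep_of_seq M W0 Y"
    and "is_lyapunov M Y lam"
  shows "\<exists>s2\<ge>0.
      ((\<lambda>n. ennreal (1 / real n) *
            (\<integral>\<^sup>+ \<omega>. ennreal ((cocycle (mat_prod Y n \<omega>) (W0 \<omega>) - real n * lam)\<^sup>2) \<partial>M)) \<longlonglongrightarrow> ennreal s2)
    \<and> weak_conv_m
        (\<lambda>n. distr M borel (\<lambda>\<omega>. 1 / sqrt (real n) * (cocycle (mat_prod Y n \<omega>) (W0 \<omega>) - real n * lam)))
        (normal_law s2)
    \<and> ((\<nexists>m \<psi>. m \<ge> 1 \<and> continuous_map simplex_top euclideanreal \<psi> \<and>
          (AE (g, x) in conv_pow \<mu> m \<Otimes>\<^sub>M \<nu>. cocycle g x - real m * lam = \<psi> x - \<psi> (act g x)))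
        \<longrightarrow> s2 > 0)
    \<and> (aperiodic \<mu> \<longrightarrow> s2 > 0)"
proof -
  interpret positive_walk \<mu> \<nu> using assms(2-6) by (intro positive_walk.intro)
  interpret M: prob_space M by fact
  define A where "A = mat_prod Y"
  have A [measurable]: "A n \<in> M \<rightarrow>\<^sub>M mat_borel" for n
    unfolding A_def by (rule distr_mat_prod_start(1)[OF assms(7,3,8,9,10,11,12)])
  have W [measurable]: "W0 \<in> M \<rightarrow>\<^sub>M simplex_borel" by fact
  have law: "distr M (mat_borel \<Otimes>\<^sub>M simplex_borel) (\<lambda>\<omega>. (A n \<omega>, W0 \<omega>)) = mu_pow n \<Otimes>\<^sub>M \<nu>" for n
    unfolding A_def by (rule distr_mat_prod_start(2)[OF assms(7,3,8,9,10,11,12)])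
  have nn_law: "(\<integral>\<^sup>+ \<omega>. F (A n \<omega>, W0 \<omega>) \<partial>M) = (\<integral>\<^sup>+ p. F p \<partial>(mu_pow n \<Otimes>\<^sub>M \<nu>))"
    if [measurable]: "F \<in> borel_measurable (mat_borel \<Otimes>\<^sub>M simplex_borel)" for F :: "_ \<Rightarrow> ennreal" and n
    unfolding law[symmetric] by (subst nn_integral_distr) auto
  define Q where "Q n = (\<integral>\<^sup>+ \<omega>. ennreal ((cocycle (A n \<omega>) (W0 \<omega>) - real n * lyap)\<^sup>2) \<partial>M)" for n
  have Q_eq: "Q n = (\<integral>\<^sup>+ p. ennreal ((cocycle (fst p) (snd p) - real n * lyap)\<^sup>2) \<partial>(mu_pow n \<Otimes>\<^sub>M \<nu>))" for n
    unfolding Q_def by (subst nn_law[symmetric]) auto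
  have Q_lim: "(\<lambda>n. ennreal (1 / real n) * Q n) \<longlonglongrightarrow> ennreal asym_var"
    unfolding Q_eq by (rule second_moment_tendsto)

  \<comment> \<open>The averages of the cocycle along \<open>W0\<close> converge to \<open>lam\<close> almost surely, as \<open>W0\<close> almost surely has
    positive coordinates, and to \<open>lyap\<close> in the quadratic mean. Fatou's lemma identifies the limits.\<close>
  have lam: "lam = lyap"
  proof -
    define X where "X n \<omega> = ((1 / real n * cocycle (A n \<omega>) (W0 \<omega>)) - lyap)\<^sup>2" for n \<omega>
    let ?l = "\<lambda>n \<omega>. 1 / real n * ln (op_norm (A n \<omega>))" and ?c = "\<lambda>n \<omega>. 1 / real n * cocycle (A n \<omega>) (W0 \<omega>)"
    have X_meas [measurable]: "X n \<in> borel_measurable M" for n unfolding X_def[abs_def] by measurable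
    have pos: "AE \<omega> in M. W0 \<omega> \<in> face UNIV"
      using AE_nu_positive unfolding assms(11)[symmetric] by (rule AE_distrD[OF W])
    have "AE \<omega> in M. (\<lambda>n. ?l n \<omega>) \<longlonglongrightarrow> lam"
      using assms(13) by (simp add: is_lyapunov_def A_def)
    then have lim: "AE \<omega> in M. (\<lambda>n. ennreal (X n \<omega>)) \<longlonglongrightarrow> ennreal ((lam - lyap)\<^sup>2)"
      using pos AE_space
    proof eventually_elim
      case (elim \<omega>)
      have gA: "A n \<omega> \<in> nonneg_mats" for n using measurable_space[OF A elim(3)] by (simp add: space_mat_borel)
      define \<delta> where "\<delta> = Min (range (\<lambda>i. W0 \<omega> $ i))"
      have \<delta>: "0 < \<delta>" "\<And>i. \<delta> \<le> W0 \<omega> $ i" using elim(2) by (auto simp: \<delta>_def face_UNIV)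
      have W0: "W0 \<omega> \<in> prob_simplex" using elim(2) by (simp add: face_UNIV)
      have "(\<lambda>n. ?l n \<omega> - ?c n \<omega>) \<longlonglongrightarrow> 0"
      proof (rule Lim_null_comparison)
        show "\<forall>\<^sub>F n in sequentially. norm (?l n \<omega> - ?c n \<omega>)
            \<le> (- ln \<delta>) * (1 / real n)"
        proof (intro always_eventually allI)
          fix n
          have "norm (?l n \<omega> - ?c n \<omega>)
              = \<bar>ln (op_norm (A n \<omega>)) - cocycle (A n \<omega>) (W0 \<omega>)\<bar> * (1 / real n)"
          proof -
            have "?l n \<omega> - ?c n \<omega>
                = (ln (op_norm (A n \<omega>)) - cocycle (A n \<omega>) (W0 \<omega>)) * (1 / real n)"
              by (simp add: diff_divide_distrib)
            then show ?thesis by (simp only: real_norm_def abs_mult) simp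
          qed
          also have "\<dots> \<le> (- ln \<delta>) * (1 / real n)"
            by (intro mult_right_mono op_norm_cocycle gA W0 \<delta>) auto
          finally show "norm (?l n \<omega> - ?c n \<omega>)
              \<le> (- ln \<delta>) * (1 / real n)" .
        qed
        show "(\<lambda>n. (- ln \<delta>) * (1 / real n)) \<longlonglongrightarrow> 0"
          by (intro tendsto_mult_right_zero tendsto_divide_0[OF tendsto_const] filterlim_at_top_imp_at_infinity
              filterlim_real_sequentially)
      qed
      from tendsto_diff[OF elim(1) this]
      have "(\<lambda>n. ?c n \<omega>) \<longlonglongrightarrow> lam" by simp
      then have "(\<lambda>n. X n \<omega>) \<longlonglongrightarrow> (lam - lyap)\<^sup>2" unfolding X_def by (intro tendsto_intros)
      then show ?case by (rule tendsto_ennrealI)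
    qed
    have intX: "(\<integral>\<^sup>+ \<omega>. ennreal (X n \<omega>) \<partial>M) = ennreal (1 / real n) * (ennreal (1 / real n) * Q n)" if "0 < n" for n
    proof -
      have "X n \<omega> = (1 / real n) * ((1 / real n) * (cocycle (A n \<omega>) (W0 \<omega>) - real n * lyap)\<^sup>2)" for \<omega>
        using that by (simp add: X_def power2_eq_square field_simps)
      then have "ennreal (X n \<omega>) = ennreal (1 / real n) * (ennreal (1 / real n)
          * ennreal ((cocycle (A n \<omega>) (W0 \<omega>) - real n * lyap)\<^sup>2))" for \<omega>
        by (simp only: ennreal_mult' zero_le_divide_iff of_nat_0_le_iff zero_le_one simp_thms)
      then show ?thesis unfolding Q_def by (simp add: nn_integral_cmult)
    qed
    have "(\<lambda>n. ennreal (1 / real n)) \<longlonglongrightarrow> ennreal 0"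
      by (intro tendsto_ennrealI tendsto_divide_0[OF tendsto_const] filterlim_at_top_imp_at_infinity
          filterlim_real_sequentially)
    then have "(\<lambda>n. ennreal (1 / real n) * (ennreal (1 / real n) * Q n)) \<longlonglongrightarrow> ennreal 0 * ennreal asym_var"
      by (rule tendsto_mult_ennreal[OF _ Q_lim]) auto
    then have "(\<lambda>n. ennreal (1 / real n) * (ennreal (1 / real n) * Q n)) \<longlonglongrightarrow> 0" by simp
    then have "(\<lambda>n. \<integral>\<^sup>+ \<omega>. ennreal (X n \<omega>) \<partial>M) \<longlonglongrightarrow> 0"
      by (rule Lim_transform_eventually) (use eventually_gt_at_top[of 0] in \<open>eventually_elim, simp add: intX\<close>)
    then have liminf0: "liminf (\<lambda>n. \<integral>\<^sup>+ \<omega>. ennreal (X n \<omega>) \<partial>M) = 0"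
      by (rule lim_imp_Liminf[OF trivial_limit_sequentially])
    have "ennreal ((lam - lyap)\<^sup>2) = (\<integral>\<^sup>+ \<omega>. ennreal ((lam - lyap)\<^sup>2) \<partial>M)" by (simp add: M.emeasure_space_1)
    also have "\<dots> = (\<integral>\<^sup>+ \<omega>. liminf (\<lambda>n. ennreal (X n \<omega>)) \<partial>M)"
    proof (rule nn_integral_cong_AE)
      show "AE \<omega> in M. ennreal ((lam - lyap)\<^sup>2) = liminf (\<lambda>n. ennreal (X n \<omega>))"
        using lim by eventually_elim (rule lim_imp_Liminf[OF trivial_limit_sequentially, symmetric])
    qed
    also have "\<dots> \<le> liminf (\<lambda>n. \<integral>\<^sup>+ \<omega>. ennreal (X n \<omega>) \<partial>M)" by (rule nn_integral_liminf) measurable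
    finally show ?thesis using liminf0 by simp
  qed

  let ?Z = "\<lambda>n \<omega>. 1 / sqrt (real n) * (cocycle (A n \<omega>) (W0 \<omega>) - real n * lyap)"
    and ?z = "\<lambda>n p. 1 / sqrt (real n) * (cocycle (fst p) (snd p) - real n * lyap)"
  show ?thesis
  proof (intro exI[of _ asym_var] conjI impI)
    show "0 \<le> asym_var" by (rule asym_var_nonneg)
    show "(\<lambda>n. ennreal (1 / real n) *
        (\<integral>\<^sup>+ \<omega>. ennreal ((cocycle (mat_prod Y n \<omega>) (W0 \<omega>) - real n * lam)\<^sup>2) \<partial>M)) \<longlonglongrightarrow> ennreal asym_var"
      using Q_lim by (simp add: Q_def lam A_def)
    show "weak_conv_m
        (\<lambda>n. distr M borel (\<lambda>\<omega>. 1 / sqrt (real n) * (cocycle (mat_prod Y n \<omega>) (W0 \<omega>) - real n * lam)))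
        (normal_law asym_var)"
      unfolding lam A_def[symmetric]
    proof (rule levy_continuity)
      show "real_distribution (distr M borel (\<lambda>\<omega>. ?Z n \<omega>))" for n
        by (rule M.real_distribution_distr) measurable
      show "real_distribution (normal_law asym_var)" by (rule normal_law_char(1)[OF asym_var_nonneg])
      fix t
      have "char (distr M borel (\<lambda>\<omega>. ?Z n \<omega>)) t
          = (\<integral> p. iexp (t * ?z n p) \<partial>(mu_pow n \<Otimes>\<^sub>M \<nu>))" for n
      proof -
        have "char (distr M borel (\<lambda>\<omega>. ?Z n \<omega>)) t
            = (\<integral> \<omega>. iexp (t * ?Z n \<omega>) \<partial>M)"
          unfolding char_def by (rule integral_distr) measurable
        also have "\<dots> = (\<integral> p. iexp (t * ?z n p)
            \<partial>distr M (mat_borel \<Otimes>\<^sub>M simplex_borel) (\<lambda>\<omega>. (A n \<omega>, W0 \<omega>)))"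
          by (subst integral_distr) auto
        finally show ?thesis unfolding law .
      qed
      then show "(\<lambda>n. char (distr M borel (\<lambda>\<omega>. ?Z n \<omega>)) t)
          \<longlonglongrightarrow> char (normal_law asym_var) t"
        using integral_iexp_cocycle_tendsto[of t] by (simp only: normal_law_char(2)[OF asym_var_nonneg])
    qed
    show "0 < asym_var" if no: "\<nexists>m \<psi>. m \<ge> 1 \<and> continuous_map simplex_top euclideanreal \<psi> \<and>
        (AE (g, x) in conv_pow \<mu> m \<Otimes>\<^sub>M \<nu>. cocycle g x - real m * lam = \<psi> x - \<psi> (act g x))"
    proof -
      have "asym_var \<noteq> 0"
      proof
        assume "asym_var = 0"
        from asym_var_zero_coboundary[OF this] continuous_psi show False
          using no unfolding lam by blast
      qed
      then show ?thesis using asym_var_nonneg by simp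
    qed
    show "0 < asym_var" if "aperiodic \<mu>"
      using aperiodic_asym_var[OF that] asym_var_nonneg by simp
  qed
qed

end
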